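(* Let $I \subseteq \mathbb{R}$ be an open interval and let $J\subseteq I$ be a compact subinterval. Consider a curve of hyperbolic polynomials (not necessarily definable) $$P(t)(x) = x^n + \sum_{j=1}^n (-1)^j a_j(t)\, x^{n-j}, \qquad t\in I,$$ such that $E^{(\infty)}(P)=\emptyset$. Assume that for all $t\in J$ the following condition holds: for all $k\le h(T(P,t))-2$, the $k$-level of the rooted tree $T(P,t)$ contains at most one vertex with label $\ge 2$. Let $p\in\mathbb{N}_{>0}$. If the $a_j$ are $C^{p+\Gamma_J(P)}$, then the roots of $P$ can be parameterized by $C^{p+\gamma_J(P)}$ functions globally near $J$, i.e. there are an open interval $I'$ with $J\subseteq I'\subseteq I$ and functions $\lambda_1,\dots,\lambda_n:I'\to\mathbb{R}$ of class $C^{p+\gamma_J(P)}$ with $P(t)(x)=\prod_{j=1}^n(x-\lambda_j(t))$ for all $t\in I'$.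
   Context: A monic real polynomial is hyperbolic if all its roots are real; curves of polynomials have continuous coefficients. Multiplicity: for a continuous function $f$ defined near $t_0\in\mathbb{R}$, $m_{t_0}(f)\in\mathbb{N}\cup\{\infty\}$ is the supremum of all integers $q$ such that $f(t)=(t-t_0)^q g(t)$ near $t_0$ with $g$ continuous. For a monic polynomial $P$ of degree $n$ with roots $\lambda_1,\dots,\lambda_n$ (with multiplicity) and $1\le k\le n$ let $\tilde\Delta_k(P):=\sum_{i_1<\dots<i_k}\prod_{1\le a<b\le k}(\lambda_{i_a}-\lambda_{i_b})^2$, a polynomial in the coefficients of $P$ ($\tilde\Delta_1=n$). For a curve $P$, $E^{(\infty)}(P)$ is the set of all $t\in I$ such that, with $s$ maximal with the property that the germ at $t$ of $\tilde\Delta_s\circ P$ is not $0$, one has $m_t(\tilde\Delta_s\circ P)=\infty$. Definition of $\Gamma_{t_0}(P)$ and $\gamma_{t_0}(P)$, recursively, for a curve $P$ of monic hyperbolic polynomials defined near $t_0$: (I) If $P(t_0)$ has at least two distinct roots, factor $P(t)=P_1(t)P_2(t)$ near $t_0$ into curves of monic hyperbolic polynomials of positive degree with continuous coefficients (as regular as those of $P$) such that $P_1(t_0)$ and $P_2(t_0)$ have no common root, and set $\Gamma_{t_0}(P):=\max\{\Gamma_{t_0}(P_1),\Gamma_{t_0}(P_2)\}$ and $\gamma_{t_0}(P):=\Gamma_{t_0}(P)-\max\{\Gamma_{t_0}(P_1)-\gamma_{t_0}(P_1),\ \Gamma_{t_0}(P_2)-\gamma_{t_0}(P_2)\}$. (II)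 If $\deg P=n>1$ and all roots of $P(t_0)$ coincide, first replace $P(t)(x)$ by $P(t)(x+a_1(t)/n)$, so that $a_1=0$ identically (this by definition does not change $\Gamma_{t_0},\gamma_{t_0}$). If then $m_{t_0}(a_2)=2r<\infty$, write $a_k(t)=(t-t_0)^{kr}a_{(r),k}(t)$ with continuous $a_{(r),k}$, $2\le k\le n$, where $a_{(r),2}(t_0)\neq 0$, put $P_{(r)}(t)(x):=x^n+\sum_{k=2}^n(-1)^k a_{(r),k}(t)x^{n-k}$, and set $\Gamma_{t_0}(P):=\Gamma_{t_0}(P_{(r)})+n r$ and $\gamma_{t_0}(P):=\gamma_{t_0}(P_{(r)})+r$. If $m_{t_0}(a_2)=\infty$, set $\Gamma_{t_0}(P):=\gamma_{t_0}(P):=0$. (III) If $\deg P=1$, set $\Gamma_{t_0}(P):=\gamma_{t_0}(P):=0$. These integers are defined whenever the coefficients are differentiable enough for every step of the recursion to be possible; it suffices that the coefficients are $C^{\Gamma_{t_0}(P)+1}$ near $t_0$. The hypothesis that the $a_j$ are $C^{p+\Gamma_J(P)}$ includes that the recursion can be carried out at every $t_0\in J$. Put $$\Gamma_J(P):=\sup\{\Gamma_{t_0}(P):t_0\in J\},\qquad \gamma_J(P):=\Gamma_J(P)-\sup\{\Gamma_{t_0}(P)-\gamma_{t_0}(P):t_0\in J\},$$ with values in $\mathbb{N}\cup\{+\infty\}$, where $C^{p+\infty}:=C^\infty$ and $\gamma_J(P)$ is read as $+\infty$ if $\Gamma_J(P)=+\infty$. The tree $T(P,t_0)$: it is the rooted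 tree with vertices labeled by positive integers recording the gradual splitting of $P$ at $t_0$. The root is labeled $n=\deg P$. If $n=1$ the tree is this single vertex. If $n>1$ and $P(t_0)$ has distinct roots, factor $P=P_1\cdots P_l$ near $t_0$ with $l\geq 2$ such that all roots of each $P_i(t_0)$ coincide and the $P_i(t_0)$ have pairwise no common roots; the root of $T(P,t_0)$ has $l$ successors, which are the roots of the subtrees $T(P_i,t_0)$ (so are labeled $\deg P_i$). If $n>1$ and all roots of $P(t_0)$ coincide, reduce to $a_1=0$ as in (II); if $m_{t_0}(a_2)=2r<\infty$ set $T(P,t_0):=T(P_{(r)},t_0)$; if $a_2=0$ identically near $t_0$ (all roots of $P$ coincide identically near $t_0$), the root has $n$ successors, all leaves labeled $1$. Thus the labels of the successors of a vertex labeled $m$ form a partition of $m$ and all leaves are labeled $1$. The height $h(T)$ of a tree $T$ is the maximal length (number of edges) of a path connecting the root with a leaf; the $k$-level of $T$ is the set of all vertices at distance $k$ from the root. *)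

theory Defs
  imports
    "HOL-Analysis.Analysis"
    "HOL-Computational_Algebra.Polynomial"
begin

text \<open>
  Curves of polynomials are total functions of type \<open>real \<Rightarrow> real poly\<close>; all local notions at a
  point \<open>t0\<close> only depend on the germ of the curve at \<open>t0\<close>.
\<close>

section \<open>Regularity and multiplicity\<close>

text \<open>Functions of class \<open>C^k\<close>, \<open>k \<le> \<infinity>\<close>; meant for open sets \<open>S\<close>, on which \<open>deriv\<close> is the derivative
  within \<open>S\<close>.\<close>

definition Ck_on :: "enat \<Rightarrow> (real \<Rightarrow> real) \<Rightarrow> real set \<Rightarrow> bool" where
  "Ck_on k f S \<longleftrightarrow>
     (\<forall>j. enat j < k \<longrightarrow> (deriv ^^ j) f differentiable_on S) \<and>
     (\<forall>j. enat j \<le> k \<longrightarrow> continuous_on S ((deriv ^^ j) f))"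

definition mult_at :: "real \<Rightarrow> (real \<Rightarrow> real) \<Rightarrow> enat" where
  "mult_at t0 f =
     Sup {enat q |q. \<exists>e>0. \<exists>g. continuous_on (ball t0 e) g \<and>
                       (\<forall>t\<in>ball t0 e. f t = (t - t0) ^ q * g t)}"

definition germ_zero :: "real \<Rightarrow> (real \<Rightarrow> real) \<Rightarrow> bool" where
  "germ_zero t0 f \<longleftrightarrow> (\<forall>\<^sub>F t in nhds t0. f t = 0)"

section \<open>Hyperbolic polynomials\<close>

definition hyperbolic :: "real poly \<Rightarrow> bool" where
  "hyperbolic p \<longleftrightarrow> lead_coeff p = 1 \<and>
     (\<forall>z::complex. poly (map_poly complex_of_real p) z = 0 \<longrightarrow> z \<in> \<real>)"

text \<open>The polynomial \<open>x^n + (\<Sum>k=1..n. (-1)^k a_k x^(n-k))\<close>, and its coefficients \<open>a_k\<close>.\<close>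

definition monic_poly :: "nat \<Rightarrow> (nat \<Rightarrow> real) \<Rightarrow> real poly" where
  "monic_poly n a = monom 1 n + (\<Sum>k=1..n. monom ((-1) ^ k * a k) (n - k))"

definition acoeff :: "real poly \<Rightarrow> nat \<Rightarrow> real" where
  "acoeff p k = (-1) ^ k * coeff p (degree p - k)"

text \<open>\<open>p(x + a_1/n)\<close>, where \<open>n = degree p\<close>.\<close>

definition center :: "real poly \<Rightarrow> real poly" where
  "center p = pcompose p [: acoeff p 1 / real (degree p), 1 :]"

text \<open>For hyperbolic \<open>p\<close>, \<open>root_list p\<close> has length \<open>degree p\<close>; it lists the roots with multiplicity.\<close>

definition root_list :: "real poly \<Rightarrow> real list" where
  "root_list p = sorted_list_of_multiset (proots p)"

definition tilde_Delta :: "nat \<Rightarrow> real poly \<Rightarrow> real" where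
  "tilde_Delta k p =
     (\<Sum>A | A \<subseteq> {..<degree p} \<and> card A = k.
        \<Prod>(i, j) | i \<in> A \<and> j \<in> A \<and> i < j. (root_list p ! i - root_list p ! j)\<^sup>2)"

definition E_infinity :: "real set \<Rightarrow> (real \<Rightarrow> real poly) \<Rightarrow> real set" where
  "E_infinity I P =
     {t \<in> I. \<exists>s\<in>{1..degree (P t)}.
        \<not> germ_zero t (\<lambda>u. tilde_Delta s (P u)) \<and>
        (\<forall>k\<in>{s<..degree (P t)}. germ_zero t (\<lambda>u. tilde_Delta k (P u))) \<and>
        mult_at t (\<lambda>u. tilde_Delta s (P u)) = \<infinity>}"

section \<open>Factorization and rescaling of germs of curves\<close>

definition coeffs_Ck_near :: "enat \<Rightarrow> real \<Rightarrow> (real \<Rightarrow> real poly) \<Rightarrow> bool" where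
  "coeffs_Ck_near k t0 P \<longleftrightarrow> (\<exists>e>0. \<forall>i. Ck_on k (\<lambda>t. coeff (P t) i) (ball t0 e))"

definition hyperbolic_curve_near :: "real \<Rightarrow> nat \<Rightarrow> (real \<Rightarrow> real poly) \<Rightarrow> bool" where
  "hyperbolic_curve_near t0 n P \<longleftrightarrow>
     (\<forall>\<^sub>F t in nhds t0. hyperbolic (P t) \<and> degree (P t) = n) \<and> coeffs_Ck_near 0 t0 P"

definition distinct_roots :: "real poly \<Rightarrow> bool" where
  "distinct_roots p \<longleftrightarrow> (\<exists>x y. x \<noteq> y \<and> poly p x = 0 \<and> poly p y = 0)"

definition factors_near :: "real \<Rightarrow> (real \<Rightarrow> real poly) \<Rightarrow> (real \<Rightarrow> real poly) list \<Rightarrow> bool" where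
  "factors_near t0 P Qs \<longleftrightarrow>
     (\<forall>Q\<in>set Qs. (\<exists>m\<ge>1. hyperbolic_curve_near t0 m Q) \<and>
        (\<forall>k. coeffs_Ck_near k t0 P \<longrightarrow> coeffs_Ck_near k t0 Q)) \<and>
     (\<forall>\<^sub>F t in nhds t0. P t = (\<Prod>Q\<leftarrow>Qs. Q t)) \<and>
     (\<forall>j<length Qs. \<forall>i<j. \<nexists>x. poly ((Qs ! i) t0) x = 0 \<and> poly ((Qs ! j) t0) x = 0)"

text \<open>\<open>Q\<close> is the curve \<open>P\<^sub>(\<^sub>r\<^sub>)\<close> obtained from the centered curve, where \<open>a_2\<close> has multiplicity \<open>2r\<close>.\<close>

definition rescaled_near ::
  "real \<Rightarrow> nat \<Rightarrow> nat \<Rightarrow> (real \<Rightarrow> real poly) \<Rightarrow> (real \<Rightarrow> real poly) \<Rightarrow> bool" where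
  "rescaled_near t0 n r P Q \<longleftrightarrow>
     mult_at t0 (\<lambda>t. acoeff (center (P t)) 2) = enat (2 * r) \<and>
     (\<exists>b. (\<forall>k\<in>{2..n}. \<exists>e>0. continuous_on (ball t0 e) (b k) \<and>
             (\<forall>t\<in>ball t0 e. acoeff (center (P t)) k = (t - t0) ^ (k * r) * b k t)) \<and>
          b 2 t0 \<noteq> 0 \<and>
          Q = (\<lambda>t. monic_poly n (\<lambda>k. if k = 1 then 0 else b k t)))"

section \<open>The integers Gamma and gamma\<close>

text \<open>
  \<open>split_orders t0 P G g\<close>: the recursion can be carried out for \<open>P\<close> at \<open>t0\<close>, and it yields the values
  \<open>G\<close> and \<open>g\<close>. Both values are unique, since the rules only involve germs at \<open>t0\<close> and
  regrouping the factors does not affect the maxima. The subtractions do not truncate,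
  because \<open>g \<le> G\<close> throughout.
\<close>

inductive split_orders :: "real \<Rightarrow> (real \<Rightarrow> real poly) \<Rightarrow> nat \<Rightarrow> nat \<Rightarrow> bool" for t0 where
  split_orders_factor:
    "\<lbrakk> hyperbolic_curve_near t0 n P; distinct_roots (P t0); factors_near t0 P [P1, P2];
       split_orders t0 P1 G1 g1; split_orders t0 P2 G2 g2 \<rbrakk>
     \<Longrightarrow> split_orders t0 P (max G1 G2) (max G1 G2 - max (G1 - g1) (G2 - g2))"
| split_orders_rescale:
    "\<lbrakk> hyperbolic_curve_near t0 n P; n > 1; \<not> distinct_roots (P t0);
       rescaled_near t0 n r P Q; split_orders t0 Q G g \<rbrakk>
     \<Longrightarrow> split_orders t0 P (G + n * r) (g + r)"
| split_orders_flat: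
    "\<lbrakk> hyperbolic_curve_near t0 n P; n > 1; \<not> distinct_roots (P t0);
       mult_at t0 (\<lambda>t. acoeff (center (P t)) 2) = \<infinity> \<rbrakk>
     \<Longrightarrow> split_orders t0 P 0 0"
| split_orders_linear:
    "hyperbolic_curve_near t0 1 P \<Longrightarrow> split_orders t0 P 0 0"

definition Gamma_at :: "real \<Rightarrow> (real \<Rightarrow> real poly) \<Rightarrow> nat" where
  "Gamma_at t0 P = (THE G. \<exists>g. split_orders t0 P G g)"

definition gamma_at :: "real \<Rightarrow> (real \<Rightarrow> real poly) \<Rightarrow> nat" where
  "gamma_at t0 P = (THE g. \<exists>G. split_orders t0 P G g)"

definition Gamma_on :: "real set \<Rightarrow> (real \<Rightarrow> real poly) \<Rightarrow> enat" where
  "Gamma_on J P = (SUP t\<in>J. enat (Gamma_at t P))"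

definition gamma_on :: "real set \<Rightarrow> (real \<Rightarrow> real poly) \<Rightarrow> enat" where
  "gamma_on J P =
     (if Gamma_on J P = \<infinity> then \<infinity>
      else Gamma_on J P - (SUP t\<in>J. enat (Gamma_at t P - gamma_at t P)))"

section \<open>The splitting tree\<close>

text \<open>The order of the successors in the list carries no information.\<close>

datatype ltree = Node (label: nat) (succs: "ltree list")

fun height :: "ltree \<Rightarrow> nat" where
  "height (Node m Ts) = (if Ts = [] then 0 else Suc (Max (height ` set Ts)))"

text \<open>The labels of the vertices at distance \<open>k\<close> from the root, with repetitions.\<close>

fun level :: "nat \<Rightarrow> ltree \<Rightarrow> nat list" where
  "level 0 T = [label T]"
| "level (Suc k) T = concat (map (level k) (succs T))"

text \<open>\<open>splitting_tree t0 P T\<close>: \<open>T\<close> is the tree of \<open>P\<close> at \<open>t0\<close>. It is unique up to the order of successors.\<close>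

inductive splitting_tree :: "real \<Rightarrow> (real \<Rightarrow> real poly) \<Rightarrow> ltree \<Rightarrow> bool" for t0 where
  splitting_tree_linear:
    "hyperbolic_curve_near t0 1 P \<Longrightarrow> splitting_tree t0 P (Node 1 [])"
| splitting_tree_factor:
    "\<lbrakk> hyperbolic_curve_near t0 n P; n > 1; distinct_roots (P t0);
       factors_near t0 P Ps; length Ps \<ge> 2; \<forall>Q\<in>set Ps. \<not> distinct_roots (Q t0);
       list_all2 (splitting_tree t0) Ps Ts \<rbrakk>
     \<Longrightarrow> splitting_tree t0 P (Node n Ts)"
| splitting_tree_rescale:
    "\<lbrakk> hyperbolic_curve_near t0 n P; n > 1; \<not> distinct_roots (P t0);
       rescaled_near t0 n r P Q; splitting_tree t0 Q T \<rbrakk>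
     \<Longrightarrow> splitting_tree t0 P T"
| splitting_tree_coincide:
    "\<lbrakk> hyperbolic_curve_near t0 n P; n > 1; \<not> distinct_roots (P t0);
       germ_zero t0 (\<lambda>t. acoeff (center (P t)) 2) \<rbrakk>
     \<Longrightarrow> splitting_tree t0 P (Node n (replicate n (Node 1 [])))"

definition thin :: "ltree \<Rightarrow> bool" where
  "thin T \<longleftrightarrow> (\<forall>k. k + 2 \<le> height T \<longrightarrow> length (filter (\<lambda>m. m \<ge> 2) (level k T)) \<le> 1)"

end

theory Submission
  imports
    Defs
    "HOL-Computational_Algebra.Polynomial_Factorial"
    "HOL-Computational_Algebra.Field_as_Ring"
    "HOL-Computational_Algebra.Fundamental_Theorem_Algebra"
    "HOL-Combinatorics.Permutations"
begin

text \<open>Near a point \<open>t0\<close> the splitting tree yields continuous root functions whose pairwise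
  differences either vanish identically or have the form \<open>(t - t0)^e u(t)\<close> with \<open>u(t0) \<noteq> 0\<close>
  (\<open>splitting_tree_root_germs\<close>). The exponents, called contact orders below, determine the outcome of
  the recursion that defines \<open>\<Gamma>\<close> and \<open>\<gamma>\<close>: rescaling by \<open>(t - t0)^r\<close> lowers all of them by \<open>r\<close>, and
  splitting off a coprime factor separates two sets of roots whose mutual contact orders are \<open>0\<close>.
  Hence the two integers do not depend on the choices made along the recursion.

  The heart of the matter is to follow the differentiability of the roots through the recursion.
  Rescaling divides the \<open>k\<close>-th coefficient by \<open>(t - t0)^(k r)\<close>, which costs \<open>k r\<close> derivatives, but only
  at \<open>t0\<close> itself, and part of the loss is recovered when the roots are multiplied by \<open>(t - t0)^r\<close>
  again. The bookkeeping uses the weighted classes \<open>wCk t0 k s\<close>, which consist of the germs \<open>f\<close> for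
  which \<open>f, \<theta>f, ..., \<theta>^s f\<close> are of class \<open>C^k\<close>, where \<open>\<theta> = (t - t0) d/dt\<close>. Because \<open>\<theta>\<close> is a derivation,
  such a class is an algebra that is closed under inverses, and the coefficients of coprime factors
  inherit it from the coefficients of the product: their increments and derivatives solve linear
  systems with coefficients in the algebra (\<open>factor_wCk\<close>). Division by \<open>t - t0\<close> turns \<open>(k + 1, s)\<close> into \<open>(k, s + 1)\<close>
  (\<open>wCk_div_id\<close>), and multiplication by \<open>t - t0\<close> undoes this (\<open>wCk_mult_id\<close>). On the way down a
  rescaling step of degree \<open>n\<close> therefore moves \<open>n r\<close> units from \<open>k\<close> to \<open>s\<close>, and on the way back \<open>r\<close> of
  them return, so that the roots lose \<open>(n - 1) r\<close> derivatives in this step and \<open>\<Gamma> - \<gamma>\<close> in total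
  (\<open>split_orders_evaluates\<close>). As the weight \<open>s\<close> is carried along, the steps may follow one another.

  Close to \<open>t0\<close>, but away from it, two roots are either identical as germs or distinct, so \<open>\<Gamma>\<close> vanishes there;
  by compactness \<open>\<Gamma>\<close> is bounded on \<open>J\<close>, and one finite order of differentiability has to be treated.
  Local parameterizations are glued at points where the number of distinct roots is locally
  maximal. Near such a point roots that meet are identical, so that a permutation that matches the
  values of two parameterizations at this point matches their germs (\<open>parameterizes_glue\<close>).\<close>

section \<open>Germs of finite differentiability, and weighted germs\<close>

text \<open>The conditions are imposed at all points near \<open>t0\<close>. In this way the class depends on the germ
  only, and membership passes to nearby points.\<close>

primrec Ck_at :: "real \<Rightarrow> nat \<Rightarrow> (real \<Rightarrow> real) \<Rightarrow> bool" where
  "Ck_at t0 0 f \<longleftrightarrow> (\<forall>\<^sub>F t in nhds t0. isCont f t)"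
| "Ck_at t0 (Suc k) f \<longleftrightarrow> (\<forall>\<^sub>F t in nhds t0. f differentiable at t) \<and> Ck_at t0 k (deriv f)"

definition euler :: "real \<Rightarrow> (real \<Rightarrow> real) \<Rightarrow> real \<Rightarrow> real" where
  "euler t0 f = (\<lambda>t. (t - t0) * deriv f t)"

text \<open>The Euler operator \<open>\<theta> = (t - t0) d/dt\<close> takes the value \<open>0\<close> at \<open>t0\<close>, whatever \<open>deriv f t0\<close> is,
  so \<open>f\<close> has to be differentiable at nearby points other than \<open>t0\<close> only. A continuous
  germ \<open>f\<close> belongs to \<open>wCk t0 k s\<close> if and only if \<open>(t - t0)^s f\<close> is of class \<open>C^(k+s)\<close>.\<close>

primrec wCk :: "real \<Rightarrow> nat \<Rightarrow> nat \<Rightarrow> (real \<Rightarrow> real) \<Rightarrow> bool" where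
  "wCk t0 k 0 f \<longleftrightarrow> Ck_at t0 k f"
| "wCk t0 k (Suc s) f \<longleftrightarrow>
     Ck_at t0 k f \<and> (\<forall>\<^sub>F t in at t0. f differentiable at t) \<and> wCk t0 k s (euler t0 f)"

lemma eventually_nhdsI_at: "\<lbrakk>\<forall>\<^sub>F t in at (t0::real). Q t; Q t0\<rbrakk> \<Longrightarrow> \<forall>\<^sub>F t in nhds t0. Q t"
  by (simp add: eventually_nhds_conv_at)

lemma eventually_at_nhds: "\<forall>\<^sub>F t in nhds (t0::real). Q t \<Longrightarrow> \<forall>\<^sub>F t in at t0. Q t"
  by (simp add: eventually_nhds_conv_at)

lemma eventually_at_iterate:
  assumes "\<forall>\<^sub>F t in at (t0::real). Q t"
  shows "\<forall>\<^sub>F t in at t0. \<forall>\<^sub>F u in nhds t. Q u"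
proof -
  obtain S where S: "open S" "t0 \<in> S" "\<forall>x\<in>S. x \<noteq> t0 \<longrightarrow> Q x"
    using assms unfolding eventually_at_topological by auto
  have o: "open (S - {t0})" using S(1) by auto
  show ?thesis unfolding eventually_at_topological
  proof (intro exI conjI ballI impI)
    fix x assume "x \<in> S" "x \<noteq> t0"
    then have "\<forall>\<^sub>F u in nhds x. u \<in> S - {t0}"
      using o by (intro eventually_nhds_in_open) auto
    then show "\<forall>\<^sub>F u in nhds x. Q u"
      by (rule eventually_mono) (use S(3) in auto)
  qed (use S in auto)
qed

lemma deriv_cong_near:
  assumes "\<forall>\<^sub>F t in nhds t0. f t = g t"
  shows "\<forall>\<^sub>F t in nhds t0. deriv f t = deriv g t"
proof -
  have "\<forall>\<^sub>F t in nhds t0. \<forall>\<^sub>F u in nhds t. f u = g u"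
    using assms by (simp add: eventually_eventually)
  then show ?thesis by (rule eventually_mono) (auto intro: deriv_cong_ev)
qed

lemma isCont_cong_near: "\<forall>\<^sub>F u in nhds t. f u = g u \<Longrightarrow> isCont f t = isCont g t"
  for f g :: "real \<Rightarrow> real" by (rule isCont_cong)

lemma differentiable_cong_near:
  assumes "\<forall>\<^sub>F u in nhds t. f u = (g u :: real)"
  shows "(f differentiable (at t)) = (g differentiable (at (t::real)))"
  unfolding real_differentiable_def using DERIV_cong_ev[OF refl assms refl] by auto

lemma Ck_at_cong:
  assumes "\<forall>\<^sub>F t in nhds t0. f t = g t"
  shows "Ck_at t0 k f = Ck_at t0 k g"
  using assms
proof (induction k arbitrary: f g)
  case 0
  have ev: "\<forall>\<^sub>F t in nhds t0. \<forall>\<^sub>F u in nhds t. f u = g u"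
    using 0 by (simp add: eventually_eventually)
  have "(\<forall>\<^sub>F t in nhds t0. isCont f t) = (\<forall>\<^sub>F t in nhds t0. isCont g t)"
    by (rule eventually_cong[OF ev]) (erule isCont_cong_near)
  then show ?case by simp
next
  case (Suc k)
  have ev: "\<forall>\<^sub>F t in nhds t0. \<forall>\<^sub>F u in nhds t. f u = g u"
    using Suc.prems by (simp add: eventually_eventually)
  have "(\<forall>\<^sub>F t in nhds t0. f differentiable at t) = (\<forall>\<^sub>F t in nhds t0. g differentiable at t)"
    by (rule eventually_cong[OF ev]) (erule differentiable_cong_near)
  then show ?case using Suc.IH[OF deriv_cong_near[OF Suc.prems]] by simp
qed

lemma euler_cong:
  assumes "\<forall>\<^sub>F t in nhds t0. f t = g t"
  shows "\<forall>\<^sub>F t in nhds t0. euler t0 f t = euler t0 g t"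
  using deriv_cong_near[OF assms] by (rule eventually_mono) (simp add: euler_def)

lemma wCk_cong:
  assumes "\<forall>\<^sub>F t in nhds t0. f t = g t"
  shows "wCk t0 k s f = wCk t0 k s g"
  using assms
proof (induction s arbitrary: f g)
  case 0
  then show ?case by (simp add: Ck_at_cong)
next
  case (Suc s)
  have ev: "\<forall>\<^sub>F t in nhds t0. \<forall>\<^sub>F u in nhds t. f u = g u"
    using Suc.prems by (simp add: eventually_eventually)
  have "(\<forall>\<^sub>F t in at t0. f differentiable at t) = (\<forall>\<^sub>F t in at t0. g differentiable at t)"
    by (rule eventually_cong[OF eventually_at_nhds[OF ev]]) (erule differentiable_cong_near)
  then show ?case
    using Suc.IH[OF euler_cong[OF Suc.prems]] Ck_at_cong[OF Suc.prems] by simp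
qed

lemma Ck_at_imp_isCont: "Ck_at t0 k f \<Longrightarrow> \<forall>\<^sub>F t in nhds t0. isCont f t"
proof (cases k)
  case (Suc l)
  assume "Ck_at t0 k f"
  then have "\<forall>\<^sub>F t in nhds t0. f differentiable at t" using Suc by simp
  then show ?thesis
    by (rule eventually_mono) (auto simp: real_differentiable_def intro: DERIV_isCont)
qed simp

lemma Ck_at_Suc_imp: "Ck_at t0 (Suc k) f \<Longrightarrow> Ck_at t0 k f"
proof (induction k arbitrary: f)
  case 0
  from Ck_at_imp_isCont[OF this] show ?case by simp
next
  case (Suc k)
  then show ?case by (metis Ck_at.simps(2))
qed

lemma Ck_at_mono: "\<lbrakk>Ck_at t0 l f; k \<le> l\<rbrakk> \<Longrightarrow> Ck_at t0 k f"
  by (induction l) (auto simp: le_Suc_eq dest: Ck_at_Suc_imp simp del: Ck_at.simps)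

lemma wCk_imp_Ck_at: "wCk t0 k s f \<Longrightarrow> Ck_at t0 k f"
  by (cases s) auto

lemma wCk_imp_isCont: "wCk t0 k s f \<Longrightarrow> isCont f t0"
  using Ck_at_imp_isCont[OF wCk_imp_Ck_at] eventually_nhds_x_imp_x by blast

lemma wCk_Suc_imp: "wCk t0 k (Suc s) f \<Longrightarrow> wCk t0 k s f"
  by (induction s arbitrary: f) (metis wCk.simps)+

lemma Ck_at_const: "Ck_at t0 k (\<lambda>_. c)"
  by (induction k arbitrary: c) auto

lemma euler_const: "euler t0 (\<lambda>_. c) = (\<lambda>_. 0)"
  by (simp add: euler_def)

lemma wCk_const: "wCk t0 k s (\<lambda>_. c)"
  by (induction s arbitrary: c) (auto simp: Ck_at_const euler_const)

lemma deriv_simps: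
  fixes f g :: "real \<Rightarrow> real"
  assumes "f differentiable at t" "g differentiable at t"
  shows "deriv (\<lambda>t. f t + g t) t = deriv f t + deriv g t"
    "deriv (\<lambda>t. f t * g t) t = deriv f t * g t + f t * deriv g t"
proof -
  have D: "DERIV f t :> deriv f t" "DERIV g t :> deriv g t"
    using assms by (simp_all add: DERIV_deriv_iff_real_differentiable)
  show "deriv (\<lambda>t. f t + g t) t = deriv f t + deriv g t"
    by (intro DERIV_imp_deriv DERIV_add D)
  show "deriv (\<lambda>t. f t * g t) t = deriv f t * g t + f t * deriv g t"
    by (rule DERIV_imp_deriv, rule DERIV_cong[OF DERIV_mult[OF D]]) (simp add: algebra_simps)
qed

lemma deriv_inverse_real:
  fixes f :: "real \<Rightarrow> real"
  assumes "f differentiable at t" "f t \<noteq> 0"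
  shows "deriv (\<lambda>t. inverse (f t)) t = - 1 * deriv f t * (inverse (f t) * inverse (f t))"
proof -
  have D: "DERIV f t :> deriv f t"
    using assms by (simp_all add: DERIV_deriv_iff_real_differentiable)
  show ?thesis
    by (rule DERIV_imp_deriv, rule DERIV_cong[OF DERIV_inverse'[OF D assms(2)]]) simp
qed

lemma Ck_at_add: "\<lbrakk>Ck_at t0 k f; Ck_at t0 k g\<rbrakk> \<Longrightarrow> Ck_at t0 k (\<lambda>t. f t + g t)"
proof (induction k arbitrary: f g)
  case 0
  then have "\<forall>\<^sub>F t in nhds t0. isCont f t \<and> isCont g t" by (simp add: eventually_conj)
  then show ?case by (auto elim!: eventually_mono)
next
  case (Suc k)
  have ev: "\<forall>\<^sub>F t in nhds t0. f differentiable at t \<and> g differentiable at t"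
    using Suc.prems by (simp add: eventually_conj)
  have "\<forall>\<^sub>F t in nhds t0. deriv (\<lambda>t. f t + g t) t = deriv f t + deriv g t"
    using ev by (rule eventually_mono) (simp add: deriv_simps)
  from Ck_at_cong[OF this] have "Ck_at t0 k (deriv (\<lambda>t. f t + g t))"
    using Suc by auto
  moreover have "\<forall>\<^sub>F t in nhds t0. (\<lambda>t. f t + g t) differentiable at t"
    using ev by (rule eventually_mono) auto
  ultimately show ?case by simp
qed

lemma Ck_at_mult: "\<lbrakk>Ck_at t0 k f; Ck_at t0 k g\<rbrakk> \<Longrightarrow> Ck_at t0 k (\<lambda>t. f t * g t)"
proof (induction k arbitrary: f g)
  case 0
  then have "\<forall>\<^sub>F t in nhds t0. isCont f t \<and> isCont g t" by (simp add: eventually_conj)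
  then show ?case by (auto elim!: eventually_mono)
next
  case (Suc k)
  have ev: "\<forall>\<^sub>F t in nhds t0. f differentiable at t \<and> g differentiable at t"
    using Suc.prems by (simp add: eventually_conj)
  have "\<forall>\<^sub>F t in nhds t0. deriv (\<lambda>t. f t * g t) t = deriv f t * g t + f t * deriv g t"
    using ev by (rule eventually_mono) (simp add: deriv_simps)
  from Ck_at_cong[OF this] have "Ck_at t0 k (deriv (\<lambda>t. f t * g t))"
    using Suc.IH[of "deriv f" g] Suc.IH[of f "deriv g"] Suc.prems
      Suc.prems[THEN Ck_at_Suc_imp] by (auto intro!: Ck_at_add)
  moreover have "\<forall>\<^sub>F t in nhds t0. (\<lambda>t. f t * g t) differentiable at t"
    using ev by (rule eventually_mono) auto
  ultimately show ?case by simp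
qed

lemma isCont_nonzero_near:
  fixes f :: "real \<Rightarrow> real"
  assumes "isCont f t0" "f t0 \<noteq> 0" shows "\<forall>\<^sub>F t in nhds t0. f t \<noteq> 0"
proof (rule eventually_nhdsI_at)
  have "(f \<longlongrightarrow> f t0) (at t0)" using assms(1) by (simp add: isCont_def)
  then show "\<forall>\<^sub>F t in at t0. f t \<noteq> 0" using assms(2) by (rule tendsto_imp_eventually_ne)
qed (fact assms)

lemma differentiable_inverse_real:
  fixes f :: "real \<Rightarrow> real"
  assumes "f differentiable at t" "f t \<noteq> 0" shows "(\<lambda>t. inverse (f t)) differentiable at t"
  using assms DERIV_inverse' unfolding real_differentiable_def by blast

lemma Ck_at_inverse: "\<lbrakk>Ck_at t0 k f; f t0 \<noteq> 0\<rbrakk> \<Longrightarrow> Ck_at t0 k (\<lambda>t. inverse (f t))"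
proof (induction k)
  case 0
  then have "isCont f t0" using eventually_nhds_x_imp_x by fastforce
  then have "\<forall>\<^sub>F t in nhds t0. isCont f t \<and> f t \<noteq> 0"
    using 0 isCont_nonzero_near by (auto intro: eventually_conj)
  then show ?case by (auto elim!: eventually_mono intro: continuous_at_within_inverse)
next
  case (Suc k)
  have "isCont f t0" using Ck_at_imp_isCont[OF Suc.prems(1)] eventually_nhds_x_imp_x by blast
  then have ev: "\<forall>\<^sub>F t in nhds t0. f differentiable at t \<and> f t \<noteq> 0"
    using Suc.prems isCont_nonzero_near by (auto intro: eventually_conj)
  have "\<forall>\<^sub>F t in nhds t0. deriv (\<lambda>t. inverse (f t)) t
      = - 1 * deriv f t * (inverse (f t) * inverse (f t))"
    using ev by (rule eventually_mono) (rule deriv_inverse_real; simp)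
  from Ck_at_cong[OF this] have "Ck_at t0 k (deriv (\<lambda>t. inverse (f t)))"
    using Suc.IH[OF Ck_at_Suc_imp[OF Suc.prems(1)] Suc.prems(2)] Suc.prems(1)
    by (simp only: Ck_at.simps(2)) (intro Ck_at_mult Ck_at_const, simp_all)
  moreover have "\<forall>\<^sub>F t in nhds t0. (\<lambda>t. inverse (f t)) differentiable at t"
    using ev by (rule eventually_mono) (auto intro: differentiable_inverse_real)
  ultimately show ?case by simp
qed

lemma Ck_at_iff:
  "Ck_at t0 k f \<longleftrightarrow> (\<forall>j<k. \<forall>\<^sub>F t in nhds t0. (deriv ^^ j) f differentiable at t)
     \<and> (\<forall>\<^sub>F t in nhds t0. isCont ((deriv ^^ k) f) t)"
proof (induction k arbitrary: f)
  case (Suc k)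
  show ?case
    by (simp only: Ck_at.simps Suc.IH All_less_Suc2 funpow_Suc_right o_apply funpow_0 conj_assoc)
qed simp

lemma Ck_on_imp_Ck_at:
  assumes "Ck_on (enat k) f S" "open S" "t \<in> S"
  shows "Ck_at t k f"
proof -
  have S: "\<forall>\<^sub>F u in nhds t. u \<in> S" using assms(2,3) by (rule eventually_nhds_in_open)
  have "\<forall>\<^sub>F u in nhds t. (deriv ^^ j) f differentiable at u" if "j < k" for j
    using S
  proof (rule eventually_mono)
    fix u assume "u \<in> S"
    moreover have "(deriv ^^ j) f differentiable_on S"
      using assms(1) that unfolding Ck_on_def by (metis enat_ord_simps(2))
    ultimately show "(deriv ^^ j) f differentiable at u"
      using at_within_open[OF _ assms(2)] unfolding differentiable_on_def by metis
  qed
  moreover have "\<forall>\<^sub>F u in nhds t. isCont ((deriv ^^ k) f) u"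
    using S
  proof (rule eventually_mono)
    fix u assume "u \<in> S"
    moreover have "continuous_on S ((deriv ^^ k) f)" using assms(1) unfolding Ck_on_def by blast
    ultimately show "isCont ((deriv ^^ k) f) u"
      using continuous_on_eq_continuous_at[OF assms(2)] by blast
  qed
  ultimately show ?thesis unfolding Ck_at_iff by blast
qed

lemma Ck_at_imp_Ck_on:
  assumes "\<And>t. t \<in> S \<Longrightarrow> Ck_at t k f" "open S"
  shows "Ck_on (enat k) f S"
proof -
  have d: "(deriv ^^ j) f differentiable at t" if "j < k" "t \<in> S" for j t
    using assms(1)[OF that(2)] that(1) eventually_nhds_x_imp_x unfolding Ck_at_iff by blast
  have c: "isCont ((deriv ^^ k) f) t" if "t \<in> S" for t
    using assms(1)[OF that] eventually_nhds_x_imp_x unfolding Ck_at_iff by blast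
  have "isCont ((deriv ^^ j) f) t" if "j \<le> k" "t \<in> S" for j t
  proof (cases "j = k")
    case False
    then show ?thesis using d[of j t] that
      by (auto simp: real_differentiable_def intro: DERIV_isCont)
  qed (use c that in simp)
  then have "continuous_on S ((deriv ^^ j) f)" if "j \<le> k" for j
    using that continuous_on_eq_continuous_at[OF assms(2)] by blast
  moreover have "(deriv ^^ j) f differentiable_on S" if "j < k" for j
    using d[OF that] at_within_open[OF _ assms(2)] unfolding differentiable_on_def by metis
  ultimately show ?thesis unfolding Ck_on_def by simp
qed

text \<open>The derivative is taken with respect to the same variable at every point, so all conditions are
  open.\<close>

lemma Ck_at_near: "Ck_at t0 k f \<Longrightarrow> \<forall>\<^sub>F t in nhds t0. Ck_at t k f"
  by (induction k arbitrary: f) (simp_all add: eventually_eventually eventually_conj_iff)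

lemma euler_simps:
  assumes "\<forall>\<^sub>F t in at t0. f differentiable at t" "\<forall>\<^sub>F t in at t0. g differentiable at t"
  shows "\<forall>\<^sub>F t in nhds t0. euler t0 (\<lambda>t. f t + g t) t = euler t0 f t + euler t0 g t"
    "\<forall>\<^sub>F t in nhds t0. euler t0 (\<lambda>t. f t * g t) t = euler t0 f t * g t + f t * euler t0 g t"
proof -
  have ev: "\<forall>\<^sub>F t in at t0. f differentiable at t \<and> g differentiable at t"
    using assms by (simp add: eventually_conj)
  show "\<forall>\<^sub>F t in nhds t0. euler t0 (\<lambda>t. f t + g t) t = euler t0 f t + euler t0 g t"
    by (rule eventually_nhdsI_at, rule eventually_mono[OF ev])
       (auto simp: deriv_simps euler_def algebra_simps)
  show "\<forall>\<^sub>F t in nhds t0. euler t0 (\<lambda>t. f t * g t) t = euler t0 f t * g t + f t * euler t0 g t"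
    by (rule eventually_nhdsI_at, rule eventually_mono[OF ev])
       (auto simp: deriv_simps euler_def algebra_simps)
qed

lemma wCk_add: "\<lbrakk>wCk t0 k s f; wCk t0 k s g\<rbrakk> \<Longrightarrow> wCk t0 k s (\<lambda>t. f t + g t)"
proof (induction s arbitrary: f g)
  case 0
  then show ?case by (simp add: Ck_at_add)
next
  case (Suc s)
  have ev: "\<forall>\<^sub>F t in at t0. f differentiable at t \<and> g differentiable at t"
    using Suc.prems by (simp add: eventually_conj)
  have "wCk t0 k s (euler t0 (\<lambda>t. f t + g t))"
    using wCk_cong[OF euler_simps(1)] Suc by auto
  moreover have "\<forall>\<^sub>F t in at t0. (\<lambda>t. f t + g t) differentiable at t"
    using ev by (rule eventually_mono) auto
  ultimately show ?case using Suc.prems by (simp add: Ck_at_add)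
qed

lemma wCk_mult: "\<lbrakk>wCk t0 k s f; wCk t0 k s g\<rbrakk> \<Longrightarrow> wCk t0 k s (\<lambda>t. f t * g t)"
proof (induction s arbitrary: f g)
  case 0
  then show ?case by (simp add: Ck_at_mult)
next
  case (Suc s)
  have ev: "\<forall>\<^sub>F t in at t0. f differentiable at t \<and> g differentiable at t"
    using Suc.prems by (simp add: eventually_conj)
  have "wCk t0 k s (euler t0 (\<lambda>t. f t * g t))"
    using wCk_cong[OF euler_simps(2)] Suc Suc.prems[THEN wCk_Suc_imp] by (auto intro!: wCk_add)
  moreover have "\<forall>\<^sub>F t in at t0. (\<lambda>t. f t * g t) differentiable at t"
    using ev by (rule eventually_mono) auto
  ultimately show ?case using Suc.prems by (simp add: Ck_at_mult)
qed

lemma wCk_minus: "wCk t0 k s f \<Longrightarrow> wCk t0 k s (\<lambda>t. - f t)"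
  using wCk_mult[OF wCk_const[of t0 k s "- 1"], of f] by simp

lemma wCk_diff: "\<lbrakk>wCk t0 k s f; wCk t0 k s g\<rbrakk> \<Longrightarrow> wCk t0 k s (\<lambda>t. f t - g t)"
  using wCk_add[OF _ wCk_minus, of t0 k s f g] by simp

lemma wCk_inverse: "\<lbrakk>wCk t0 k s f; f t0 \<noteq> 0\<rbrakk> \<Longrightarrow> wCk t0 k s (\<lambda>t. inverse (f t))"
proof (induction s)
  case 0
  then show ?case by (simp add: Ck_at_inverse)
next
  case (Suc s)
  have ne: "\<forall>\<^sub>F t in nhds t0. f t \<noteq> 0"
    using wCk_imp_isCont[OF Suc.prems(1)] Suc.prems(2) by (rule isCont_nonzero_near)
  have ev: "\<forall>\<^sub>F t in at t0. f differentiable at t \<and> f t \<noteq> 0"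
    using Suc.prems eventually_at_nhds[OF ne] by (simp add: eventually_conj)
  have "\<forall>\<^sub>F t in nhds t0. euler t0 (\<lambda>t. inverse (f t)) t
      = - (euler t0 f t * (inverse (f t) * inverse (f t)))"
    by (rule eventually_nhdsI_at, rule eventually_mono[OF ev])
       (auto simp: deriv_inverse_real euler_def)
  from wCk_cong[OF this] have "wCk t0 k s (euler t0 (\<lambda>t. inverse (f t)))"
    using Suc wCk_Suc_imp[OF Suc.prems(1)] by (auto intro!: wCk_mult wCk_minus)
  moreover have "\<forall>\<^sub>F t in at t0. (\<lambda>t. inverse (f t)) differentiable at t"
    using ev by (rule eventually_mono) (auto intro: differentiable_inverse_real)
  ultimately show ?case using Suc.prems by (simp add: Ck_at_inverse)
qed

text \<open>One Euler derivative more costs an ordinary one: \<open>\<theta>(\<theta>^s f) = (t - t0) (\<theta>^s f)'\<close>.\<close>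

lemma wCk_trade: "wCk t0 (Suc k) s f \<Longrightarrow> wCk t0 k (Suc s) f"
proof (induction s arbitrary: f)
  case 0
  have "Ck_at t0 k (\<lambda>t. t - t0)"
  proof (cases k)
    case (Suc l)
    have "deriv (\<lambda>t. t - t0) = (\<lambda>_. 1)" by (auto intro!: DERIV_imp_deriv derivative_eq_intros)
    then show ?thesis using Suc by (auto simp: Ck_at_const)
  qed auto
  then show ?case
    using 0 Ck_at_Suc_imp[of t0 k f] eventually_at_nhds
    by (auto simp: euler_def intro: Ck_at_mult)
next
  case (Suc s)
  from Suc.prems show ?case using Suc.IH[of "euler t0 f"] Ck_at_Suc_imp[of t0 k f] by auto
qed

lemma wCk_trade_add: "wCk t0 (k + j) s f \<Longrightarrow> wCk t0 k (s + j) f"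
proof (induction j arbitrary: s)
  case (Suc j)
  then have "wCk t0 (k + j) (Suc s) f" by (intro wCk_trade) simp
  from Suc.IH[OF this] show ?case by simp
qed simp

text \<open>The commutation rule \<open>\<theta> f' = (\<theta> f)' - f'\<close> reduces the claim to fewer Euler derivatives.\<close>

lemma wCk_deriv: "wCk t0 (Suc k) s f \<Longrightarrow> wCk t0 k s (deriv f)"
proof (induction s arbitrary: f)
  case 0
  then show ?case by simp
next
  case (Suc s)
  have d: "Ck_at t0 (Suc k) (euler t0 f)" using Suc.prems wCk_imp_Ck_at[of t0 "Suc k" s] by (simp del: Ck_at.simps)
  have ef: "\<forall>\<^sub>F t in nhds t0. euler t0 f differentiable at t"
    using d by simp
  have f1: "Ck_at t0 k (deriv f)" using Suc.prems by auto
  have off: "\<forall>\<^sub>F t in at t0. deriv f differentiable at t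
      \<and> (t - t0) * deriv (deriv f) t = deriv (euler t0 f) t - deriv f t"
  proof -
    have "\<forall>\<^sub>F t in at t0. euler t0 f differentiable at t \<and> t \<noteq> t0"
      using eventually_at_nhds[OF ef] by (auto simp: eventually_at_filter elim: eventually_mono)
    then show ?thesis
    proof (rule eventually_mono)
      fix t assume t: "euler t0 f differentiable at t \<and> t \<noteq> t0"
      have e: "\<forall>\<^sub>F u in nhds t. inverse (u - t0) * euler t0 f u = deriv f u"
      proof -
        have "\<forall>\<^sub>F u in nhds t. u \<noteq> t0" using t
          by (intro t1_space_nhds) auto
        then show ?thesis by (rule eventually_mono) (auto simp: euler_def)
      qed
      have "(\<lambda>u. inverse (u - t0) * euler t0 f u) differentiable at t"
        using t by (intro differentiable_mult differentiable_inverse_real) auto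
      then have df: "deriv f differentiable at t" using differentiable_cong_near[OF e] by simp
      have "deriv (euler t0 f) t = deriv (\<lambda>u. (u - t0)) t * deriv f t + (t - t0) * deriv (deriv f) t"
        unfolding euler_def by (rule deriv_simps) (use df in auto)
      moreover have "deriv (\<lambda>u. (u - t0)) t = 1"
        by (auto intro!: DERIV_imp_deriv derivative_eq_intros)
      ultimately show "deriv f differentiable at t
        \<and> (t - t0) * deriv (deriv f) t = deriv (euler t0 f) t - deriv f t"
        using df by simp
    qed
  qed
  have at0: "deriv (euler t0 f) t0 = deriv f t0"
  proof (rule DERIV_imp_deriv)
    have "isCont (deriv f) t0" using Ck_at_imp_isCont[OF f1] eventually_nhds_x_imp_x by blast
    then show "DERIV (euler t0 f) t0 :> deriv f t0"
      unfolding euler_def by (subst CARAT_DERIV) (auto intro!: exI[of _ "deriv f"])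
  qed
  have "\<forall>\<^sub>F t in nhds t0. euler t0 (deriv f) t = deriv (euler t0 f) t - deriv f t"
    by (rule eventually_nhdsI_at, rule eventually_mono[OF off]) (auto simp: euler_def at0[unfolded euler_def])
  from wCk_cong[OF this] have "wCk t0 k s (euler t0 (deriv f))"
    using Suc.IH[of "euler t0 f"] Suc.IH[of f] Suc.prems wCk_Suc_imp[OF Suc.prems]
    by (auto intro!: wCk_diff)
  then show ?case using f1 off by (auto elim: eventually_mono)
qed

lemma deriv_off_center:
  fixes f g :: "real \<Rightarrow> real"
  assumes "isCont g t0" "\<forall>\<^sub>F t in nhds t0. f t = (t - t0) * g t"
  shows "DERIV f t0 :> g t0"
proof -
  have "DERIV (\<lambda>t. (t - t0) * g t) t0 :> g t0"
    using assms(1) by (subst CARAT_DERIV) (auto intro!: exI[of _ g])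
  then show ?thesis using DERIV_cong_ev[OF refl assms(2) refl] by simp
qed

text \<open>The derivative of \<open>(t - t0) g\<close> is \<open>g + \<theta> g\<close>, also at \<open>t0\<close>, where continuity of \<open>g\<close> suffices. This is
  the step in which a power of \<open>t - t0\<close> is turned back into differentiability.\<close>

lemma wCk_mult_id:
  assumes "wCk t0 k (Suc s) g"
  shows "wCk t0 (Suc k) s (\<lambda>t. (t - t0) * g t)"
  using assms
proof (induction s arbitrary: g)
  case (0 g)
  let ?f = "\<lambda>t. (t - t0) * g t"
  have D0: "DERIV ?f t0 :> g t0"
    using wCk_imp_isCont[OF 0] by (intro deriv_off_center) auto
  have off: "\<forall>\<^sub>F t in at t0. DERIV ?f t :> g t + euler t0 g t"
    using 0 by (auto elim!: eventually_mono simp: euler_def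
      DERIV_deriv_iff_real_differentiable[symmetric] intro!: derivative_eq_intros)
  have ev: "\<forall>\<^sub>F t in nhds t0. DERIV ?f t :> g t + euler t0 g t"
    by (rule eventually_nhdsI_at[OF off]) (use D0 in \<open>auto simp: euler_def\<close>)
  have "\<forall>\<^sub>F t in nhds t0. deriv ?f t = g t + euler t0 g t"
    using ev by (rule eventually_mono) (rule DERIV_imp_deriv)
  from Ck_at_cong[OF this] have "Ck_at t0 k (deriv ?f)" using 0 by (auto intro: Ck_at_add)
  moreover have "\<forall>\<^sub>F t in nhds t0. ?f differentiable at t"
    using ev by (rule eventually_mono) (auto simp: real_differentiable_def)
  ultimately show ?case by simp
next
  case (Suc s g)
  let ?f = "\<lambda>t. (t - t0) * g t"
  have 1: "wCk t0 (Suc k) s ?f" using Suc.IH wCk_Suc_imp[OF Suc.prems] by blast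
  have gd: "\<forall>\<^sub>F t in at t0. g differentiable at t" using Suc.prems by simp
  have off: "\<forall>\<^sub>F t in at t0. DERIV ?f t :> g t + euler t0 g t"
    using gd by (auto elim!: eventually_mono simp: euler_def
      DERIV_deriv_iff_real_differentiable[symmetric] intro!: derivative_eq_intros)
  have "\<forall>\<^sub>F t in nhds t0. euler t0 ?f t = (t - t0) * (g t + euler t0 g t)"
    by (rule eventually_nhdsI_at, rule eventually_mono[OF off])
       (auto simp: euler_def dest!: DERIV_imp_deriv)
  from wCk_cong[OF this]
  have eq: "wCk t0 (Suc k) s (euler t0 ?f) = wCk t0 (Suc k) s (\<lambda>t. (t - t0) * (g t + euler t0 g t))" .
  have "wCk t0 k (Suc s) (euler t0 g)" using Suc.prems by (simp only: wCk.simps(2))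
  from Suc.IH[OF wCk_add[OF wCk_Suc_imp[OF Suc.prems] this]] have "wCk t0 (Suc k) s (euler t0 ?f)"
    by (simp only: eq)
  moreover have "\<forall>\<^sub>F t in at t0. ?f differentiable at t"
    using off by (rule eventually_mono) (auto simp: real_differentiable_def)
  ultimately show ?case using wCk_imp_Ck_at[OF 1] by simp
qed

text \<open>A substitute for Hadamard's integral formula. The derivative \<open>v = w'\<close> of a solution of
  \<open>\<theta> w + j w = \<phi>\<close> solves \<open>\<theta> v + (j + 1) v = \<phi>'\<close>, an equation of the same kind with a right-hand side
  that is one order less smooth. All that has to be shown is that \<open>v\<close> has a limit at \<open>t0\<close>; this
  follows from l'Hopital's rule, because \<open>(t - t0)^(j+1) v\<close> has the derivative \<open>(t - t0)^j \<phi>'\<close>.\<close>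

lemma Ck_at_euler_equation:
  assumes "Ck_at t0 k \<phi>" "isCont w t0" "\<forall>\<^sub>F t in at t0. w differentiable at t"
    "\<forall>\<^sub>F t in at t0. euler t0 w t + real j * w t = \<phi> t" "j \<ge> 1"
  shows "Ck_at t0 k w"
  using assms
proof (induction k arbitrary: \<phi> w j)
  case 0
  have "\<forall>\<^sub>F t in at t0. isCont w t"
    using 0(3) by (rule eventually_mono) (auto simp: real_differentiable_def intro: DERIV_isCont)
  then show ?case using 0(2) by (simp add: eventually_nhdsI_at)
next
  case (Suc k)
  define v where "v = deriv w"
  have ne: "\<forall>\<^sub>F t in at t0. t \<noteq> t0" by (auto simp: eventually_at_filter)
  have \<phi>d: "\<forall>\<^sub>F t in nhds t0. \<phi> differentiable at t" and \<phi>': "Ck_at t0 k (deriv \<phi>)"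
    using Suc.prems(1) by auto
  have \<phi>c: "isCont \<phi> t0" using Ck_at_imp_isCont[OF Suc.prems(1)] eventually_nhds_x_imp_x by blast
  have \<phi>'c: "isCont (deriv \<phi>) t0" using Ck_at_imp_isCont[OF \<phi>'] eventually_nhds_x_imp_x by blast
  have eq: "\<forall>\<^sub>F t in at t0. \<forall>\<^sub>F u in nhds t. u \<noteq> t0 \<and> w differentiable at u \<and>
      euler t0 w u + real j * w u = \<phi> u \<and> \<phi> differentiable at u"
    using ne Suc.prems(3,4) eventually_at_nhds[OF \<phi>d]
    by (intro eventually_at_iterate eventually_conj)
  have vd: "\<forall>\<^sub>F t in at t0. t \<noteq> t0 \<and> w differentiable at t \<and> v differentiable at t \<and>
      (t - t0) * v t = \<phi> t - real j * w t \<and> (t - t0) * deriv v t + real (Suc j) * v t = deriv \<phi> t"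
    using eq
  proof (rule eventually_mono)
    fix t assume *: "\<forall>\<^sub>F u in nhds t. u \<noteq> t0 \<and> w differentiable at u \<and>
      euler t0 w u + real j * w u = \<phi> u \<and> \<phi> differentiable at u"
    then have t: "t \<noteq> t0" "w differentiable at t" "\<phi> differentiable at t"
      "euler t0 w t + real j * w t = \<phi> t"
      using eventually_nhds_x_imp_x by fastforce+
    have e: "\<forall>\<^sub>F u in nhds t. inverse (u - t0) * (\<phi> u - real j * w u) = v u"
      using * by (rule eventually_mono) (auto simp: euler_def v_def field_simps)
    have "(\<lambda>u. inverse (u - t0) * (\<phi> u - real j * w u)) differentiable at t"
      using t by (intro differentiable_mult differentiable_inverse_real differentiable_diff) auto
    then have dv: "v differentiable at t" using differentiable_cong_near[OF e] by simp
    have D: "DERIV w t :> v t" "DERIV v t :> deriv v t"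
      using t dv by (simp_all add: v_def DERIV_deriv_iff_real_differentiable)
    have "DERIV (\<lambda>u. (u - t0) * v u + real j * w u) t :> v t + (t - t0) * deriv v t + real j * v t"
      by (rule derivative_eq_intros D refl | simp)+
    moreover have "\<forall>\<^sub>F u in nhds t. (u - t0) * v u + real j * w u = \<phi> u"
      using * by (rule eventually_mono) (auto simp: euler_def v_def)
    ultimately have "DERIV \<phi> t :> v t + (t - t0) * deriv v t + real j * v t"
      using DERIV_cong_ev[OF refl, of "\<lambda>u. (u - t0) * v u + real j * w u" \<phi> t _ _] by blast
    then have "deriv \<phi> t = v t + (t - t0) * deriv v t + real j * v t" by (rule DERIV_imp_deriv)
    then show "t \<noteq> t0 \<and> w differentiable at t \<and> v differentiable at t \<and>
      (t - t0) * v t = \<phi> t - real j * w t \<and> (t - t0) * deriv v t + real (Suc j) * v t = deriv \<phi> t"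
      using t dv by (auto simp: euler_def v_def algebra_simps)
  qed
  have lim1: "((\<lambda>t. (t - t0) * v t) \<longlongrightarrow> \<phi> t0 - real j * w t0) (at t0)"
  proof (rule Lim_transform_eventually)
    show "((\<lambda>t. \<phi> t - real j * w t) \<longlongrightarrow> \<phi> t0 - real j * w t0) (at t0)"
      using \<phi>c Suc.prems(2) by (auto simp: isCont_def intro!: tendsto_intros)
    show "\<forall>\<^sub>F t in at t0. \<phi> t - real j * w t = (t - t0) * v t"
      using vd by (rule eventually_mono) auto
  qed
  obtain i where i: "j = Suc i" using Suc.prems(5) by (cases j) auto
  \<comment> \<open>The rule applies as \<open>(t - t0)^(j+1) v = (t - t0)^j (\<phi> - j w)\<close> tends to \<open>0\<close>, where \<open>j \<ge> 1\<close> is needed.\<close>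
  have limv: "(v \<longlongrightarrow> deriv \<phi> t0 / real (Suc j)) (at t0)"
  proof (rule Lim_transform_eventually)
    show "((\<lambda>t. ((t - t0) ^ Suc j * v t) / (t - t0) ^ Suc j) \<longlongrightarrow> deriv \<phi> t0 / real (Suc j)) (at t0)"
    proof (rule lhopital)
      have "((\<lambda>t. (t - t0) ^ j * ((t - t0) * v t)) \<longlongrightarrow> (t0 - t0) ^ j * (\<phi> t0 - real j * w t0)) (at t0)"
        by (intro tendsto_mult lim1 tendsto_intros)
      then show "((\<lambda>t. (t - t0) ^ Suc j * v t) \<longlongrightarrow> 0) (at t0)"
        by (simp add: i mult.commute mult.left_commute)
      have "((\<lambda>t. (t - t0) ^ Suc j) \<longlongrightarrow> (t0 - t0) ^ Suc j) (at t0)" by (intro tendsto_intros)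
      then show "((\<lambda>t. (t - t0) ^ Suc j) \<longlongrightarrow> 0) (at t0)" by simp
      show "\<forall>\<^sub>F t in at t0. (t - t0) ^ Suc j \<noteq> 0" using ne by (rule eventually_mono) auto
      show "\<forall>\<^sub>F t in at t0. real (Suc j) * (t - t0) ^ j \<noteq> 0" using ne by (rule eventually_mono) auto
      show "\<forall>\<^sub>F t in at t0. DERIV (\<lambda>t. (t - t0) ^ Suc j) t :> real (Suc j) * (t - t0) ^ j"
      proof (intro always_eventually allI)
        fix t
        have "DERIV (\<lambda>t. t - t0) t :> 1" by (auto intro!: derivative_eq_intros)
        from DERIV_power[OF this, of "Suc j"]
        show "DERIV (\<lambda>t. (t - t0) ^ Suc j) t :> real (Suc j) * (t - t0) ^ j" by simp
      qed
      show "\<forall>\<^sub>F t in at t0. DERIV (\<lambda>t. (t - t0) ^ Suc j * v t) t :> (t - t0) ^ j * deriv \<phi> t"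
        using vd
      proof (rule eventually_mono, elim conjE)
        fix t assume t: "v differentiable at t" "(t - t0) * deriv v t + real (Suc j) * v t = deriv \<phi> t"
        have D: "DERIV v t :> deriv v t"
          using t by (simp add: DERIV_deriv_iff_real_differentiable)
        have "DERIV (\<lambda>t. (t - t0) ^ Suc j * v t) t
            :> (real (Suc j) * (t - t0) ^ j) * v t + (t - t0) ^ Suc j * deriv v t"
          by (rule derivative_eq_intros D refl | simp)+
        then show "DERIV (\<lambda>t. (t - t0) ^ Suc j * v t) t :> (t - t0) ^ j * deriv \<phi> t"
          by (rule DERIV_cong) (simp add: t(2)[symmetric] algebra_simps)
      qed
      show "((\<lambda>t. (t - t0) ^ j * deriv \<phi> t / (real (Suc j) * (t - t0) ^ j)) \<longlongrightarrow> deriv \<phi> t0 / real (Suc j)) (at t0)"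
      proof (rule Lim_transform_eventually)
        show "((\<lambda>t. deriv \<phi> t / real (Suc j)) \<longlongrightarrow> deriv \<phi> t0 / real (Suc j)) (at t0)"
          using \<phi>'c unfolding isCont_def by (intro tendsto_intros) auto
        show "\<forall>\<^sub>F t in at t0. deriv \<phi> t / real (Suc j) = (t - t0) ^ j * deriv \<phi> t / (real (Suc j) * (t - t0) ^ j)"
          using ne by (rule eventually_mono) auto
      qed
    qed
    show "\<forall>\<^sub>F t in at t0. (t - t0) ^ Suc j * v t / (t - t0) ^ Suc j = v t"
      using ne by (rule eventually_mono) auto
  qed
  \<comment> \<open>A continuous function whose derivative has a limit at \<open>t0\<close> is differentiable there.\<close>
  have Dw: "DERIV w t0 :> deriv \<phi> t0 / real (Suc j)"
    unfolding has_field_derivative_iff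
  proof (rule lhopital)
    show "((\<lambda>t. w t - w t0) \<longlongrightarrow> 0) (at t0)"
      using Suc.prems(2) unfolding isCont_def by (auto intro: tendsto_eq_intros)
    show "((\<lambda>t. t - t0) \<longlongrightarrow> 0) (at t0)" by (auto intro!: tendsto_eq_intros)
    show "\<forall>\<^sub>F t in at t0. t - t0 \<noteq> 0" using ne by (rule eventually_mono) auto
    show "\<forall>\<^sub>F t in at t0. (1::real) \<noteq> 0" by simp
    show "\<forall>\<^sub>F t in at t0. DERIV (\<lambda>t. w t - w t0) t :> v t"
      using vd by (rule eventually_mono)
        (auto simp: v_def DERIV_deriv_iff_real_differentiable[symmetric] intro!: derivative_eq_intros)
    show "\<forall>\<^sub>F t in at t0. DERIV (\<lambda>t. t - t0) t :> 1"
      by (intro always_eventually allI) (auto intro!: derivative_eq_intros)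
    show "((\<lambda>x. v x / 1) \<longlongrightarrow> deriv \<phi> t0 / real (Suc j)) (at t0)" using limv by simp
  qed
  have v0: "v t0 = deriv \<phi> t0 / real (Suc j)" using Dw by (simp add: v_def DERIV_imp_deriv)
  have "Ck_at t0 k v"
  proof (rule Suc.IH[OF \<phi>'])
    show "isCont v t0" using limv by (simp add: isCont_def v0)
    show "\<forall>\<^sub>F t in at t0. v differentiable at t" using vd by (rule eventually_mono) auto
    show "\<forall>\<^sub>F t in at t0. euler t0 v t + real (Suc j) * v t = deriv \<phi> t"
      using vd by (rule eventually_mono) (auto simp: euler_def)
  qed simp
  moreover have "\<forall>\<^sub>F t in nhds t0. w differentiable at t"
    by (rule eventually_nhdsI_at[OF Suc.prems(3)]) (use Dw in \<open>auto simp: real_differentiable_def\<close>)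
  ultimately show ?case by (simp add: v_def)
qed

text \<open>If \<open>f = (t - t0) g\<close>, then \<open>\<theta> g + g = f'\<close>. The equation shows that \<open>g\<close> is of class \<open>C^k\<close>, and then it
  expresses \<open>\<theta> g\<close> by functions that are already under control.\<close>

lemma wCk_div_id:
  assumes "wCk t0 (Suc k) s f" "\<forall>\<^sub>F t in nhds t0. f t = (t - t0) * g t" "isCont g t0"
  shows "wCk t0 k (Suc s) g"
proof -
  have f1: "Ck_at t0 (Suc k) f" using assms(1) by (rule wCk_imp_Ck_at)
  have ne: "\<forall>\<^sub>F t in at t0. t \<noteq> t0" by (auto simp: eventually_at_filter)
  have fd: "\<forall>\<^sub>F t in nhds t0. f differentiable at t" using f1 by simp
  have "\<forall>\<^sub>F t in at t0. \<forall>\<^sub>F u in nhds t. u \<noteq> t0 \<and> f u = (u - t0) * g u \<and> f differentiable at u"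
    using ne eventually_at_nhds[OF assms(2)] eventually_at_nhds[OF fd]
    by (intro eventually_at_iterate eventually_conj)
  then have off: "\<forall>\<^sub>F t in at t0. g differentiable at t \<and> euler t0 g t + g t = deriv f t"
  proof (rule eventually_mono)
    fix t assume *: "\<forall>\<^sub>F u in nhds t. u \<noteq> t0 \<and> f u = (u - t0) * g u \<and> f differentiable at u"
    then have t: "t \<noteq> t0" "f differentiable at t" using eventually_nhds_x_imp_x by fastforce+
    have e: "\<forall>\<^sub>F u in nhds t. inverse (u - t0) * f u = g u"
      using * by (rule eventually_mono) (auto simp: field_simps)
    have "(\<lambda>u. inverse (u - t0) * f u) differentiable at t"
      using t by (intro differentiable_mult differentiable_inverse_real) auto
    then have dg: "g differentiable at t" using differentiable_cong_near[OF e] by simp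
    have e2: "\<forall>\<^sub>F u in nhds t. f u = (u - t0) * g u" using * by (rule eventually_mono) auto
    have "deriv f t = deriv (\<lambda>u. (u - t0) * g u) t" by (rule deriv_cong_ev[OF e2 refl])
    also have "\<dots> = deriv (\<lambda>u. (u - t0)) t * g t + (t - t0) * deriv g t"
      by (rule deriv_simps) (use dg in auto)
    also have "deriv (\<lambda>u. (u - t0)) t = 1"
      by (auto intro!: DERIV_imp_deriv derivative_eq_intros)
    finally show "g differentiable at t \<and> euler t0 g t + g t = deriv f t"
      using dg by (simp add: euler_def)
  qed
  have g0: "Ck_at t0 k g"
  proof (rule Ck_at_euler_equation[where j = 1 and \<phi> = "deriv f"])
    show "Ck_at t0 k (deriv f)" using f1 by simp
  qed (use off assms(3) in \<open>auto elim: eventually_mono\<close>)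
  have gd: "\<forall>\<^sub>F t in at t0. g differentiable at t" using off by (rule eventually_mono) auto
  have f0: "deriv f t0 = g t0" using deriv_off_center[OF assms(3,2)] by (rule DERIV_imp_deriv)
  have eu: "\<forall>\<^sub>F t in nhds t0. euler t0 g t = deriv f t - g t"
    by (rule eventually_nhdsI_at, rule eventually_mono[OF off]) (use f0 in \<open>auto simp: euler_def\<close>)
  have "wCk t0 k s g \<Longrightarrow> wCk t0 k s (deriv f) \<Longrightarrow> wCk t0 k (Suc s) g" for s
    using wCk_cong[OF eu, of k s] g0 gd
    by (auto intro!: wCk_diff)
  note step = this
  have "wCk t0 (Suc k) s f \<Longrightarrow> wCk t0 k (Suc s) g"
  proof (induction s)
    case 0
    then show ?case using step[of 0] g0 wCk_deriv[OF 0] by simp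
  next
    case (Suc s)
    then show ?case using step[of "Suc s"] wCk_deriv[OF Suc.prems] wCk_Suc_imp[OF Suc.prems] by blast
  qed
  then show ?thesis using assms(1) .
qed

section \<open>Linear systems over an algebra of germs\<close>

text \<open>Two kinds of algebras occur: the weighted classes, and the functions that are merely continuous
  at \<open>t0\<close>. The latter are used for difference quotients.\<close>

locale germ_algebra =
  fixes t0 :: real and C :: "(real \<Rightarrow> real) \<Rightarrow> bool"
  assumes const: "C (\<lambda>_. c)"
    and add: "\<lbrakk>C f; C g\<rbrakk> \<Longrightarrow> C (\<lambda>t. f t + g t)"
    and mult: "\<lbrakk>C f; C g\<rbrakk> \<Longrightarrow> C (\<lambda>t. f t * g t)"
    and inv: "\<lbrakk>C f; f t0 \<noteq> 0\<rbrakk> \<Longrightarrow> C (\<lambda>t. inverse (f t))"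
    and cont: "C f \<Longrightarrow> isCont f t0"
begin

lemma diff: "\<lbrakk>C f; C g\<rbrakk> \<Longrightarrow> C (\<lambda>t. f t - g t)"
  using add[OF _ mult[OF const[of "- 1"]], of f g] by simp

lemma sum: "(\<And>x. x \<in> X \<Longrightarrow> C (f x)) \<Longrightarrow> C (\<lambda>t. \<Sum>x\<in>X. f x t)"
  by (induction X rule: infinite_finite_induct) (auto intro: add const)

text \<open>Gaussian elimination: a pivot that does not vanish at \<open>t0\<close> is invertible in the algebra. The
  solution is given by operators \<open>N\<close> with entries in the algebra that work pointwise for all right-hand
  sides; so unknowns about whose dependence on \<open>t\<close> nothing is known inherit the regularity of the data.\<close>

lemma linear_system_solvable:
  fixes M :: "'i \<Rightarrow> 'j \<Rightarrow> real \<Rightarrow> real"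
  assumes "finite S" "finite E"
    and "\<And>i j. i \<in> E \<Longrightarrow> j \<in> S \<Longrightarrow> C (M i j)"
    and "\<And>c. \<forall>i\<in>E. (\<Sum>j\<in>S. M i j t0 * c j) = 0 \<Longrightarrow> \<forall>j\<in>S. c j = 0"
  shows "\<exists>N. (\<forall>j\<in>S. \<forall>i\<in>E. C (N j i)) \<and>
     (\<forall>\<^sub>F t in nhds t0. \<forall>z w. (\<forall>i\<in>E. (\<Sum>j\<in>S. M i j t * z j) = w i) \<longrightarrow>
        (\<forall>j\<in>S. z j = (\<Sum>i\<in>E. N j i t * w i)))"
  using assms(1,3,4)
proof (induction S arbitrary: M rule: finite_induct)
  case empty
  then show ?case by auto
next
  case (insert j0 S M)
  obtain i0 where i0: "i0 \<in> E" "M i0 j0 t0 \<noteq> 0"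
  proof (rule ccontr)
    assume "\<not> thesis"
    then have z: "\<forall>i\<in>E. M i j0 t0 = 0" using that by blast
    have "\<forall>i\<in>E. (\<Sum>j\<in>insert j0 S. M i j t0 * (if j = j0 then 1 else 0)) = 0"
      using z insert.hyps by (auto simp: sum.delta' if_distrib[of "\<lambda>x. _ * x"] cong: if_cong)
    from insert.prems(2)[OF this] show False by simp
  qed
  \<comment> \<open>The unknown \<open>j0\<close> is eliminated from all equations by means of the equation \<open>i0\<close>.\<close>
  define q where "q = (\<lambda>t. inverse (M i0 j0 t))"
  define M' where "M' = (\<lambda>i j t. M i j t - M i j0 t * q t * M i0 j t)"
  have CM: "C (M i j)" if "i \<in> E" "j \<in> insert j0 S" for i j using insert.prems(1) that by blast
  have Cq: "C q" unfolding q_def using CM i0 by (intro inv) auto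
  have CM': "C (M' i j)" if "i \<in> E" "j \<in> S" for i j
    unfolding M'_def using that i0 by (intro diff mult CM Cq) auto
  have inj': "\<forall>j\<in>S. c j = 0" if c: "\<forall>i\<in>E. (\<Sum>j\<in>S. M' i j t0 * c j) = 0" for c
  proof -
    define c' where "c' = c(j0 := - q t0 * (\<Sum>j\<in>S. M i0 j t0 * c j))"
    have "(\<Sum>j\<in>insert j0 S. M i j t0 * c' j) = 0" if "i \<in> E" for i
    proof -
      have "(\<Sum>j\<in>S. M i j t0 * c' j) = (\<Sum>j\<in>S. M i j t0 * c j)"
        using insert.hyps by (intro sum.cong) (auto simp: c'_def)
      then have "(\<Sum>j\<in>insert j0 S. M i j t0 * c' j) = (\<Sum>j\<in>S. M' i j t0 * c j)"
        using insert.hyps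
        by (simp add: c'_def M'_def algebra_simps sum_subtractf sum_distrib_left sum_negf)
      then show ?thesis using c that by simp
    qed
    then have "\<forall>j\<in>insert j0 S. c' j = 0" by (intro insert.prems(2)) blast
    then show ?thesis using insert.hyps by (metis c'_def fun_upd_other insertCI)
  qed
  from insert.IH[of M', OF CM' inj'] obtain N where N: "\<And>j i. j \<in> S \<Longrightarrow> i \<in> E \<Longrightarrow> C (N j i)"
    and evN: "\<forall>\<^sub>F t in nhds t0. \<forall>z w. (\<forall>i\<in>E. (\<Sum>j\<in>S. M' i j t * z j) = w i) \<longrightarrow>
        (\<forall>j\<in>S. z j = (\<Sum>i\<in>E. N j i t * w i))" by blast
  \<comment> \<open>\<open>K\<close> undoes the elimination on the right-hand sides, and the row \<open>j0\<close> of \<open>L\<close> is the back substitution.\<close>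
  define K where "K = (\<lambda>j i t. N j i t -
     (if i = i0 then \<Sum>l\<in>E. N j l t * (M l j0 t * q t) else 0))"
  define L where "L = (\<lambda>j i. if j = j0 then
       (\<lambda>t. q t * ((if i = i0 then 1 else 0) - (\<Sum>l\<in>S. M i0 l t * K l i t))) else K j i)"
  have CK: "C (K j i)" if "j \<in> S" "i \<in> E" for j i
  proof (cases "i = i0")
    case True
    then show ?thesis unfolding K_def using that by (auto intro!: diff sum mult N CM Cq)
  next
    case False
    then show ?thesis unfolding K_def using that N by simp
  qed
  have CL: "C (L j i)" if "j \<in> insert j0 S" "i \<in> E" for j i
  proof (cases "j = j0")
    case True
    have "C (\<lambda>t. q t * ((if i = i0 then 1 else 0) - (\<Sum>l\<in>S. M i0 l t * K l i t)))"
      using that i0 by (intro mult diff sum const CM CK Cq) auto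
    then show ?thesis using True by (simp add: L_def)
  next
    case False
    then show ?thesis using that CK by (auto simp: L_def)
  qed
  have nz: "\<forall>\<^sub>F t in nhds t0. M i0 j0 t \<noteq> 0"
    using i0 CM by (intro isCont_nonzero_near cont) auto
  have "\<forall>\<^sub>F t in nhds t0. \<forall>z w. (\<forall>i\<in>E. (\<Sum>j\<in>insert j0 S. M i j t * z j) = w i) \<longrightarrow>
        (\<forall>j\<in>insert j0 S. z j = (\<Sum>i\<in>E. L j i t * w i))"
    using evN nz
  proof eventually_elim
    case (elim t)
    show ?case
    proof (intro allI impI)
      fix z w assume zw: "\<forall>i\<in>E. (\<Sum>j\<in>insert j0 S. M i j t * z j) = w i"
      have q: "q t * M i0 j0 t = 1" using elim(2) by (simp add: q_def)
      have zw': "(\<Sum>j\<in>S. M i j t * z j) = w i - M i j0 t * z j0" if "i \<in> E" for i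
        using zw that insert.hyps by (auto simp: algebra_simps)
      have "\<forall>i\<in>E. (\<Sum>j\<in>S. M' i j t * z j) = w i - M i j0 t * q t * w i0"
      proof
        fix i assume i: "i \<in> E"
        have "(\<Sum>j\<in>S. M' i j t * z j)
            = (\<Sum>j\<in>S. M i j t * z j) - M i j0 t * q t * (\<Sum>j\<in>S. M i0 j t * z j)"
          by (simp add: M'_def algebra_simps sum_subtractf sum_distrib_left)
        also have "\<dots> = w i - M i j0 t * z j0 - M i j0 t * q t * w i0
            + M i j0 t * (q t * M i0 j0 t) * z j0"
          unfolding zw'[OF i] zw'[OF i0(1)] by (simp add: algebra_simps)
        finally show "(\<Sum>j\<in>S. M' i j t * z j) = w i - M i j0 t * q t * w i0" by (simp add: q)
      qed
      then have "\<forall>j\<in>S. z j = (\<Sum>i\<in>E. N j i t * (w i - M i j0 t * q t * w i0))"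
        using elim(1)[rule_format, of z "\<lambda>i. w i - M i j0 t * q t * w i0"] by blast
      moreover have "(\<Sum>i\<in>E. N j i t * (w i - M i j0 t * q t * w i0)) = (\<Sum>i\<in>E. K j i t * w i)" for j
      proof -
        have "(\<Sum>i\<in>E. K j i t * w i) = (\<Sum>i\<in>E. N j i t * w i)
          - (\<Sum>i\<in>E. if i = i0 then (\<Sum>l\<in>E. N j l t * (M l j0 t * q t)) * w i else 0)"
          unfolding sum_subtractf[symmetric] by (intro sum.cong) (auto simp: K_def algebra_simps)
        also have "(\<Sum>i\<in>E. if i = i0 then (\<Sum>l\<in>E. N j l t * (M l j0 t * q t)) * w i else 0)
          = (\<Sum>l\<in>E. N j l t * (M l j0 t * q t)) * w i0"
          using i0 assms(2) by simp
        finally show ?thesis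
          by (simp add: algebra_simps sum_subtractf sum_distrib_left)
      qed
      ultimately have zS: "\<forall>j\<in>S. z j = (\<Sum>i\<in>E. K j i t * w i)" by simp
      have "z j0 = q t * (w i0 - (\<Sum>l\<in>S. M i0 l t * z l))"
      proof -
        have "q t * (w i0 - (\<Sum>l\<in>S. M i0 l t * z l)) = (q t * M i0 j0 t) * z j0"
          by (simp add: zw' i0)
        then show ?thesis by (simp add: q)
      qed
      also have "(\<Sum>l\<in>S. M i0 l t * z l) = (\<Sum>l\<in>S. \<Sum>i\<in>E. M i0 l t * K l i t * w i)"
        using zS by (intro sum.cong) (auto simp: sum_distrib_left mult.assoc)
      also have "\<dots> = (\<Sum>i\<in>E. \<Sum>l\<in>S. M i0 l t * K l i t * w i)" by (rule sum.swap)
      also have "q t * (w i0 - \<dots>) = (\<Sum>i\<in>E. L j0 i t * w i)"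
      proof -
        have "(\<Sum>i\<in>E. L j0 i t * w i) = (\<Sum>i\<in>E. (if i = i0 then q t * w i else 0))
           - (\<Sum>i\<in>E. q t * (\<Sum>l\<in>S. M i0 l t * K l i t * w i))"
          unfolding sum_subtractf[symmetric]
          by (intro sum.cong) (auto simp: L_def algebra_simps sum_distrib_left)
        also have "(\<Sum>i\<in>E. (if i = i0 then q t * w i else 0)) = q t * w i0"
          using i0 assms(2) by simp
        finally show ?thesis by (simp add: algebra_simps sum_distrib_left)
      qed
      finally have "z j0 = (\<Sum>i\<in>E. L j0 i t * w i)" .
      moreover have "L j = K j" if "j \<in> S" for j using that insert.hyps by (auto simp: L_def)
      ultimately show "\<forall>j\<in>insert j0 S. z j = (\<Sum>i\<in>E. L j i t * w i)"
        using zS by simp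
    qed
  qed
  then show ?case using CL by blast
qed

end

lemma germ_algebra_isCont: "germ_algebra t0 (\<lambda>f. isCont f t0)"
  by unfold_locales (auto intro: continuous_at_within_inverse)

lemma germ_algebra_wCk: "germ_algebra t0 (wCk t0 k s)"
  by unfold_locales (auto intro: wCk_const wCk_add wCk_mult wCk_inverse wCk_imp_isCont)

section \<open>Regularity of coprime factors\<close>

lemma poly_eq_sum_monom:
  fixes X :: "'a::comm_ring_1 poly"
  assumes "\<forall>i\<ge>d. coeff X i = 0" shows "X = (\<Sum>i<d. monom (coeff X i) i)"
proof (rule poly_eqI)
  fix k
  have "(\<Sum>i<d. coeff (monom (coeff X i) i) k) = (if k < d then coeff X k else 0)"
    by (simp add: if_distrib cong: if_cong)
  then show "coeff X k = coeff (\<Sum>i<d. monom (coeff X i) i) k"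
    using assms by (auto simp: coeff_sum)
qed

text \<open>The matrix of the map \<open>(X, Y) \<mapsto> X B + Y A\<close> on coefficients.\<close>

definition sylvester :: "(real \<Rightarrow> real poly) \<Rightarrow> (real \<Rightarrow> real poly) \<Rightarrow> nat \<Rightarrow> nat + nat \<Rightarrow> real \<Rightarrow> real" where
  "sylvester A B k j t = (case j of Inl i \<Rightarrow> coeff (monom 1 i * B t) k | Inr i \<Rightarrow> coeff (monom 1 i * A t) k)"

lemma sylvester_mult:
  fixes A B :: "real \<Rightarrow> real poly"
  assumes "\<forall>i\<ge>d. coeff X i = 0" "\<forall>i\<ge>m. coeff Y i = 0"
  shows "(\<Sum>j\<in>{..<d} <+> {..<m}. sylvester A B k j t * (case j of Inl i \<Rightarrow> coeff X i | Inr i \<Rightarrow> coeff Y i))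
     = coeff (X * B t + Y * A t) k"
proof -
  have "X * B t = (\<Sum>i<d. smult (coeff X i) (monom 1 i * B t))"
    by (subst poly_eq_sum_monom[OF assms(1)])
       (simp add: sum_distrib_right mult_smult_left[symmetric] smult_monom del: mult_smult_left)
  moreover have "Y * A t = (\<Sum>i<m. smult (coeff Y i) (monom 1 i * A t))"
    by (subst poly_eq_sum_monom[OF assms(2)])
       (simp add: sum_distrib_right mult_smult_left[symmetric] smult_monom del: mult_smult_left)
  ultimately show ?thesis
    by (simp add: sum.Plus sylvester_def coeff_sum mult.commute)
qed

lemma coeffs_ge_mult:
  fixes X B :: "'a::idom poly"
  assumes "\<forall>i\<ge>d. coeff X i = 0" "degree B \<le> m" "k \<ge> d + m"
  shows "coeff (X * B) k = 0"
proof (cases "X = 0")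
  case False
  then have "degree X < d" using assms(1) by (metis leading_coeff_0_iff not_le)
  then have "degree (X * B) < d + m" using degree_mult_le[of X B] assms(2) by linarith
  then show ?thesis using assms(3) by (intro coeff_eq_0) auto
qed simp

text \<open>Coprimality makes the map \<open>(X, Y) \<mapsto> X B + Y A\<close> injective on polynomials of degree below the degrees
  of \<open>A\<close> and \<open>B\<close>: if \<open>X B + Y A = 0\<close> then \<open>A\<close> divides \<open>X\<close>.\<close>

lemma (in germ_algebra) bezout_operator:
  assumes C: "\<And>i. C (\<lambda>t. coeff (A t) i)" "\<And>i. C (\<lambda>t. coeff (B t) i)"
    and cop: "coprime (A t0) (B t0)" and deg: "degree (A t0) = d" "degree (B t0) = m"
    and A0: "A t0 \<noteq> 0"
  shows "\<exists>N. (\<forall>i k. C (N i k)) \<and>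
    (\<forall>\<^sub>F t in nhds t0. \<forall>X Y. (\<forall>i\<ge>d. coeff X i = 0) \<longrightarrow> (\<forall>i\<ge>m. coeff Y i = 0) \<longrightarrow>
       (\<forall>i<d. coeff X i = (\<Sum>k<d+m. N i k t * coeff (X * B t + Y * A t) k)))"
proof -
  let ?S = "{..<d} <+> {..<m}"
  have CM: "C (sylvester A B k j)" for k j
  proof -
    have "sylvester A B k j = (case j of Inl i \<Rightarrow> (\<lambda>t. if i \<le> k then coeff (B t) (k - i) else 0)
       | Inr i \<Rightarrow> (\<lambda>t. if i \<le> k then coeff (A t) (k - i) else 0))"
      by (rule ext, cases j) (auto simp: sylvester_def coeff_monom_mult)
    then show ?thesis using C const by (cases j; cases "projl j \<le> k"; cases "projr j \<le> k") auto
  qed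
  have inj: "\<forall>j\<in>?S. c j = 0" if c: "\<forall>k\<in>{..<d+m}. (\<Sum>j\<in>?S. sylvester A B k j t0 * c j) = 0" for c
  proof -
    define X where "X = (\<Sum>i<d. monom (c (Inl i)) i)"
    define Y where "Y = (\<Sum>i<m. monom (c (Inr i)) i)"
    have cX: "coeff X i = (if i < d then c (Inl i) else 0)" for i
      by (simp add: X_def coeff_sum if_distrib cong: if_cong)
    have cY: "coeff Y i = (if i < m then c (Inr i) else 0)" for i
      by (simp add: Y_def coeff_sum if_distrib cong: if_cong)
    have "coeff (X * B t0 + Y * A t0) k = 0" for k
    proof (cases "k < d + m")
      case True
      have "(\<Sum>j\<in>?S. sylvester A B k j t0 * c j)
        = (\<Sum>j\<in>?S. sylvester A B k j t0 * (case j of Inl i \<Rightarrow> coeff X i | Inr i \<Rightarrow> coeff Y i))"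
        by (intro sum.cong) (auto simp: cX cY)
      also have "\<dots> = coeff (X * B t0 + Y * A t0) k"
        by (rule sylvester_mult) (auto simp: cX cY)
      finally show ?thesis using c True by simp
    next
      case False
      then show ?thesis
        using coeffs_ge_mult[of d X "B t0" m k] coeffs_ge_mult[of m Y "A t0" d k]
        by (auto simp: cX cY deg)
    qed
    then have eq: "X * B t0 + Y * A t0 = 0" by (intro poly_eqI) simp
    then have "A t0 dvd X * B t0" by (simp add: add_eq_0_iff2)
    then have "A t0 dvd X" using coprime_dvd_mult_left_iff[OF cop] by blast
    moreover have "degree X < d" if "X \<noteq> 0"
      using that cX[of "degree X"] by (metis leading_coeff_0_iff)
    ultimately have X0: "X = 0" using deg(1) dvd_imp_degree_le[of "A t0" X] by fastforce
    then have "Y = 0" using eq A0 by simp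
    then have "c (Inl i) = 0" if "i < d" for i using X0 cX[of i] that by simp
    moreover have "c (Inr i) = 0" if "i < m" for i using \<open>Y = 0\<close> cY[of i] that by simp
    ultimately show ?thesis by (auto elim!: PlusE)
  qed
  have "\<exists>N. (\<forall>j\<in>?S. \<forall>k\<in>{..<d+m}. C (N j k)) \<and>
     (\<forall>\<^sub>F t in nhds t0. \<forall>z w. (\<forall>k\<in>{..<d+m}. (\<Sum>j\<in>?S. sylvester A B k j t * z j) = w k) \<longrightarrow>
        (\<forall>j\<in>?S. z j = (\<Sum>k<d+m. N j k t * w k)))"
  proof (rule linear_system_solvable[of ?S "{..<d+m}" "sylvester A B"])
    show "finite ?S" by (intro finite_Plus) auto
    show "finite {..<d+m}" by simp
    show "C (sylvester A B k j)" for k j by (rule CM)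
    show "\<forall>j\<in>?S. c j = 0" if "\<forall>k\<in>{..<d+m}. (\<Sum>j\<in>?S. sylvester A B k j t0 * c j) = 0" for c
      using that by (rule inj)
  qed
  then obtain N where N: "\<forall>j\<in>?S. \<forall>k\<in>{..<d+m}. C (N j k)"
    and ev: "\<forall>\<^sub>F t in nhds t0. \<forall>z w. (\<forall>k\<in>{..<d+m}. (\<Sum>j\<in>?S. sylvester A B k j t * z j) = w k) \<longrightarrow>
        (\<forall>j\<in>?S. z j = (\<Sum>k<d+m. N j k t * w k))" by (elim exE conjE)
  define N' where "N' = (\<lambda>i k. if i < d \<and> k < d + m then N (Inl i) k else (\<lambda>_. 0))"
  have "C (N' i k)" for i k
    using N[THEN bspec, OF InlI[of i "{..<d}"], THEN bspec, of k] const by (simp add: N'_def)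
  moreover have "\<forall>\<^sub>F t in nhds t0. \<forall>X Y. (\<forall>i\<ge>d. coeff X i = 0) \<longrightarrow> (\<forall>i\<ge>m. coeff Y i = 0) \<longrightarrow>
       (\<forall>i<d. coeff X i = (\<Sum>k<d+m. N' i k t * coeff (X * B t + Y * A t) k))"
    using ev
  proof eventually_elim
    case (elim t)
    show ?case
    proof (intro allI impI)
      fix X Y :: "real poly" and i
      assume XY: "\<forall>i\<ge>d. coeff X i = 0" "\<forall>i\<ge>m. coeff Y i = 0" and i: "i < d"
      let ?z = "\<lambda>j. case j of Inl i \<Rightarrow> coeff X i | Inr i \<Rightarrow> coeff Y i"
      have sys: "\<forall>k\<in>{..<d+m}. (\<Sum>j\<in>?S. sylvester A B k j t * ?z j) = coeff (X * B t + Y * A t) k"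
        by (rule ballI) (rule sylvester_mult[OF XY])
      have "Inl i \<in> ?S" using i by (intro InlI) simp
      with elim[THEN spec, of ?z, THEN spec, of "coeff (X * B t + Y * A t)", THEN mp, OF sys]
      have "?z (Inl i) = (\<Sum>k<d+m. N (Inl i) k t * coeff (X * B t + Y * A t) k)" by (rule bspec)
      also have "\<dots> = (\<Sum>k<d+m. N' i k t * coeff (X * B t + Y * A t) k)"
        using i by (intro sum.cong) (simp_all add: N'_def)
      finally show "coeff X i = (\<Sum>k<d+m. N' i k t * coeff (X * B t + Y * A t) k)" by simp
    qed
  qed
  ultimately show ?thesis by (intro exI[of _ N'] conjI allI)
qed

text \<open>Statements about single coefficients hold simultaneously for all of them, since the coefficients
  beyond the degree bound vanish.\<close>

lemma eventually_all_coeffs: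
  fixes A :: "real \<Rightarrow> real poly"
  assumes "\<forall>\<^sub>F t in nhds t0. degree (A t) \<le> d"
    and "\<And>i. \<forall>\<^sub>F t in F. R (\<lambda>u. coeff (A u) i) t" and "F \<le> nhds t0"
    and zero: "\<And>f t. \<forall>\<^sub>F u in nhds t. f u = 0 \<Longrightarrow> R f t"
  shows "\<forall>\<^sub>F t in F. \<forall>i. R (\<lambda>u. coeff (A u) i) t"
proof -
  have "\<forall>\<^sub>F t in nhds t0. \<forall>\<^sub>F u in nhds t. degree (A u) \<le> d"
    using assms(1) by (simp add: eventually_eventually)
  then have 1: "\<forall>\<^sub>F t in F. \<forall>\<^sub>F u in nhds t. degree (A u) \<le> d" using assms(3) by (rule filter_leD[rotated])
  have 2: "\<forall>\<^sub>F t in F. \<forall>i\<in>{..d}. R (\<lambda>u. coeff (A u) i) t"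
    using assms(2) by (intro eventually_ball_finite) auto
  show ?thesis using 1 2
  proof eventually_elim
    case (elim t)
    show ?case
    proof
      fix i show "R (\<lambda>u. coeff (A u) i) t"
      proof (cases "i \<le> d")
        case False
        have "\<forall>\<^sub>F u in nhds t. coeff (A u) i = 0"
          using elim(1) by (rule eventually_mono) (use False in \<open>auto intro: coeff_eq_0\<close>)
        then show ?thesis by (rule zero)
      qed (use elim in auto)
    qed
  qed
qed

text \<open>Two factors that stay monic and coprime.\<close>

definition coprime_monic_near ::
  "real \<Rightarrow> nat \<Rightarrow> nat \<Rightarrow> (real \<Rightarrow> real poly) \<Rightarrow> (real \<Rightarrow> real poly) \<Rightarrow> bool" where
  "coprime_monic_near t0 d m A B \<longleftrightarrow> (\<forall>\<^sub>F t in nhds t0.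
     lead_coeff (A t) = 1 \<and> degree (A t) = d \<and> lead_coeff (B t) = 1 \<and> degree (B t) = m \<and>
     coprime (A t) (B t))"

lemma coprime_monic_near_at:
  assumes "coprime_monic_near t0 d m A B"
  shows "lead_coeff (A t0) = 1" "degree (A t0) = d" "lead_coeff (B t0) = 1" "degree (B t0) = m"
    "coprime (A t0) (B t0)"
  using eventually_nhds_x_imp_x[OF assms[unfolded coprime_monic_near_def]] by blast+

lemma coprime_monic_near_commute:
  "coprime_monic_near t0 d m A B \<Longrightarrow> coprime_monic_near t0 m d B A"
  unfolding coprime_monic_near_def by (erule eventually_mono) (auto simp: coprime_commute)

lemma coprime_monic_near_nearby:
  "coprime_monic_near t0 d m A B \<Longrightarrow> \<forall>\<^sub>F t in nhds t0. coprime_monic_near t d m A B"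
  unfolding coprime_monic_near_def by (simp add: eventually_eventually)

lemma coprime_monic_near_tail:
  assumes "coprime_monic_near t0 d m A B" "i \<ge> d"
  shows "\<forall>\<^sub>F u in nhds t0. coeff (A u) i = (if i = d then 1 else 0)"
  using assms(1)[unfolded coprime_monic_near_def]
  by (rule eventually_mono) (use assms(2) in \<open>auto simp: coeff_eq_0\<close>)

lemma monic_diff_coeff:
  fixes A B :: "real poly"
  assumes "lead_coeff A = 1" "degree A = d" "lead_coeff B = 1" "degree B = d" "i \<ge> d"
  shows "coeff (A - B) i = 0"
  using assms by (cases "i = d") (auto simp: coeff_eq_0)

text \<open>The product rule is not available, because \<open>N\<close> is only continuous; but the increments of \<open>f\<close> vanish at \<open>t\<close>.\<close>

lemma differentiable_sum_mult_increment:
  fixes f N :: "'k \<Rightarrow> real \<Rightarrow> real"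
  assumes "finite K" "\<And>k. k \<in> K \<Longrightarrow> isCont (N k) t" "\<And>k. k \<in> K \<Longrightarrow> f k differentiable at t"
  shows "(\<lambda>u. \<Sum>k\<in>K. N k u * (f k u - f k t)) differentiable at t"
proof (rule differentiable_sum[OF assms(1)], rule ballI)
  fix k assume k: "k \<in> K"
  then obtain D where "DERIV (f k) t :> D" using assms(3) unfolding real_differentiable_def by blast
  then obtain g where g: "\<And>z. f k z - f k t = g z * (z - t)" "isCont g t"
    unfolding CARAT_DERIV by auto
  have "DERIV (\<lambda>u. N k u * (f k u - f k t)) t :> N k t * g t"
    unfolding CARAT_DERIV using g assms(2)[OF k]
    by (intro exI[of _ "\<lambda>u. N k u * g u"]) auto
  then show "(\<lambda>u. N k u * (f k u - f k t)) differentiable at t"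
    unfolding real_differentiable_def by blast
qed

text \<open>The increments satisfy \<open>\<Delta>P = \<Delta>A B(u) + \<Delta>B A(t)\<close>, so those of \<open>A\<close> are linear combinations of those of \<open>P\<close>
  with coefficients that depend continuously on \<open>u\<close>.\<close>

lemma factor_differentiable:
  assumes cm: "coprime_monic_near t d m A B"
    and eq: "\<forall>\<^sub>F u in nhds t. P u = A u * B u"
    and cont: "\<And>i. isCont (\<lambda>u. coeff (B u) i) t"
    and P: "\<And>i. (\<lambda>u. coeff (P u) i) differentiable at t"
  shows "(\<lambda>u. coeff (A u) i) differentiable at t"
proof -
  interpret G: germ_algebra t "\<lambda>f. isCont f t" by (rule germ_algebra_isCont)
  note at = coprime_monic_near_at[OF cm] eventually_nhds_x_imp_x[OF eq]
  have A0: "A t \<noteq> 0" using at(1) by auto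
  have cA: "isCont (\<lambda>u. coeff (A t) i) t" for i by simp
  obtain N where N: "\<forall>i k. isCont (N i k) t" and
    ev: "\<forall>\<^sub>F u in nhds t. \<forall>X Y. (\<forall>i\<ge>d. coeff X i = 0) \<longrightarrow> (\<forall>i\<ge>m. coeff Y i = 0) \<longrightarrow>
       (\<forall>i<d. coeff X i = (\<Sum>k<d+m. N i k u * coeff (X * B u + Y * A t) k))"
    using G.bezout_operator[of "\<lambda>_. A t" B d m, OF cA cont at(5,2,4) A0] by (elim exE conjE)
  show ?thesis
  proof (cases "i < d")
    case True
    have "\<forall>\<^sub>F u in nhds t.
       coeff (A t) i + (\<Sum>k<d+m. N i k u * (coeff (P u) k - coeff (P t) k)) = coeff (A u) i"
      using ev eq cm[unfolded coprime_monic_near_def]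
    proof eventually_elim
      case (elim u)
      have 1: "(A u - A t) * B u + (B u - B t) * A t = P u - P t"
        by (simp add: elim(2) at(6) algebra_simps)
      have "\<forall>i\<ge>d. coeff (A u - A t) i = 0" "\<forall>i\<ge>m. coeff (B u - B t) i = 0"
        using monic_diff_coeff elim(3) at by blast+
      from elim(1)[rule_format, OF this(1)[rule_format] this(2)[rule_format] True] show ?case
        unfolding 1 by (auto simp: algebra_simps)
    qed
    moreover have "(\<lambda>u. coeff (A t) i + (\<Sum>k<d+m. N i k u * (coeff (P u) k - coeff (P t) k)))
        differentiable at t"
      by (intro differentiable_add differentiable_const differentiable_sum_mult_increment)
         (use N P in auto)
    ultimately show ?thesis by (simp only: differentiable_cong_near)
  next
    case False
    then show ?thesis using differentiable_cong_near[OF coprime_monic_near_tail[OF cm, of i]] by simp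
  qed
qed

lemma factor_differentiable_near:
  assumes cm: "coprime_monic_near t0 d m A B"
    and eq: "\<forall>\<^sub>F t in nhds t0. P t = A t * B t"
    and cont: "\<And>i. Ck_at t0 0 (\<lambda>t. coeff (B t) i)"
    and F: "F \<le> nhds t0" and P: "\<And>i. \<forall>\<^sub>F t in F. (\<lambda>u. coeff (P u) i) differentiable at t"
  shows "\<forall>\<^sub>F t in F. \<forall>i. (\<lambda>u. coeff (A u) i) differentiable at t"
proof -
  have "\<forall>\<^sub>F t in nhds t0. degree (B t) \<le> m"
    using cm unfolding coprime_monic_near_def by (auto elim: eventually_mono)
  then have cB: "\<forall>\<^sub>F t in nhds t0. \<forall>i. isCont (\<lambda>u. coeff (B u) i) t"
    by (rule eventually_all_coeffs) (use cont isCont_cong_near in auto)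
  have "\<forall>\<^sub>F t in nhds t0. degree (P t) \<le> d + m"
    using eq cm unfolding coprime_monic_near_def
    by eventually_elim (auto intro: order.trans[OF degree_mult_le])
  then have dP: "\<forall>\<^sub>F t in F. \<forall>i. (\<lambda>u. coeff (P u) i) differentiable at t"
    by (rule eventually_all_coeffs[OF _ _ F]) (use P differentiable_cong_near in auto)
  have eq': "\<forall>\<^sub>F t in nhds t0. \<forall>\<^sub>F u in nhds t. P u = A u * B u"
    using eq by (simp add: eventually_eventually)
  show ?thesis
    using filter_leD[OF F cB] dP filter_leD[OF F eq'] filter_leD[OF F coprime_monic_near_nearby[OF cm]]
    by eventually_elim (use factor_differentiable in blast)
qed

lemma deriv_coeff_mult:
  fixes A B :: "real \<Rightarrow> real poly"
  assumes "\<And>i. (\<lambda>u. coeff (A u) i) differentiable at t" "\<And>i. (\<lambda>u. coeff (B u) i) differentiable at t"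
  shows "deriv (\<lambda>u. coeff (A u * B u) k) t =
    (\<Sum>i\<le>k. deriv (\<lambda>u. coeff (A u) i) t * coeff (B t) (k - i)
        + coeff (A t) i * deriv (\<lambda>u. coeff (B u) (k - i)) t)"
proof (rule DERIV_imp_deriv)
  have D: "DERIV (\<lambda>u. coeff (A u) i) t :> deriv (\<lambda>u. coeff (A u) i) t"
     "DERIV (\<lambda>u. coeff (B u) i) t :> deriv (\<lambda>u. coeff (B u) i) t" for i
    using assms by (simp_all add: DERIV_deriv_iff_real_differentiable)
  show "DERIV (\<lambda>u. coeff (A u * B u) k) t :>
    (\<Sum>i\<le>k. deriv (\<lambda>u. coeff (A u) i) t * coeff (B t) (k - i)
        + coeff (A t) i * deriv (\<lambda>u. coeff (B u) (k - i)) t)"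
    unfolding coeff_mult
  proof (rule DERIV_sum)
    fix i
    show "DERIV (\<lambda>u. coeff (A u) i * coeff (B u) (k - i)) t :>
      deriv (\<lambda>u. coeff (A u) i) t * coeff (B t) (k - i)
        + coeff (A t) i * deriv (\<lambda>u. coeff (B u) (k - i)) t"
      by (rule DERIV_cong[OF DERIV_mult[OF D(1)[of i] D(2)[of "k - i"]]])
         (simp only: mult.commute)
  qed
qed

text \<open>The derivatives of the factors solve \<open>A' B + B' A = P'\<close>, in which \<open>A'\<close> and \<open>B'\<close> have smaller degree
  than the monic polynomials \<open>A\<close> and \<open>B\<close>. The filter is \<open>nhds t0\<close> for ordinary derivatives and \<open>at t0\<close>
  for Euler derivatives.\<close>

lemma (in germ_algebra) factor_derivative:
  assumes cm: "coprime_monic_near t0 d m A B"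
    and eq: "\<forall>\<^sub>F t in nhds t0. P t = A t * B t"
    and C: "\<And>i. C (\<lambda>t. coeff (A t) i)" "\<And>i. C (\<lambda>t. coeff (B t) i)"
    and F: "F \<le> nhds t0"
    and dA: "\<forall>\<^sub>F t in F. \<forall>i. (\<lambda>u. coeff (A u) i) differentiable at t"
    and dB: "\<forall>\<^sub>F t in F. \<forall>i. (\<lambda>u. coeff (B u) i) differentiable at t"
  shows "\<exists>N. (\<forall>i k. C (N i k)) \<and> (\<forall>\<^sub>F t in F. \<forall>i<d.
     deriv (\<lambda>u. coeff (A u) i) t = (\<Sum>k<d+m. N i k t * deriv (\<lambda>u. coeff (P u) k) t))"
proof -
  note at = coprime_monic_near_at[OF cm]
  have "A t0 \<noteq> 0" using at by auto
  from bezout_operator[OF C at(5,2,4) this]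
  obtain N where N: "\<forall>i k. C (N i k)" and
    ev: "\<forall>\<^sub>F t in nhds t0. \<forall>X Y. (\<forall>i\<ge>d. coeff X i = 0) \<longrightarrow> (\<forall>i\<ge>m. coeff Y i = 0) \<longrightarrow>
       (\<forall>i<d. coeff X i = (\<Sum>k<d+m. N i k t * coeff (X * B t + Y * A t) k))" by (elim exE conjE)
  have eq': "\<forall>\<^sub>F t in nhds t0. \<forall>\<^sub>F u in nhds t. P u = A u * B u"
    using eq by (simp add: eventually_eventually)
  have "\<forall>\<^sub>F t in F. \<forall>i<d.
     deriv (\<lambda>u. coeff (A u) i) t = (\<Sum>k<d+m. N i k t * deriv (\<lambda>u. coeff (P u) k) t)"
    using filter_leD[OF F ev] filter_leD[OF F eq'] filter_leD[OF F coprime_monic_near_nearby[OF cm]] dA dB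
  proof eventually_elim
    case (elim t)
    define X where "X = (\<Sum>i<d. monom (deriv (\<lambda>u. coeff (A u) i) t) i)"
    define Y where "Y = (\<Sum>i<m. monom (deriv (\<lambda>u. coeff (B u) i) t) i)"
    have zA: "deriv (\<lambda>u. coeff (A u) i) t = 0" if "i \<ge> d" for i
      using deriv_cong_ev[OF coprime_monic_near_tail[OF elim(3) that] refl] by simp
    have zB: "deriv (\<lambda>u. coeff (B u) i) t = 0" if "i \<ge> m" for i
      using deriv_cong_ev[OF coprime_monic_near_tail[OF coprime_monic_near_commute[OF elim(3)] that] refl]
      by simp
    have cX: "coeff X i = deriv (\<lambda>u. coeff (A u) i) t" for i
      using zA by (cases "i < d") (simp_all add: X_def coeff_sum if_distrib cong: if_cong)
    have cY: "coeff Y i = deriv (\<lambda>u. coeff (B u) i) t" for i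
      using zB by (cases "i < m") (simp_all add: Y_def coeff_sum if_distrib cong: if_cong)
    have W: "coeff (X * B t + Y * A t) k = deriv (\<lambda>u. coeff (P u) k) t" for k
    proof -
      have "\<forall>\<^sub>F u in nhds t. coeff (P u) k = coeff (A u * B u) k"
        using elim(2) by (rule eventually_mono) simp
      from deriv_cong_ev[OF this refl]
      have "deriv (\<lambda>u. coeff (P u) k) t = (\<Sum>i\<le>k. coeff X i * coeff (B t) (k - i)
          + coeff (A t) i * coeff Y (k - i))"
        using elim(4,5) by (simp add: deriv_coeff_mult cX cY)
      then show ?thesis unfolding mult.commute[of Y] by (simp add: coeff_mult sum.distrib)
    qed
    have "\<forall>i\<ge>d. coeff X i = 0" "\<forall>i\<ge>m. coeff Y i = 0" using zA zB by (simp_all add: cX cY)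
    from elim(1)[THEN spec, of X, THEN spec, of Y, THEN mp, OF this(1), THEN mp, OF this(2)]
    show ?case unfolding W cX .
  qed
  then show ?thesis using N by (intro exI[of _ N] conjI)
qed

text \<open>Bootstrapping: if the factors are of class \<open>C^k\<close>, then so are their derivatives, which are
  combinations of the derivatives of \<open>P\<close> with coefficients built from the factors. The two factors
  exchange their roles in the induction.\<close>

lemma factor_Ck_at:
  assumes "coprime_monic_near t0 d m A B" "\<forall>\<^sub>F t in nhds t0. P t = A t * B t"
    and "\<And>i. Ck_at t0 0 (\<lambda>t. coeff (A t) i)" "\<And>i. Ck_at t0 0 (\<lambda>t. coeff (B t) i)"
    and "\<And>i. Ck_at t0 k (\<lambda>t. coeff (P t) i)"
  shows "Ck_at t0 k (\<lambda>t. coeff (A t) i)"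
  using assms
proof (induction k arbitrary: A B d m i)
  case 0
  then show ?case by blast
next
  case (Suc k)
  note cm = Suc.prems(1) and eq = Suc.prems(2) and P = Suc.prems(5)
  note cm' = coprime_monic_near_commute[OF cm]
  have eq': "\<forall>\<^sub>F t in nhds t0. P t = B t * A t" using eq by eventually_elim simp
  have dP: "\<forall>\<^sub>F t in nhds t0. (\<lambda>u. coeff (P u) i) differentiable at t" for i using P by simp
  have dA: "\<forall>\<^sub>F t in nhds t0. \<forall>i. (\<lambda>u. coeff (A u) i) differentiable at t"
    by (rule factor_differentiable_near[OF cm eq Suc.prems(4) order.refl dP])
  have dB: "\<forall>\<^sub>F t in nhds t0. \<forall>i. (\<lambda>u. coeff (B u) i) differentiable at t"
    by (rule factor_differentiable_near[OF cm' eq' Suc.prems(3) order.refl dP])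
  interpret germ_algebra t0 "wCk t0 k 0" by (rule germ_algebra_wCk)
  have CA: "wCk t0 k 0 (\<lambda>t. coeff (A t) i)" for i
    using Suc.IH[OF cm eq Suc.prems(3,4) Ck_at_Suc_imp[OF P]] by simp
  have CB: "wCk t0 k 0 (\<lambda>t. coeff (B t) i)" for i
    using Suc.IH[OF cm' eq' Suc.prems(4,3) Ck_at_Suc_imp[OF P]] by simp
  from factor_derivative[OF cm eq CA CB order.refl dA dB]
  obtain N where N: "\<forall>i l. wCk t0 k 0 (N i l)" and
    ev: "\<forall>\<^sub>F t in nhds t0. \<forall>i<d.
     deriv (\<lambda>u. coeff (A u) i) t = (\<Sum>k<d+m. N i k t * deriv (\<lambda>u. coeff (P u) k) t)"
    by (elim exE conjE)
  show ?case
  proof (cases "i < d")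
    case True
    have e: "\<forall>\<^sub>F t in nhds t0.
        deriv (\<lambda>u. coeff (A u) i) t = (\<Sum>k<d+m. N i k t * deriv (\<lambda>u. coeff (P u) k) t)"
      using ev by (rule eventually_mono) (use True in auto)
    have "wCk t0 k 0 (\<lambda>t. \<Sum>l<d+m. N i l t * deriv (\<lambda>u. coeff (P u) l) t)"
      by (intro sum mult N[THEN spec, THEN spec]) (use P in auto)
    then show ?thesis using Ck_at_cong[OF e, of k] dA by (auto elim: eventually_mono)
  next
    case False
    then show ?thesis
      using Ck_at_cong[OF coprime_monic_near_tail[OF cm, of i], of "Suc k"] Ck_at_const
      by (simp del: Ck_at.simps)
  qed
qed

text \<open>The same argument for the derivation \<open>\<theta>\<close>.\<close>

lemma factor_wCk:
  assumes "coprime_monic_near t0 d m A B" "\<forall>\<^sub>F t in nhds t0. P t = A t * B t"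
    and "\<And>i. Ck_at t0 0 (\<lambda>t. coeff (A t) i)" "\<And>i. Ck_at t0 0 (\<lambda>t. coeff (B t) i)"
    and "\<And>i. wCk t0 k s (\<lambda>t. coeff (P t) i)"
  shows "wCk t0 k s (\<lambda>t. coeff (A t) i)"
  using assms
proof (induction s arbitrary: A B d m i)
  case 0
  then show ?case using factor_Ck_at[OF 0(1-4)] by simp
next
  case (Suc s)
  note cm = Suc.prems(1) and eq = Suc.prems(2) and P = Suc.prems(5)
  note cm' = coprime_monic_near_commute[OF cm]
  have le: "at t0 \<le> nhds t0" by (simp add: at_within_def)
  have eq': "\<forall>\<^sub>F t in nhds t0. P t = B t * A t" using eq by eventually_elim simp
  have dP: "\<forall>\<^sub>F t in at t0. (\<lambda>u. coeff (P u) i) differentiable at t" for i using P by simp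
  have dA: "\<forall>\<^sub>F t in at t0. \<forall>i. (\<lambda>u. coeff (A u) i) differentiable at t"
    by (rule factor_differentiable_near[OF cm eq Suc.prems(4) le dP])
  have dB: "\<forall>\<^sub>F t in at t0. \<forall>i. (\<lambda>u. coeff (B u) i) differentiable at t"
    by (rule factor_differentiable_near[OF cm' eq' Suc.prems(3) le dP])
  interpret germ_algebra t0 "wCk t0 k s" by (rule germ_algebra_wCk)
  have CA: "wCk t0 k s (\<lambda>t. coeff (A t) i)" for i
    by (rule Suc.IH[OF cm eq Suc.prems(3,4) wCk_Suc_imp[OF P]])
  have CB: "wCk t0 k s (\<lambda>t. coeff (B t) i)" for i
    by (rule Suc.IH[OF cm' eq' Suc.prems(4,3) wCk_Suc_imp[OF P]])
  from factor_derivative[OF cm eq CA CB le dA dB]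
  obtain N where N: "\<forall>i l. wCk t0 k s (N i l)" and
    ev: "\<forall>\<^sub>F t in at t0. \<forall>i<d.
     deriv (\<lambda>u. coeff (A u) i) t = (\<Sum>k<d+m. N i k t * deriv (\<lambda>u. coeff (P u) k) t)"
    by (elim exE conjE)
  show ?case
  proof (cases "i < d")
    case True
    have e: "\<forall>\<^sub>F t in nhds t0.
        euler t0 (\<lambda>u. coeff (A u) i) t = (\<Sum>k<d+m. N i k t * euler t0 (\<lambda>u. coeff (P u) k) t)"
      by (rule eventually_nhdsI_at, rule eventually_mono[OF ev])
         (use True in \<open>auto simp: euler_def sum_distrib_left mult.left_commute\<close>)
    have "wCk t0 k s (\<lambda>t. \<Sum>l<d+m. N i l t * euler t0 (\<lambda>u. coeff (P u) l) t)"
      by (intro sum mult N[THEN spec, THEN spec]) (use P in auto)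
    then show ?thesis using wCk_cong[OF e, of k s] dA wCk_imp_Ck_at[OF CA[of i]]
      by (auto elim: eventually_mono)
  next
    case False
    then show ?thesis
      using wCk_cong[OF coprime_monic_near_tail[OF cm, of i], of k "Suc s"] wCk_const
      by (simp del: wCk.simps)
  qed
qed

section \<open>Orders of vanishing\<close>

text \<open>The order \<open>\<infinity>\<close> stands for the zero germ, not for flatness. A germ need not have an order in this
  sense.\<close>

definition vanishing_order :: "real \<Rightarrow> (real \<Rightarrow> real) \<Rightarrow> enat \<Rightarrow> bool" where
  "vanishing_order t0 f e \<longleftrightarrow> (case e of
      enat m \<Rightarrow> \<exists>u. isCont u t0 \<and> u t0 \<noteq> 0 \<and> (\<forall>\<^sub>F t in nhds t0. f t = (t - t0) ^ m * u t)
    | \<infinity> \<Rightarrow> germ_zero t0 f)"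

lemma eventually_ne_at: "\<forall>\<^sub>F t in at (t0::real). t \<noteq> t0"
  by (auto simp: eventually_at_filter)

lemma isCont_eq_at:
  fixes f g :: "real \<Rightarrow> real"
  assumes "isCont f t0" "isCont g t0" "\<forall>\<^sub>F t in at t0. f t = g t"
  shows "f t0 = g t0"
proof (rule tendsto_unique[OF at_neq_bot])
  show "(f \<longlongrightarrow> f t0) (at t0)" using assms(1) by (simp add: isCont_def)
  have "(g \<longlongrightarrow> g t0) (at t0)" using assms(2) by (simp add: isCont_def)
  moreover have "\<forall>\<^sub>F t in at t0. g t = f t" using assms(3) by eventually_elim simp
  ultimately show "(f \<longlongrightarrow> g t0) (at t0)" by (rule Lim_transform_eventually)
qed

lemma power_factor_le:
  fixes g u :: "real \<Rightarrow> real"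
  assumes "isCont g t0" "isCont u t0" "u t0 \<noteq> 0"
    and "\<forall>\<^sub>F t in nhds t0. (t - t0) ^ q * g t = (t - t0) ^ m * u t"
  shows "q \<le> m"
proof (rule ccontr)
  assume "\<not> q \<le> m"
  then obtain d where d: "q = m + Suc d" by (metis add_Suc_right less_imp_Suc_add not_le)
  have "(t0 - t0) ^ Suc d * g t0 = u t0"
  proof (rule isCont_eq_at[of t0 "\<lambda>t. (t - t0) ^ Suc d * g t" u])
    show "\<forall>\<^sub>F t in at t0. (t - t0) ^ Suc d * g t = u t"
      using eventually_at_nhds[OF assms(4)] eventually_ne_at
      by eventually_elim (simp add: d power_add mult.assoc)
  qed (use assms in \<open>auto intro!: continuous_intros\<close>)
  then show False using assms(3) by simp
qed

lemma power_zero_contradiction: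
  fixes u :: "real \<Rightarrow> real"
  assumes "isCont u t0" "u t0 \<noteq> (0::real)" "\<forall>\<^sub>F t in nhds t0. (t - t0) ^ m * u t = 0"
  shows False
proof -
  have "\<forall>\<^sub>F t in nhds t0. (t - t0) ^ Suc m * 0 = (t - t0) ^ m * u t"
    using assms(3) by (rule eventually_mono) simp
  from power_factor_le[OF _ assms(1,2) this] show False by simp
qed

lemma vanishing_order_unique:
  assumes "vanishing_order t0 f a" "vanishing_order t0 f b"
  shows "a = b"
proof -
  have 1: "m \<le> l" if m: "vanishing_order t0 f (enat m)" and l: "vanishing_order t0 f (enat l)" for m l
  proof -
    obtain u v where uv: "isCont u t0" "\<forall>\<^sub>F t in nhds t0. f t = (t - t0) ^ m * u t"
       "isCont v t0" "v t0 \<noteq> 0" "\<forall>\<^sub>F t in nhds t0. f t = (t - t0) ^ l * v t"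
      using m l unfolding vanishing_order_def by auto
    have "\<forall>\<^sub>F t in nhds t0. (t - t0) ^ m * u t = (t - t0) ^ l * v t"
      using uv(2,5) by eventually_elim simp
    from power_factor_le[OF uv(1,3,4) this] show ?thesis .
  qed
  have 2: False if m: "vanishing_order t0 f (enat m)" and z: "vanishing_order t0 f \<infinity>" for m
  proof -
    obtain u where u: "isCont u t0" "u t0 \<noteq> 0" "\<forall>\<^sub>F t in nhds t0. f t = (t - t0) ^ m * u t"
      using m unfolding vanishing_order_def by auto
    have "\<forall>\<^sub>F t in nhds t0. f t = 0" using z unfolding vanishing_order_def germ_zero_def by simp
    with u(3) have "\<forall>\<^sub>F t in nhds t0. (t - t0) ^ m * u t = 0" by eventually_elim simp
    from power_zero_contradiction[OF u(1,2) this] show False .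
  qed
  show ?thesis using assms 1 2 by (cases a; cases b) (auto intro: antisym)
qed

lemma vanishing_order_nonzero:
  assumes "vanishing_order t0 f e" "f t0 \<noteq> 0" shows "e = 0"
proof (cases e)
  case (enat m)
  then obtain u where "\<forall>\<^sub>F t in nhds t0. f t = (t - t0) ^ m * u t"
    using assms(1) unfolding vanishing_order_def by auto
  then have "f t0 = (t0 - t0) ^ m * u t0" by (rule eventually_nhds_x_imp_x)
  then show ?thesis using assms(2) enat by (cases m) (auto simp: zero_enat_def)
next
  case infinity
  then have "\<forall>\<^sub>F t in nhds t0. f t = 0" using assms(1) unfolding vanishing_order_def germ_zero_def by simp
  then show ?thesis using eventually_nhds_x_imp_x assms(2) by blast
qed

lemma vanishing_order_nonzeroI:
  assumes "isCont f t0" "f t0 \<noteq> 0" shows "vanishing_order t0 f 0"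
  using assms unfolding vanishing_order_def zero_enat_def by (auto intro!: exI[of _ f])

lemma vanishing_order_zero: "vanishing_order t0 (\<lambda>t. 0) \<infinity>"
  by (simp add: vanishing_order_def germ_zero_def)

lemma vanishing_order_mult_power:
  assumes "vanishing_order t0 f e"
  shows "vanishing_order t0 (\<lambda>t. (t - t0) ^ r * f t) (e + enat r)"
proof (cases e)
  case (enat m)
  then obtain u where u: "isCont u t0" "u t0 \<noteq> 0" "\<forall>\<^sub>F t in nhds t0. f t = (t - t0) ^ m * u t"
    using assms unfolding vanishing_order_def by auto
  have "\<forall>\<^sub>F t in nhds t0. (t - t0) ^ r * f t = (t - t0) ^ (m + r) * u t"
    using u(3) by eventually_elim (simp add: power_add mult_ac)
  then show ?thesis using u enat unfolding vanishing_order_def by auto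
next
  case infinity
  then have "\<forall>\<^sub>F t in nhds t0. f t = 0" using assms unfolding vanishing_order_def germ_zero_def by simp
  then have "\<forall>\<^sub>F t in nhds t0. (t - t0) ^ r * f t = 0" by eventually_elim simp
  then show ?thesis using infinity unfolding vanishing_order_def germ_zero_def by simp
qed

lemma vanishing_order_div_power:
  assumes "vanishing_order t0 f e" "enat r \<le> e" "isCont g t0"
    and "\<forall>\<^sub>F t in nhds t0. f t = (t - t0) ^ r * g t"
  shows "vanishing_order t0 g (e - enat r)"
proof (cases e)
  case (enat m)
  then obtain u where u: "isCont u t0" "u t0 \<noteq> 0" "\<forall>\<^sub>F t in nhds t0. f t = (t - t0) ^ m * u t"
    using assms unfolding vanishing_order_def by auto
  have rm: "r \<le> m" using assms(2) enat by simp
  have off: "\<forall>\<^sub>F t in at t0. g t = (t - t0) ^ (m - r) * u t"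
    using eventually_at_nhds[OF u(3)] eventually_at_nhds[OF assms(4)] eventually_ne_at
  proof eventually_elim
    case (elim t)
    then have "(t - t0) ^ r * g t = (t - t0) ^ r * ((t - t0) ^ (m - r) * u t)"
      using rm by (simp add: power_add[symmetric] mult.assoc[symmetric])
    then show ?case using elim(3) by simp
  qed
  have "g t0 = (t0 - t0) ^ (m - r) * u t0"
    by (rule isCont_eq_at[of t0 g "\<lambda>t. (t - t0) ^ (m - r) * u t"])
       (use off assms u in \<open>auto intro!: continuous_intros\<close>)
  with off have "\<forall>\<^sub>F t in nhds t0. g t = (t - t0) ^ (m - r) * u t" by (rule eventually_nhdsI_at)
  then show ?thesis using u enat unfolding vanishing_order_def by auto
next
  case infinity
  then have "\<forall>\<^sub>F t in nhds t0. f t = 0" using assms(1) unfolding vanishing_order_def germ_zero_def by simp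
  from eventually_at_nhds[OF this] eventually_at_nhds[OF assms(4)] eventually_ne_at
  have off: "\<forall>\<^sub>F t in at t0. g t = 0" by eventually_elim simp
  have "g t0 = 0" by (rule isCont_eq_at[of t0 g "\<lambda>_. 0"]) (use off assms in auto)
  with off have "\<forall>\<^sub>F t in nhds t0. g t = 0" by (rule eventually_nhdsI_at)
  then show ?thesis using infinity unfolding vanishing_order_def germ_zero_def by simp
qed

lemma mult_at_le:
  assumes "vanishing_order t0 f (enat m)" shows "mult_at t0 f \<le> enat m"
  unfolding mult_at_def
proof (rule Sup_least, clarify)
  fix q e and g :: "real \<Rightarrow> real"
  assume e: "e > 0" "continuous_on (ball t0 e) g" "\<forall>t\<in>ball t0 e. f t = (t - t0) ^ q * g t"
  obtain u where u: "isCont u t0" "u t0 \<noteq> 0" "\<forall>\<^sub>F t in nhds t0. f t = (t - t0) ^ m * u t"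
    using assms unfolding vanishing_order_def by auto
  have "\<forall>\<^sub>F t in nhds t0. t \<in> ball t0 e" using e(1) by (intro eventually_nhds_in_open) auto
  with u(3) have "\<forall>\<^sub>F t in nhds t0. (t - t0) ^ q * g t = (t - t0) ^ m * u t"
    by eventually_elim (use e(3) in auto)
  moreover have "isCont g t0" using e by (simp add: continuous_on_eq_continuous_at)
  ultimately show "enat q \<le> enat m" using power_factor_le[OF _ u(1,2)] by simp
qed

lemma isCont_near_quotient:
  fixes f w :: "real \<Rightarrow> real"
  assumes "\<forall>\<^sub>F t in nhds t0. isCont f t" "\<forall>\<^sub>F t in nhds t0. f t = (t - t0) ^ r * w t" "isCont w t0"
  shows "\<forall>\<^sub>F t in nhds t0. isCont w t"
proof (rule eventually_nhdsI_at[of "\<lambda>t. isCont w t"])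
  have "\<forall>\<^sub>F t in nhds t0. \<forall>\<^sub>F u in nhds t. f u = (u - t0) ^ r * w u"
    using assms(2) by (simp add: eventually_eventually)
  from eventually_at_nhds[OF this] eventually_at_nhds[OF assms(1)] eventually_ne_at
  show "\<forall>\<^sub>F t in at t0. isCont w t"
  proof eventually_elim
    case (elim t)
    have "\<forall>\<^sub>F u in nhds t. u \<noteq> t0" using elim(3) by (intro t1_space_nhds) auto
    with elim(1) have "\<forall>\<^sub>F u in nhds t. inverse ((u - t0) ^ r) * f u = w u"
      by eventually_elim (simp add: field_simps)
    moreover have "isCont (\<lambda>u. inverse ((u - t0) ^ r) * f u) t"
      using elim by (auto intro!: continuous_intros continuous_at_within_inverse)
    ultimately show ?case by (simp only: isCont_cong_near)
  qed
qed fact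

lemma wCk_mult_power: "wCk t0 k (s + j) g \<Longrightarrow> wCk t0 (k + j) s (\<lambda>t. (t - t0) ^ j * g t)"
proof (induction j arbitrary: s)
  case (Suc j)
  have "wCk t0 k (Suc s + j) g" using Suc.prems by (simp only: add_Suc_shift)
  from Suc.IH[OF this] have "wCk t0 (k + j) (Suc s) (\<lambda>t. (t - t0) ^ j * g t)" .
  from wCk_mult_id[OF this] show ?case by (simp add: mult.assoc)
qed simp

lemma wCk_div_power:
  "\<lbrakk>wCk t0 (k + j) s f; \<forall>\<^sub>F t in nhds t0. f t = (t - t0) ^ j * g t; isCont g t0\<rbrakk>
    \<Longrightarrow> wCk t0 k (s + j) g"
proof (induction j arbitrary: s f)
  case 0
  then show ?case using wCk_cong[OF 0(2)] by simp
next
  case (Suc j)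
  have "wCk t0 (k + j) (Suc s) (\<lambda>t. (t - t0) ^ j * g t)"
  proof (rule wCk_div_id)
    show "wCk t0 (Suc (k + j)) s f" using Suc.prems by simp
    show "\<forall>\<^sub>F t in nhds t0. f t = (t - t0) * ((t - t0) ^ j * g t)"
      using Suc.prems(2) by eventually_elim (simp add: mult.assoc)
    show "isCont (\<lambda>t. (t - t0) ^ j * g t) t0" using Suc.prems(3) by (auto intro!: continuous_intros)
  qed
  from Suc.IH[OF this _ Suc.prems(3)] show ?case by simp
qed

section \<open>Polynomials given by their roots\<close>

abbreviation root_poly :: "'i set \<Rightarrow> ('i \<Rightarrow> real) \<Rightarrow> real poly" where
  "root_poly S x \<equiv> \<Prod>i\<in>S. [:- x i, 1:]"

lemma degree_root_poly: "finite S \<Longrightarrow> degree (root_poly S x) = card S"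
  by (subst degree_prod_sum_eq) auto

lemma lead_coeff_root_poly: "lead_coeff (root_poly S x) = 1"
  by (simp add: lead_coeff_prod)

lemma poly_root_poly: "finite S \<Longrightarrow> poly (root_poly S x) y = 0 \<longleftrightarrow> (\<exists>i\<in>S. x i = y)"
  by (auto simp: poly_prod)

lemma coeff_linear_mult: "coeff ([:- a, 1:] * q) k = (case k of 0 \<Rightarrow> 0 | Suc j \<Rightarrow> coeff q j) - a * coeff q k"
  for a :: "'a::comm_ring_1"
  by (cases k) (simp_all add: algebra_simps)

lemma coeff_root_poly_insert:
  assumes "finite S" "i \<notin> S"
  shows "coeff (root_poly (insert i S) x) k
     = (case k of 0 \<Rightarrow> 0 | Suc j \<Rightarrow> coeff (root_poly S x) j) - x i * coeff (root_poly S x) k"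
  unfolding prod.insert[OF assms] by (rule coeff_linear_mult)

lemma coeff_root_poly_card: "finite S \<Longrightarrow> coeff (root_poly S x) (card S) = 1"
  using lead_coeff_root_poly[where S = S and x = x] degree_root_poly by metis

lemma root_poly_first_coeff:
  assumes "finite S" "Suc k = card S"
  shows "coeff (root_poly S x) k = - (\<Sum>i\<in>S. x i)"
  using assms
proof (induction S arbitrary: k rule: finite_induct)
  case (insert i S)
  then have k: "k = card S" by simp
  note eq = coeff_root_poly_insert[OF insert.hyps, of x k]
  have 1: "coeff (root_poly S x) k = 1" unfolding k by (rule coeff_root_poly_card) fact
  show ?case
  proof (cases k)
    case 0
    then have "S = {}" using k insert.hyps by simp
    then show ?thesis unfolding eq 1 using 0 by simp
  next
    case (Suc j)
    then have "coeff (root_poly S x) j = - (\<Sum>i\<in>S. x i)" using insert.IH k by simp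
    then show ?thesis unfolding eq 1 using Suc insert.hyps by simp
  qed
qed simp

lemma root_poly_second_coeff:
  assumes "finite S" "k + 2 = card S"
  shows "2 * coeff (root_poly S x) k = (\<Sum>i\<in>S. x i)\<^sup>2 - (\<Sum>i\<in>S. (x i)\<^sup>2)"
  using assms
proof (induction S arbitrary: k rule: finite_induct)
  case (insert i S)
  then have k: "Suc k = card S" by simp
  note eq = coeff_root_poly_insert[OF insert.hyps, of x k]
  have 1: "coeff (root_poly S x) k = - (\<Sum>i\<in>S. x i)"
    by (rule root_poly_first_coeff[OF insert.hyps(1) k])
  show ?case
  proof (cases k)
    case 0
    then obtain b where "S = {b}" using k by (metis One_nat_def card_1_singletonE)
    then show ?thesis unfolding eq 1 using 0 insert.hyps by (simp add: power2_eq_square algebra_simps)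
  next
    case (Suc j)
    then have "2 * coeff (root_poly S x) j = (\<Sum>i\<in>S. x i)\<^sup>2 - (\<Sum>i\<in>S. (x i)\<^sup>2)"
      using insert.IH[of j] k by simp
    then show ?thesis unfolding eq 1 using Suc insert.hyps by (simp add: power2_eq_square algebra_simps)
  qed
qed simp

text \<open>Stated without division, so that it includes \<open>c = 0\<close>, which is the case at the centre of a rescaling.\<close>

lemma coeff_root_poly_scale:
  assumes "finite S" "k \<le> card S"
  shows "coeff (root_poly S (\<lambda>i. c * x i)) k = c ^ (card S - k) * coeff (root_poly S x) k"
  using assms
proof (induction S arbitrary: k rule: finite_induct)
  case (insert i S)
  note eq = coeff_root_poly_insert[OF insert.hyps]
  show ?case
  proof (cases "k \<le> card S")
    case True
    then have 1: "coeff (root_poly S (\<lambda>i. c * x i)) k = c ^ (card S - k) * coeff (root_poly S x) k"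
      by (rule insert.IH)
    have 2: "(case k of 0 \<Rightarrow> 0 | Suc j \<Rightarrow> coeff (root_poly S (\<lambda>i. c * x i)) j)
        = c ^ (Suc (card S) - k) * (case k of 0 \<Rightarrow> 0 | Suc j \<Rightarrow> coeff (root_poly S x) j)"
      using insert.IH[of "k - 1"] True by (cases k) auto
    have 3: "card (insert i S) - k = Suc (card S - k)" "Suc (card S) - k = Suc (card S - k)"
      using insert.hyps True by auto
    show ?thesis unfolding eq 1 2 3 by (simp add: algebra_simps)
  next
    case False
    then have k: "k = Suc (card S)" using insert by simp
    have z: "coeff (root_poly S y) (Suc (card S)) = 0" for y
      using insert.hyps by (intro coeff_eq_0) (simp add: degree_root_poly)
    show ?thesis unfolding eq k nat.case z using insert.IH[of "card S"] insert.hyps by simp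
  qed
qed simp

lemma center_root_poly:
  assumes "finite S" "S \<noteq> {}"
  defines "c \<equiv> (\<lambda>x. (\<Sum>i\<in>S. x i) / real (card S))"
  shows "acoeff (root_poly S x) 1 / real (degree (root_poly S x)) = c x"
    "center (root_poly S x) = root_poly S (\<lambda>i. x i - c x)"
proof -
  obtain k where k: "Suc k = card S" using assms by (metis card_gt_0_iff gr0_implies_Suc)
  show 1: "acoeff (root_poly S x) 1 / real (degree (root_poly S x)) = c x"
    using root_poly_first_coeff[OF assms(1) k, of x] k
    by (simp add: acoeff_def degree_root_poly assms(1) c_def k[symmetric])
  show "center (root_poly S x) = root_poly S (\<lambda>i. x i - c x)"
    unfolding center_def 1 pcompose_prod by (simp add: pcompose_pCons)
qed

text \<open>By Newton's identity, as the roots of the centered polynomial have sum zero.\<close>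

lemma acoeff2_center_root_poly:
  assumes "finite S" "2 \<le> card S"
  defines "c \<equiv> (\<lambda>x. (\<Sum>i\<in>S. x i) / real (card S))"
  shows "acoeff (center (root_poly S x)) 2 = - (\<Sum>i\<in>S. (x i - c x)\<^sup>2) / 2"
proof -
  obtain k where k: "k + 2 = card S" using assms(2) by (metis add.commute le_Suc_ex)
  have ne: "S \<noteq> {}" using assms(2) by auto
  have "(\<Sum>i\<in>S. x i - c x) = 0" using k ne assms(1) by (simp add: sum_subtractf c_def)
  then have 2: "2 * coeff (root_poly S (\<lambda>i. x i - c x)) k = - (\<Sum>i\<in>S. (x i - c x)\<^sup>2)"
    using root_poly_second_coeff[OF assms(1) k, of "\<lambda>i. x i - c x"] by simp
  have "center (root_poly S x) = root_poly S (\<lambda>i. x i - c x)"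
    unfolding c_def by (rule center_root_poly(2)[OF assms(1) ne])
  moreover have "degree (root_poly S (\<lambda>i. x i - c x)) - 2 = k"
    using k by (simp only: degree_root_poly[OF assms(1)])
  ultimately have "acoeff (center (root_poly S x)) 2
      = (- 1) ^ 2 * coeff (root_poly S (\<lambda>i. x i - c x)) k"
    by (simp only: acoeff_def)
  then show ?thesis using 2 by simp
qed

lemma coprime_linear_poly:
  assumes "poly q x \<noteq> 0" shows "coprime [:- x, 1:] (q :: real poly)"
proof (rule prime_elem_imp_coprime)
  show "prime_elem [:- x, 1:]" by (rule prime_elem_linear_field_poly) simp
  show "\<not> [:- x, 1:] dvd q" using assms by (simp add: poly_eq_0_iff_dvd)
qed

lemma coprime_root_poly:
  assumes "\<And>i. i \<in> S \<Longrightarrow> poly q (x i) \<noteq> 0" shows "coprime (root_poly S x) q"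
  by (rule prod_coprime_left) (use assms coprime_linear_poly in blast)

lemma monic_dvd_antisym:
  fixes p q :: "real poly"
  assumes "p dvd q" "q dvd p" "lead_coeff p = 1" "lead_coeff q = 1" shows "p = q"
proof -
  obtain r where r: "q = p * r" using assms(1) by (rule dvdE)
  have nz: "p \<noteq> 0" "q \<noteq> 0" using assms by auto
  then have "degree q \<le> degree p" "r \<noteq> 0" using assms(2) r by (auto intro: dvd_imp_degree_le)
  then have "degree r = 0" using degree_mult_eq[OF nz(1)] r by simp
  moreover have "lead_coeff r = 1" using assms(3,4) r by (simp add: lead_coeff_mult)
  ultimately have "r = 1" by (metis degree_eq_zeroE coeff_pCons_0 pCons_one)
  then show ?thesis using r by simp
qed

text \<open>A monic factor of a product of linear polynomials consists of those linear factors at whose roots it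
  vanishes.\<close>

lemma monic_factor_eq_root_poly:
  assumes "A * B = root_poly S x * root_poly T x" "lead_coeff A = 1"
    "\<And>i. i \<in> T \<Longrightarrow> poly A (x i) \<noteq> 0" "\<And>i. i \<in> S \<Longrightarrow> poly B (x i) \<noteq> 0"
  shows "A = root_poly S x"
proof (rule monic_dvd_antisym)
  have "root_poly S x dvd A * B" unfolding assms(1) by simp
  moreover have "coprime (root_poly S x) B" by (rule coprime_root_poly) (rule assms(4))
  ultimately show "root_poly S x dvd A" by (simp only: coprime_dvd_mult_left_iff)
  have "A dvd root_poly S x * root_poly T x" unfolding assms(1)[symmetric] by simp
  moreover have "coprime (root_poly T x) A" by (rule coprime_root_poly) (rule assms(3))
  then have "coprime A (root_poly T x)" by (simp only: coprime_commute)
  ultimately show "A dvd root_poly S x" by (simp only: coprime_dvd_mult_left_iff)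
  show "lead_coeff A = 1" "lead_coeff (root_poly S x) = 1"
    using assms(2) lead_coeff_root_poly[where S = S and x = x] by simp_all
qed

lemma map_poly_of_real_mult:
  "map_poly complex_of_real (p * q) = map_poly complex_of_real p * map_poly complex_of_real q"
  by (rule poly_eqI) (simp add: coeff_map_poly coeff_mult)

lemma poly_map_poly_of_real:
  "poly (map_poly complex_of_real p) (complex_of_real x) = complex_of_real (poly p x)"
  by (simp add: poly_altdef degree_map_poly coeff_map_poly)

lemma hyperbolic_splits:
  assumes "hyperbolic p"
  shows "\<exists>xs. length xs = degree p \<and> p = (\<Prod>x\<leftarrow>xs. [:- x, 1:])"
  using assms
proof (induction "degree p" arbitrary: p)
  case 0
  then have "degree p = 0" "coeff p 0 = 1" by (simp_all add: hyperbolic_def)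
  then have "p = 1" by (metis degree_eq_zeroE coeff_pCons_0 pCons_one)
  then show ?case by (intro exI[of _ "[]"]) auto
next
  case (Suc n)
  have lc: "lead_coeff p = 1" and real: "\<And>z::complex. poly (map_poly complex_of_real p) z = 0 \<Longrightarrow> z \<in> \<real>"
    using Suc.prems unfolding hyperbolic_def by auto
  have "degree (map_poly complex_of_real p) = degree p" by (intro degree_map_poly) auto
  then have "\<not> constant (poly (map_poly complex_of_real p))" using Suc.hyps(2) by (simp add: constant_degree)
  then obtain z where z: "poly (map_poly complex_of_real p) z = 0"
    using fundamental_theorem_of_algebra by blast
  then obtain x where "z = complex_of_real x" using real by (auto elim: Reals_cases)
  then have "poly p x = 0" using z by (simp add: poly_map_poly_of_real)
  then obtain q where q: "p = [:- x, 1:] * q" by (auto simp: poly_eq_0_iff_dvd elim: dvdE)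
  have q0: "q \<noteq> 0" using q Suc.hyps(2) by auto
  have "degree p = degree [:- x, 1:] + degree q" unfolding q by (rule degree_mult_eq) (use q0 in auto)
  then have dq: "degree q = n" using Suc.hyps(2) by simp
  have lq: "lead_coeff q = 1" using lc unfolding q lead_coeff_mult by simp
  have "hyperbolic q"
    unfolding hyperbolic_def
  proof (intro conjI allI impI lq)
    fix w :: complex assume "poly (map_poly complex_of_real q) w = 0"
    moreover have "map_poly complex_of_real p = map_poly complex_of_real [:- x, 1:] * map_poly complex_of_real q"
      unfolding q by (rule map_poly_of_real_mult)
    ultimately show "w \<in> \<real>" by (intro real) simp
  qed
  then obtain xs where "length xs = degree q" "q = (\<Prod>x\<leftarrow>xs. [:- x, 1:])" using Suc.hyps(1)[OF dq[symmetric]] by blast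
  then show ?case using q dq Suc.hyps(2) by (intro exI[of _ "x # xs"]) auto
qed

section \<open>Families of roots and their contact orders\<close>

text \<open>The index set is arbitrary because factors correspond to subsets of the roots. The number \<open>e i j\<close>
  is the contact order of the roots \<open>i\<close> and \<open>j\<close>, and in particular \<open>e i i = \<infinity>\<close>.\<close>

definition root_family ::
  "real \<Rightarrow> nat set \<Rightarrow> (nat \<Rightarrow> real \<Rightarrow> real) \<Rightarrow> (nat \<Rightarrow> nat \<Rightarrow> enat) \<Rightarrow> (real \<Rightarrow> real poly) \<Rightarrow> bool" where
  "root_family t0 S l e P \<longleftrightarrow> finite S \<and> (\<forall>i\<in>S. Ck_at t0 0 (l i)) \<and>
     (\<forall>i\<in>S. \<forall>j\<in>S. vanishing_order t0 (\<lambda>t. l i t - l j t) (e i j)) \<and>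
     (\<forall>\<^sub>F t in nhds t0. P t = root_poly S (\<lambda>i. l i t))"

definition finite_part :: "enat \<Rightarrow> nat" where
  "finite_part x = (case x of enat m \<Rightarrow> m | \<infinity> \<Rightarrow> 0)"

text \<open>In the recursion the root \<open>i\<close> stays together with the root \<open>j\<close> for \<open>e i j\<close> units of rescaling. After
  \<open>last_contact e S i\<close> units only roots that are identical to \<open>i\<close> are left in its cluster, and the
  recursion stops.\<close>

definition last_contact :: "(nat \<Rightarrow> nat \<Rightarrow> enat) \<Rightarrow> nat set \<Rightarrow> nat \<Rightarrow> nat" where
  "last_contact e S i = Max ((\<lambda>j. finite_part (e i j)) ` S)"

text \<open>One unit of rescaling of a cluster of \<open>m\<close> roots contributes \<open>m\<close> to \<open>\<Gamma>\<close> and \<open>m - 1\<close> to \<open>\<Gamma> - \<gamma>\<close>. Summing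
  the contributions along the path of the root \<open>i\<close> by counting how long each other root accompanies it
  gives \<open>root_loss\<close> for \<open>\<Gamma> - \<gamma>\<close>; the root \<open>i\<close> itself adds \<open>last_contact\<close> to \<open>\<Gamma>\<close>. The rules of the
  recursion take the maximum over all paths.\<close>

definition root_loss :: "(nat \<Rightarrow> nat \<Rightarrow> enat) \<Rightarrow> nat set \<Rightarrow> nat \<Rightarrow> nat" where
  "root_loss e S i = (\<Sum>j\<in>S - {i}. case e i j of enat m \<Rightarrow> m | \<infinity> \<Rightarrow> last_contact e S i)"

definition max_loss :: "(nat \<Rightarrow> nat \<Rightarrow> enat) \<Rightarrow> nat set \<Rightarrow> nat" where
  "max_loss e S = Max (root_loss e S ` S)"

definition max_order :: "(nat \<Rightarrow> nat \<Rightarrow> enat) \<Rightarrow> nat set \<Rightarrow> nat" where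
  "max_order e S = Max ((\<lambda>i. root_loss e S i + last_contact e S i) ` S)"

lemma root_family_refl:
  assumes "root_family t0 S l e P" "i \<in> S" shows "e i i = \<infinity>"
proof -
  have "vanishing_order t0 (\<lambda>t. l i t - l i t) (e i i)" using assms unfolding root_family_def by blast
  then have "vanishing_order t0 (\<lambda>t. 0) (e i i)" by simp
  then show ?thesis using vanishing_order_zero by (rule vanishing_order_unique)
qed

lemma root_family_finite: "root_family t0 S l e P \<Longrightarrow> finite S"
  by (simp add: root_family_def)

lemma root_family_cont: "root_family t0 S l e P \<Longrightarrow> i \<in> S \<Longrightarrow> Ck_at t0 0 (l i)"
  by (simp add: root_family_def)

lemma root_family_isCont: "root_family t0 S l e P \<Longrightarrow> i \<in> S \<Longrightarrow> isCont (l i) t0"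
  using Ck_at_imp_isCont[OF root_family_cont] eventually_nhds_x_imp_x by blast

lemma root_family_contact:
  "root_family t0 S l e P \<Longrightarrow> i \<in> S \<Longrightarrow> j \<in> S \<Longrightarrow> vanishing_order t0 (\<lambda>t. l i t - l j t) (e i j)"
  by (simp add: root_family_def)

lemma root_family_eq: "root_family t0 S l e P \<Longrightarrow> \<forall>\<^sub>F t in nhds t0. P t = root_poly S (\<lambda>i. l i t)"
  by (simp add: root_family_def)

lemma root_family_mono:
  assumes "root_family t0 S l e P" "T \<subseteq> S" "\<forall>\<^sub>F t in nhds t0. Q t = root_poly T (\<lambda>i. l i t)"
  shows "root_family t0 T l e Q"
  using assms finite_subset[of T S] unfolding root_family_def by (auto simp: subset_iff)

lemma root_family_card:
  assumes "root_family t0 S l e P" "hyperbolic_curve_near t0 n P" shows "card S = n"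
proof -
  have "P t0 = root_poly S (\<lambda>i. l i t0)" using root_family_eq[OF assms(1)] by (rule eventually_nhds_x_imp_x)
  moreover have "degree (P t0) = n"
    using assms(2) eventually_nhds_x_imp_x unfolding hyperbolic_curve_near_def by fastforce
  ultimately show ?thesis using degree_root_poly[OF root_family_finite[OF assms(1)]] by simp
qed

subsection \<open>The contact numbers of a family\<close>

lemma all_infinite_numbers:
  assumes "finite S" "S \<noteq> {}" "\<And>i j. i \<in> S \<Longrightarrow> j \<in> S \<Longrightarrow> e i j = \<infinity>"
  shows "max_loss e S = 0" "max_order e S = 0"
proof -
  have 1: "last_contact e S i = 0" if "i \<in> S" for i
  proof -
    have "(\<lambda>j. finite_part (e i j)) ` S = {0}" using assms that by (auto simp: finite_part_def)
    then show ?thesis by (simp add: last_contact_def)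
  qed
  have 2: "root_loss e S i = 0" if "i \<in> S" for i
    unfolding root_loss_def using assms(3)[OF that] 1[OF that] by (intro sum.neutral) auto
  have "root_loss e S ` S = {0}" "(\<lambda>i. root_loss e S i + last_contact e S i) ` S = {0}"
    using 1 2 assms(2) by auto
  then show "max_loss e S = 0" "max_order e S = 0" by (simp_all add: max_loss_def max_order_def)
qed

lemma split_last_contact:
  assumes "finite S" "S = S1 \<union> S2" "i \<in> S1" "\<And>j. j \<in> S2 \<Longrightarrow> e i j = 0"
  shows "last_contact e S i = last_contact e S1 i"
proof (cases "S2 = {}")
  case False
  have fin: "finite S1" "finite S2" using assms by auto
  have "(\<lambda>j. finite_part (e i j)) ` S2 = (\<lambda>j. 0) ` S2"
    by (rule image_cong) (simp_all add: assms(4) finite_part_def zero_enat_def)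
  then have "(\<lambda>j. finite_part (e i j)) ` S = (\<lambda>j. finite_part (e i j)) ` S1 \<union> {0}"
    using False by (auto simp: assms(2) image_Un)
  then have "last_contact e S i = max (last_contact e S1 i) 0"
    unfolding last_contact_def using fin assms(3) by (simp only:) (subst Max_Un, auto)
  then show ?thesis by simp
qed (use assms in simp)

lemma split_root_loss:
  assumes "finite S" "S = S1 \<union> S2" "S1 \<inter> S2 = {}" "i \<in> S1" "\<And>j. j \<in> S2 \<Longrightarrow> e i j = 0"
  shows "root_loss e S i = root_loss e S1 i"
proof -
  have "root_loss e S i = (\<Sum>j\<in>S1 - {i}. case e i j of enat m \<Rightarrow> m | \<infinity> \<Rightarrow> last_contact e S i)"
    unfolding root_loss_def
    by (rule sum.mono_neutral_right) (use assms in \<open>auto simp: zero_enat_def\<close>)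
  moreover have "last_contact e S i = last_contact e S1 i"
    by (rule split_last_contact[where ?S2.0 = S2]) (use assms in auto)
  ultimately show ?thesis by (simp only: root_loss_def)
qed

text \<open>Contact order \<open>0\<close> contributes nothing to any path.\<close>

lemma split_numbers:
  assumes "finite S" "S = S1 \<union> S2" "S1 \<inter> S2 = {}" "S1 \<noteq> {}" "S2 \<noteq> {}"
    "\<And>i j. i \<in> S1 \<Longrightarrow> j \<in> S2 \<Longrightarrow> e i j = 0 \<and> e j i = 0"
  shows "max_loss e S = max (max_loss e S1) (max_loss e S2)"
    "max_order e S = max (max_order e S1) (max_order e S2)"
proof -
  have fin: "finite S1" "finite S2" using assms by auto
  have S': "S = S2 \<union> S1" "S2 \<inter> S1 = {}" using assms by auto
  have a: "root_loss e S i = root_loss e S1 i" "last_contact e S i = last_contact e S1 i" if "i \<in> S1" for i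
    using split_root_loss[OF assms(1-3) that] split_last_contact[OF assms(1,2) that] assms(6)[OF that] by blast+
  have b: "root_loss e S i = root_loss e S2 i" "last_contact e S i = last_contact e S2 i" if "i \<in> S2" for i
    using split_root_loss[OF assms(1) S' that] split_last_contact[OF assms(1) S'(1) that] assms(6)[OF _ that] by blast+
  have "root_loss e S ` S = root_loss e S1 ` S1 \<union> root_loss e S2 ` S2"
    unfolding assms(2) image_Un using a b assms(2) by (metis image_cong)
  then show "max_loss e S = max (max_loss e S1) (max_loss e S2)"
    unfolding max_loss_def using fin assms(4,5) by (simp only:) (subst Max_Un, auto)
  have "(\<lambda>i. root_loss e S i + last_contact e S i) ` S
      = (\<lambda>i. root_loss e S1 i + last_contact e S1 i) ` S1 \<union> (\<lambda>i. root_loss e S2 i + last_contact e S2 i) ` S2"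
    (is "?f ` S = ?f1 ` S1 \<union> ?f2 ` S2")
  proof -
    have "?f ` S = ?f ` S1 \<union> ?f ` S2" by (subst (1) assms(2)) (rule image_Un)
    moreover have "?f ` S1 = ?f1 ` S1" by (rule image_cong) (use a in simp_all)
    moreover have "?f ` S2 = ?f2 ` S2" by (rule image_cong) (use b in simp_all)
    ultimately show ?thesis by simp
  qed
  then show "max_order e S = max (max_order e S1) (max_order e S2)"
    unfolding max_order_def using fin assms(4,5) by (simp only:) (subst Max_Un, auto)
qed

text \<open>Every root has the contact order \<open>r\<close> with some root. Hence \<open>last_contact\<close> drops by \<open>r\<close> as well: it
  is not the value \<open>0\<close> of a root without finite contact orders.\<close>

lemma rescale_numbers:
  assumes "finite S" "S \<noteq> {}" "\<And>i j. i \<in> S \<Longrightarrow> j \<in> S \<Longrightarrow> enat r \<le> e i j"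
    and "\<And>i. i \<in> S \<Longrightarrow> \<exists>j\<in>S. e i j = enat r"
  defines "e' \<equiv> (\<lambda>i j. e i j - enat r)"
  shows "max_loss e S = max_loss e' S + (card S - 1) * r"
    "max_order e S = max_order e' S + card S * r"
proof -
  have L: "last_contact e S i = last_contact e' S i + r" if i: "i \<in> S" for i
  proof -
    obtain j0 where j0: "j0 \<in> S" "e i j0 = enat r" using assms(4) i by blast
    have le: "finite_part (e i j) \<le> finite_part (e' i j) + r" if "j \<in> S" for j
      by (cases "e i j") (simp_all add: e'_def finite_part_def)
    have eq: "finite_part (e i j) = finite_part (e' i j) + r" if "j \<in> S" "e i j \<noteq> \<infinity>" for j
      using assms(3)[OF i that(1)] that(2) by (cases "e i j") (simp_all add: e'_def finite_part_def)
    show ?thesis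
    proof (rule antisym)
      show "last_contact e S i \<le> last_contact e' S i + r"
        unfolding last_contact_def
      proof (rule Max.boundedI)
        fix x assume "x \<in> (\<lambda>j. finite_part (e i j)) ` S"
        then obtain j where j: "j \<in> S" "x = finite_part (e i j)" by blast
        have "finite_part (e' i j) \<le> Max ((\<lambda>j. finite_part (e' i j)) ` S)" using j assms(1) by (intro Max_ge) auto
        then show "x \<le> Max ((\<lambda>j. finite_part (e' i j)) ` S) + r" using le[OF j(1)] j by linarith
      qed (use assms in auto)
      have "Max ((\<lambda>j. finite_part (e' i j)) ` S) \<in> (\<lambda>j. finite_part (e' i j)) ` S"
        using assms by (intro Max_in) auto
      then obtain j where j: "j \<in> S" "last_contact e' S i = finite_part (e' i j)"
        unfolding last_contact_def by auto
      have "\<exists>j\<in>S. last_contact e' S i + r \<le> finite_part (e i j)"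
      proof (cases "e i j = \<infinity>")
        case True
        then have "last_contact e' S i = 0" using j by (simp add: e'_def finite_part_def)
        then show ?thesis using j0 by (intro bexI[of _ j0]) (simp_all add: finite_part_def)
      next
        case False
        then show ?thesis using j eq by (intro bexI[of _ j]) simp_all
      qed
      then obtain j1 where j1: "j1 \<in> S" "last_contact e' S i + r \<le> finite_part (e i j1)" by blast
      have "finite_part (e i j1) \<le> last_contact e S i"
        unfolding last_contact_def using j1 assms(1) by (intro Max_ge) auto
      then show "last_contact e' S i + r \<le> last_contact e S i" using j1(2) by linarith
    qed
  qed
  have R: "root_loss e S i = root_loss e' S i + (card S - 1) * r" if i: "i \<in> S" for i
  proof -
    have "root_loss e S i = (\<Sum>j\<in>S - {i}. (case e' i j of enat m \<Rightarrow> m | \<infinity> \<Rightarrow> last_contact e' S i) + r)"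
      unfolding root_loss_def
    proof (rule sum.cong[OF refl])
      fix j assume "j \<in> S - {i}"
      then show "(case e i j of enat m \<Rightarrow> m | \<infinity> \<Rightarrow> last_contact e S i)
          = (case e' i j of enat m \<Rightarrow> m | \<infinity> \<Rightarrow> last_contact e' S i) + r"
        using assms(3)[OF i, of j] L[OF i] by (cases "e i j") (simp_all add: e'_def)
    qed
    then show ?thesis using i assms(1) by (simp add: root_loss_def sum.distrib)
  qed
  have "root_loss e S ` S = (\<lambda>i. root_loss e' S i + (card S - 1) * r) ` S"
    by (rule image_cong) (use R in auto)
  then show "max_loss e S = max_loss e' S + (card S - 1) * r"
    unfolding max_loss_def by (simp only: Max_add_commute[OF assms(1,2)])
  have "root_loss e S i + last_contact e S i = (root_loss e' S i + last_contact e' S i) + card S * r"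
    if "i \<in> S" for i
  proof -
    have "card S \<ge> 1" using assms(1,2) by (simp add: Suc_leI card_gt_0_iff)
    then have "(card S - 1) * r + r = card S * r" by (cases "card S") auto
    then show ?thesis using R[OF that] L[OF that] by linarith
  qed
  then have "(\<lambda>i. root_loss e S i + last_contact e S i) ` S
      = (\<lambda>i. (root_loss e' S i + last_contact e' S i) + card S * r) ` S"
    by (rule image_cong[OF refl])
  then show "max_order e S = max_order e' S + card S * r"
    unfolding max_order_def by (simp only: Max_add_commute[OF assms(1,2)])
qed

subsection \<open>The centered curve\<close>

definition mean_root :: "nat set \<Rightarrow> (nat \<Rightarrow> real \<Rightarrow> real) \<Rightarrow> real \<Rightarrow> real" where
  "mean_root S l t = (\<Sum>i\<in>S. l i t) / real (card S)"

lemma root_family_center: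
  assumes "root_family t0 S l e P" "S \<noteq> {}"
  shows "\<forall>\<^sub>F t in nhds t0. mean_root S l t = - coeff (P t) (card S - 1) / real (card S) \<and>
    center (P t) = pcompose (P t) [:mean_root S l t, 1:] \<and>
    center (P t) = root_poly S (\<lambda>i. l i t - mean_root S l t)"
  using root_family_eq[OF assms(1)]
proof eventually_elim
  case (elim t)
  note fin = root_family_finite[OF assms(1)]
  note c = center_root_poly[OF fin assms(2), of "\<lambda>i. l i t", folded elim mean_root_def]
  have "degree (P t) = card S" unfolding elim by (rule degree_root_poly[OF fin])
  then have "mean_root S l t = - coeff (P t) (card S - 1) / real (card S)"
    using c(1) by (simp add: acoeff_def)
  moreover have "center (P t) = pcompose (P t) [:mean_root S l t, 1:]"
    unfolding center_def c(1) ..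
  ultimately show ?case using c(2) by blast
qed

lemma mean_root_wCk:
  assumes "root_family t0 S l e P" "S \<noteq> {}" "\<And>i. wCk t0 k s (\<lambda>t. coeff (P t) i)"
  shows "wCk t0 k s (mean_root S l)"
proof -
  have "\<forall>\<^sub>F t in nhds t0. mean_root S l t = (- 1 / real (card S)) * coeff (P t) (card S - 1)"
    using root_family_center[OF assms(1,2)] by eventually_elim simp
  from wCk_cong[OF this] show ?thesis by (simp only:) (intro wCk_mult wCk_const assms(3))
qed

lemma (in germ_algebra) coeff_pcompose:
  assumes "\<And>i. C (\<lambda>t. coeff (P t) i)" "C c"
  shows "C (\<lambda>t. coeff (\<Sum>i\<le>n. smult (coeff (P t) i) ([:c t, 1:] ^ i)) k)"
proof -
  have "C (\<lambda>t. coeff ([:c t, 1:] ^ i) k)" for i k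
  proof (induction i arbitrary: k)
    case 0
    then show ?case using const by simp
  next
    case (Suc i)
    have "coeff ([:c t, 1:] ^ Suc i) k = c t * coeff ([:c t, 1:] ^ i) k
        + (case k of 0 \<Rightarrow> 0 | Suc j \<Rightarrow> coeff ([:c t, 1:] ^ i) j)" for t
      by (simp add: coeff_pCons)
    then show ?case using Suc assms(2) by (cases k) (auto intro!: add mult const)
  qed
  then show ?thesis by (simp only: coeff_sum coeff_smult) (intro sum mult assms(1))
qed

text \<open>A form of composition that exhibits the coefficients as polynomials in the data.\<close>

lemma pcompose_eq_sum:
  fixes p q :: "real poly"
  assumes "degree p \<le> n" shows "pcompose p q = (\<Sum>i\<le>n. smult (coeff p i) (q ^ i))"
proof -
  have "pcompose (monom a i) q = smult a (q ^ i)" for a :: real and i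
    by (induction i) (simp_all add: monom_0 monom_Suc pcompose_pCons)
  then show ?thesis
    by (subst poly_as_sum_of_monoms'[OF assms, symmetric]) (simp only: pcompose_sum)
qed

lemma center_wCk:
  assumes "root_family t0 S l e P" "S \<noteq> {}" "\<And>i. wCk t0 k s (\<lambda>t. coeff (P t) i)"
  shows "wCk t0 k s (\<lambda>t. coeff (center (P t)) i)"
proof -
  interpret germ_algebra t0 "wCk t0 k s" by (rule germ_algebra_wCk)
  have "\<forall>\<^sub>F t in nhds t0. coeff (center (P t)) i =
     coeff (\<Sum>i\<le>card S. smult (coeff (P t) i) ([:mean_root S l t, 1:] ^ i)) i"
    using root_family_center[OF assms(1,2)] root_family_eq[OF assms(1)]
  proof eventually_elim
    case (elim t)
    have "degree (P t) \<le> card S" unfolding elim(2)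
      using degree_root_poly[OF root_family_finite[OF assms(1)]] by simp
    from pcompose_eq_sum[OF this] show ?case using elim(1) by simp
  qed
  from wCk_cong[OF this] show ?thesis
    using coeff_pcompose[OF assms(3) mean_root_wCk[OF assms]] by simp
qed

lemma all_contacts_infinite:
  assumes "root_family t0 S l e P" "S \<noteq> {}" "\<And>i j. i \<in> S \<Longrightarrow> j \<in> S \<Longrightarrow> e i j = \<infinity>" "i \<in> S"
  shows "\<forall>\<^sub>F t in nhds t0. l i t = mean_root S l t"
proof -
  have "\<forall>\<^sub>F t in nhds t0. \<forall>j\<in>S. l i t - l j t = 0"
    using root_family_contact[OF assms(1,4)] assms(3)[OF assms(4)] root_family_finite[OF assms(1)]
    by (intro eventually_ball_finite) (auto simp: vanishing_order_def germ_zero_def)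
  then show ?thesis
  proof eventually_elim
    case (elim t)
    then have "(\<Sum>j\<in>S. l j t) = (\<Sum>j\<in>S. l i t)" by (intro sum.cong) auto
    then show ?case using assms(2) root_family_finite[OF assms(1)] by (simp add: mean_root_def)
  qed
qed

section \<open>The order of the second coefficient\<close>

text \<open>With the least contact order \<open>m\<close> the centered roots are \<open>(t - t0)^m w\<^sub>i\<close> with continuous \<open>w\<^sub>i\<close> that do not
  all vanish at \<open>t0\<close>, and the second coefficient of the centered polynomial is \<open>- 1/2\<close> times the sum of
  the squares of the centered roots. Over the reals these squares cannot cancel.\<close>

lemma second_coefficient_order:
  assumes rf: "root_family t0 S l e P" and two: "2 \<le> card S"
    and i0: "i0 \<in> S" and j0: "j0 \<in> S" and e0: "e i0 j0 = enat m"
    and le: "\<And>i j. i \<in> S \<Longrightarrow> j \<in> S \<Longrightarrow> enat m \<le> e i j"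
  shows "\<exists>w. (\<forall>i\<in>S. Ck_at t0 0 (w i) \<and> (\<forall>\<^sub>F t in nhds t0. l i t - mean_root S l t = (t - t0) ^ m * w i t))
     \<and> w i0 t0 \<noteq> w j0 t0
     \<and> vanishing_order t0 (\<lambda>t. acoeff (center (P t)) 2) (enat (2 * m))"
proof -
  note fin = root_family_finite[OF rf]
  have ne: "S \<noteq> {}" using i0 by blast
  have "\<exists>v. isCont v t0 \<and> (\<forall>\<^sub>F t in nhds t0. l i t - l j t = (t - t0) ^ m * v t)"
    if ij: "i \<in> S" "j \<in> S" for i j
  proof (cases "e i j")
    case (enat q)
    then obtain u where u: "isCont u t0" "\<forall>\<^sub>F t in nhds t0. l i t - l j t = (t - t0) ^ q * u t"
      using root_family_contact[OF rf ij] unfolding vanishing_order_def by auto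
    obtain d where d: "q = m + d" using le[OF ij] enat by (metis enat_ord_simps(1) le_Suc_ex)
    show ?thesis
    proof (intro exI[of _ "\<lambda>t. (t - t0) ^ d * u t"] conjI)
      show "\<forall>\<^sub>F t in nhds t0. l i t - l j t = (t - t0) ^ m * ((t - t0) ^ d * u t)"
        using u(2) by eventually_elim (simp add: d power_add)
    qed (use u(1) in \<open>auto intro!: continuous_intros\<close>)
  next
    case infinity
    then have "\<forall>\<^sub>F t in nhds t0. l i t - l j t = 0"
      using root_family_contact[OF rf ij] unfolding vanishing_order_def germ_zero_def by simp
    then show ?thesis by (intro exI[of _ "\<lambda>_. 0"]) (auto elim: eventually_mono)
  qed
  then obtain v where v: "\<And>i j. i \<in> S \<Longrightarrow> j \<in> S \<Longrightarrow> isCont (v i j) t0"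
    and veq: "\<And>i j. i \<in> S \<Longrightarrow> j \<in> S \<Longrightarrow> \<forall>\<^sub>F t in nhds t0. l i t - l j t = (t - t0) ^ m * v i j t"
    by metis
  \<comment> \<open>Centering replaces a root by the average of its differences to all roots.\<close>
  define w where "w = (\<lambda>i t. (\<Sum>j\<in>S. v i j t) / real (card S))"
  have card: "real (card S) \<noteq> 0" using two by simp
  have wc: "isCont (w i) t0" if "i \<in> S" for i
    unfolding w_def using v[OF that] card by (intro continuous_intros) auto
  have weq: "\<forall>\<^sub>F t in nhds t0. l i t - mean_root S l t = (t - t0) ^ m * w i t" if i: "i \<in> S" for i
  proof -
    have "\<forall>\<^sub>F t in nhds t0. \<forall>j\<in>S. l i t - l j t = (t - t0) ^ m * v i j t"
      using fin veq[OF i] by (intro eventually_ball_finite) auto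
    then show ?thesis
    proof eventually_elim
      case (elim t)
      have "l i t - mean_root S l t = (\<Sum>j\<in>S. l i t - l j t) / real (card S)"
        using card by (simp add: mean_root_def sum_subtractf field_simps)
      also have "(\<Sum>j\<in>S. l i t - l j t) = (t - t0) ^ m * (\<Sum>j\<in>S. v i j t)"
        unfolding sum_distrib_left by (rule sum.cong) (use elim in auto)
      finally show ?case by (simp add: w_def)
    qed
  qed
  have wcont: "Ck_at t0 0 (w i)" if i: "i \<in> S" for i
  proof -
    have "Ck_at t0 0 (\<lambda>t. l i t - mean_root S l t)"
    proof -
      have a: "\<forall>\<^sub>F t in nhds t0. \<forall>j\<in>S. isCont (l j) t"
        using fin root_family_cont[OF rf] by (intro eventually_ball_finite) auto
      show ?thesis unfolding Ck_at.simps
        using a by eventually_elim (use card i in \<open>auto simp: mean_root_def intro!: continuous_intros\<close>)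
    qed
    then have "\<forall>\<^sub>F t in nhds t0. isCont (\<lambda>t. l i t - mean_root S l t) t" by simp
    from isCont_near_quotient[OF this weq[OF i] wc[OF i]] show ?thesis by simp
  qed
  obtain u where u: "isCont u t0" "u t0 \<noteq> 0" "\<forall>\<^sub>F t in nhds t0. l i0 t - l j0 t = (t - t0) ^ m * u t"
    using root_family_contact[OF rf i0 j0] e0 unfolding vanishing_order_def by auto
  have "\<forall>\<^sub>F t in at t0. w i0 t - w j0 t = u t"
    using eventually_at_nhds[OF weq[OF i0]] eventually_at_nhds[OF weq[OF j0]]
      eventually_at_nhds[OF u(3)] eventually_ne_at
  proof eventually_elim
    case (elim t)
    have "(t - t0) ^ m * (w i0 t - w j0 t) = (l i0 t - mean_root S l t) - (l j0 t - mean_root S l t)"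
      unfolding elim(1,2) by (simp add: algebra_simps)
    also have "\<dots> = (t - t0) ^ m * u t" using elim(3) by simp
    finally show ?case using elim(4) by simp
  qed
  then have "w i0 t0 - w j0 t0 = u t0"
    by (intro isCont_eq_at[of t0 "\<lambda>t. w i0 t - w j0 t" u]) (use wc i0 j0 u in auto)
  then have wne: "w i0 t0 \<noteq> w j0 t0" using u(2) by simp
  define W where "W = (\<lambda>t. - (\<Sum>i\<in>S. (w i t)\<^sup>2) / 2)"
  have "isCont W t0" unfolding W_def using wc by (intro continuous_intros) auto
  moreover have "W t0 \<noteq> 0"
  proof -
    have "(\<Sum>i\<in>S. (w i t0)\<^sup>2) \<noteq> 0"
    proof
      assume "(\<Sum>i\<in>S. (w i t0)\<^sup>2) = 0"
      then have "\<forall>i\<in>S. (w i t0)\<^sup>2 = 0" using fin by (subst (asm) sum_nonneg_eq_0_iff) auto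
      then show False using wne i0 j0 by simp
    qed
    then show ?thesis by (simp add: W_def)
  qed
  moreover have "\<forall>\<^sub>F t in nhds t0. acoeff (center (P t)) 2 = (t - t0) ^ (2 * m) * W t"
  proof -
    have "\<forall>\<^sub>F t in nhds t0. \<forall>i\<in>S. l i t - mean_root S l t = (t - t0) ^ m * w i t"
      using fin weq by (intro eventually_ball_finite) auto
    then show ?thesis using root_family_eq[OF rf]
    proof eventually_elim
      case (elim t)
      have "acoeff (center (P t)) 2 = - (\<Sum>i\<in>S. (l i t - mean_root S l t)\<^sup>2) / 2"
        unfolding elim(2) mean_root_def by (rule acoeff2_center_root_poly[OF fin two])
      also have "(\<Sum>i\<in>S. (l i t - mean_root S l t)\<^sup>2) = (\<Sum>i\<in>S. (t - t0) ^ (2 * m) * (w i t)\<^sup>2)"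
        by (rule sum.cong) (use elim(1) in \<open>auto simp: power_mult_distrib power_mult[symmetric] mult.commute\<close>)
      finally show ?case by (simp add: W_def sum_distrib_left)
    qed
  qed
  ultimately have "vanishing_order t0 (\<lambda>t. acoeff (center (P t)) 2) (enat (2 * m))"
    unfolding vanishing_order_def by auto
  then show ?thesis using wcont weq wne by blast
qed

lemma least_contact:
  assumes "finite S" "i1 \<in> S" "j1 \<in> S" "e i1 j1 \<noteq> (\<infinity>::enat)"
  obtains m i0 j0 where "i0 \<in> S" "j0 \<in> S" "e i0 j0 = enat m" "\<And>i j. i \<in> S \<Longrightarrow> j \<in> S \<Longrightarrow> enat m \<le> e i j"
proof -
  let ?X = "(\<lambda>(i, j). e i j) ` (S \<times> S)"
  have X: "finite ?X" "?X \<noteq> {}" using assms by auto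
  from Min_in[OF X] obtain i0 j0 where ij: "i0 \<in> S" "j0 \<in> S" "Min ?X = e i0 j0" by auto
  have le: "e i0 j0 \<le> e i j" if "i \<in> S" "j \<in> S" for i j
    unfolding ij(3)[symmetric] using X that by (intro Min_le) auto
  have "e i0 j0 \<noteq> \<infinity>" using le[OF assms(2,3)] assms(4) by (metis enat_ord_simps(5))
  then obtain m where "e i0 j0 = enat m" by auto
  with that ij le show ?thesis by metis
qed

section \<open>Evaluation of the recursion on a family of roots\<close>

text \<open>The invariant of the induction over the recursion. The family of roots is universally quantified,
  so that the formulas for \<open>G\<close> and \<open>G - g\<close> show at the same time that these values are unique. The
  weight \<open>s\<close> is arbitrary because the coefficients of rescaled curves and their factors carry one.\<close>

definition evaluates :: "real \<Rightarrow> (real \<Rightarrow> real poly) \<Rightarrow> nat \<Rightarrow> nat \<Rightarrow> bool" where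
  "evaluates t0 P G g \<longleftrightarrow> (\<forall>S l e. S \<noteq> {} \<longrightarrow> root_family t0 S l e P \<longrightarrow>
     g \<le> G \<and> G = max_order e S \<and> G - g = max_loss e S \<and>
     (\<forall>k s. G \<le> k \<longrightarrow> (\<forall>i. wCk t0 k s (\<lambda>t. coeff (P t) i)) \<longrightarrow>
        (\<forall>i\<in>S. wCk t0 (k - (G - g)) (s + (G - g)) (l i))))"

text \<open>Identical roots are equal to their mean, which is a multiple of the first coefficient.\<close>

lemma evaluates_coincident:
  assumes "\<And>S l e i j. root_family t0 S l e P \<Longrightarrow> S \<noteq> {} \<Longrightarrow> i \<in> S \<Longrightarrow> j \<in> S \<Longrightarrow> e i j = \<infinity>"
  shows "evaluates t0 P 0 0"
  unfolding evaluates_def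
proof (intro allI impI)
  fix S l e assume S: "S \<noteq> {}" and rf: "root_family t0 S l e P"
  note inf = assms[OF rf S]
  have "wCk t0 k s (l i)" if "i \<in> S" "\<forall>i. wCk t0 k s (\<lambda>t. coeff (P t) i)" for k s i
    using wCk_cong[OF all_contacts_infinite[OF rf S inf that(1)]] mean_root_wCk[OF rf S] that(2) by simp
  then show "0 \<le> (0::nat) \<and> 0 = max_order e S \<and> 0 - 0 = max_loss e S \<and>
     (\<forall>k s. 0 \<le> k \<longrightarrow> (\<forall>i. wCk t0 k s (\<lambda>t. coeff (P t) i)) \<longrightarrow>
        (\<forall>i\<in>S. wCk t0 (k - (0 - 0)) (s + (0 - 0)) (l i)))"
    using all_infinite_numbers[OF root_family_finite[OF rf] S inf] by simp
qed

lemma evaluates_linear: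
  assumes "hyperbolic_curve_near t0 1 P" shows "evaluates t0 P 0 0"
proof (rule evaluates_coincident)
  fix S l e i j assume rf: "root_family t0 S l e P" and ij: "i \<in> S" "j \<in> S"
  then obtain a where "S = {a}" using root_family_card[OF rf assms] by (metis One_nat_def card_1_singletonE)
  then show "e i j = \<infinity>" using root_family_refl[OF rf] ij by auto
qed

lemma evaluates_flat:
  assumes "hyperbolic_curve_near t0 n P" "n > 1" "mult_at t0 (\<lambda>t. acoeff (center (P t)) 2) = \<infinity>"
  shows "evaluates t0 P 0 0"
proof (rule evaluates_coincident, rule ccontr)
  fix S l e i j assume rf: "root_family t0 S l e P" and ij: "i \<in> S" "j \<in> S" "e i j \<noteq> \<infinity>"
  have two: "2 \<le> card S" using root_family_card[OF rf assms(1)] assms(2) by simp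
  obtain m i0 j0 where m: "i0 \<in> S" "j0 \<in> S" "e i0 j0 = enat m"
    "\<And>i j. i \<in> S \<Longrightarrow> j \<in> S \<Longrightarrow> enat m \<le> e i j"
    using least_contact[where e = e, OF root_family_finite[OF rf] ij(1) ij(2) ij(3)] by metis
  have "vanishing_order t0 (\<lambda>t. acoeff (center (P t)) 2) (enat (2 * m))"
    using second_coefficient_order[OF rf two m] by blast
  from mult_at_le[OF this] show False using assms(3) by simp
qed

lemma coeffs_Ck_near_imp: "coeffs_Ck_near (enat k) t0 P \<Longrightarrow> Ck_at t0 k (\<lambda>t. coeff (P t) i)"
  unfolding coeffs_Ck_near_def using Ck_on_imp_Ck_at[OF _ open_ball centre_in_ball[THEN iffD2]] by blast

lemma hyperbolic_curve_nearD:
  assumes "hyperbolic_curve_near t0 m P"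
  shows "\<forall>\<^sub>F t in nhds t0. hyperbolic (P t) \<and> degree (P t) = m \<and> lead_coeff (P t) = 1"
    "Ck_at t0 0 (\<lambda>t. coeff (P t) i)"
proof -
  have "\<forall>\<^sub>F t in nhds t0. hyperbolic (P t) \<and> degree (P t) = m"
    using assms unfolding hyperbolic_curve_near_def by simp
  then show "\<forall>\<^sub>F t in nhds t0. hyperbolic (P t) \<and> degree (P t) = m \<and> lead_coeff (P t) = 1"
    by eventually_elim (auto simp: hyperbolic_def)
  show "Ck_at t0 0 (\<lambda>t. coeff (P t) i)"
    using assms unfolding hyperbolic_curve_near_def by (intro coeffs_Ck_near_imp) (simp add: zero_enat_def)
qed

lemma poly_curve_nonzero:
  assumes "hyperbolic_curve_near t0 m A" "isCont x t0" "poly (A t0) (x t0) \<noteq> 0"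
  shows "\<forall>\<^sub>F t in nhds t0. poly (A t) (x t) \<noteq> 0"
proof -
  have eq: "\<forall>\<^sub>F t in nhds t0. poly (A t) (x t) = (\<Sum>i\<le>m. coeff (A t) i * x t ^ i)"
    using hyperbolic_curve_nearD(1)[OF assms(1)] by eventually_elim (simp add: poly_altdef)
  have "isCont (\<lambda>t. \<Sum>i\<le>m. coeff (A t) i * x t ^ i) t0"
    using hyperbolic_curve_nearD(2)[OF assms(1), THEN Ck_at_imp_isCont] assms(2) eventually_nhds_x_imp_x
    by (intro continuous_intros) blast+
  moreover have "(\<Sum>i\<le>m. coeff (A t0) i * x t0 ^ i) \<noteq> 0"
    using eventually_nhds_x_imp_x[OF eq] assms(3) by simp
  ultimately have "\<forall>\<^sub>F t in nhds t0. (\<Sum>i\<le>m. coeff (A t) i * x t ^ i) \<noteq> 0" by (rule isCont_nonzero_near)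
  with eq show ?thesis by eventually_elim simp
qed

lemma hyperbolic_has_root:
  assumes "hyperbolic p" "degree p \<ge> 1" shows "\<exists>x. poly p x = 0"
proof -
  obtain xs where xs: "length xs = degree p" "p = (\<Prod>x\<leftarrow>xs. [:- x, 1:])"
    using hyperbolic_splits[OF assms(1)] by blast
  then obtain y ys where "xs = y # ys" using assms(2) by (cases xs) auto
  then show ?thesis using xs(2) by (intro exI[of _ y]) simp
qed

text \<open>The roots of the factor \<open>A\<close> near \<open>t0\<close> are those that are roots of \<open>A\<close> at \<open>t0\<close>, by continuity.\<close>

lemma root_family_splits:
  assumes rf: "root_family t0 S l e P"
    and A: "hyperbolic_curve_near t0 m1 A" "m1 \<ge> 1" and B: "hyperbolic_curve_near t0 m2 B" "m2 \<ge> 1"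
    and eq: "\<forall>\<^sub>F t in nhds t0. P t = A t * B t"
    and no: "\<nexists>x. poly (A t0) x = 0 \<and> poly (B t0) x = 0"
  obtains S1 S2 where "S = S1 \<union> S2" "S1 \<inter> S2 = {}" "S1 \<noteq> {}" "S2 \<noteq> {}"
    "root_family t0 S1 l e A" "root_family t0 S2 l e B"
    "\<And>i j. i \<in> S1 \<Longrightarrow> j \<in> S2 \<Longrightarrow> e i j = 0 \<and> e j i = 0"
    "coprime_monic_near t0 (card S1) (card S2) A B"
proof -
  note fin = root_family_finite[OF rf]
  define S1 where "S1 = {i\<in>S. poly (A t0) (l i t0) = 0}"
  define S2 where "S2 = {i\<in>S. poly (A t0) (l i t0) \<noteq> 0}"
  have SS: "S = S1 \<union> S2" "S1 \<inter> S2 = {}" by (auto simp: S1_def S2_def)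
  have P0: "P t0 = root_poly S (\<lambda>i. l i t0)" "P t0 = A t0 * B t0"
    using root_family_eq[OF rf] eq eventually_nhds_x_imp_x by fastforce+
  have root: "\<exists>i\<in>S. l i t0 = x" if "poly (A t0) x * poly (B t0) x = 0" for x
    using that P0 poly_root_poly[OF fin, of "\<lambda>i. l i t0" x] by (metis poly_mult)
  have hA: "hyperbolic (A t0)" "degree (A t0) = m1" and hB: "hyperbolic (B t0)" "degree (B t0) = m2"
    using hyperbolic_curve_nearD(1)[OF A(1)] hyperbolic_curve_nearD(1)[OF B(1)] eventually_nhds_x_imp_x
    by fastforce+
  obtain x where x: "poly (A t0) x = 0" using hyperbolic_has_root[OF hA(1)] hA(2) A(2) by blast
  obtain y where y: "poly (B t0) y = 0" using hyperbolic_has_root[OF hB(1)] hB(2) B(2) by blast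
  have ne1: "S1 \<noteq> {}" using root[of x] x by (auto simp: S1_def)
  have ne2: "S2 \<noteq> {}" using root[of y] y no by (auto simp: S2_def)
  have B1: "poly (B t0) (l i t0) \<noteq> 0" if "i \<in> S1" for i using that no by (auto simp: S1_def)
  have fin12: "finite S1" "finite S2" using fin SS by auto
  have evA: "\<forall>\<^sub>F t in nhds t0. \<forall>i\<in>S2. poly (A t) (l i t) \<noteq> 0"
    using fin12 by (intro eventually_ball_finite ballI poly_curve_nonzero[OF A(1)] root_family_isCont[OF rf])
      (auto simp: S2_def)
  have evB: "\<forall>\<^sub>F t in nhds t0. \<forall>i\<in>S1. poly (B t) (l i t) \<noteq> 0"
    using fin12 B1 by (intro eventually_ball_finite ballI poly_curve_nonzero[OF B(1)] root_family_isCont[OF rf])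
      (auto simp: S1_def)
  have eqs: "\<forall>\<^sub>F t in nhds t0. A t = root_poly S1 (\<lambda>i. l i t) \<and> B t = root_poly S2 (\<lambda>i. l i t)
      \<and> coprime (A t) (B t) \<and> degree (A t) = card S1 \<and> degree (B t) = card S2
      \<and> lead_coeff (A t) = 1 \<and> lead_coeff (B t) = 1"
    using evA evB eq root_family_eq[OF rf] hyperbolic_curve_nearD(1)[OF A(1)] hyperbolic_curve_nearD(1)[OF B(1)]
  proof eventually_elim
    case (elim t)
    have prod: "A t * B t = root_poly S1 (\<lambda>i. l i t) * root_poly S2 (\<lambda>i. l i t)"
      unfolding elim(3)[symmetric] elim(4) SS(1) by (rule prod.union_disjoint) (use fin12 SS in auto)
    have a: "A t = root_poly S1 (\<lambda>i. l i t)"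
      by (rule monic_factor_eq_root_poly[OF prod]) (use elim in auto)
    have b: "B t = root_poly S2 (\<lambda>i. l i t)"
      by (rule monic_factor_eq_root_poly[where B = "A t" and T = S1])
         (use elim prod in \<open>auto simp: mult.commute\<close>)
    have "coprime (root_poly S1 (\<lambda>i. l i t)) (B t)" by (rule coprime_root_poly) (use elim(2) in auto)
    then have cop: "coprime (A t) (B t)" using a by simp
    have "degree (A t) = card S1" "degree (B t) = card S2"
      unfolding a b by (simp_all only: degree_root_poly[OF fin12(1)] degree_root_poly[OF fin12(2)])
    then show ?case using a b cop elim(5,6) by blast
  qed
  have rf1: "root_family t0 S1 l e A" by (rule root_family_mono[OF rf]) (use SS eqs in \<open>auto elim: eventually_mono\<close>)
  have rf2: "root_family t0 S2 l e B" by (rule root_family_mono[OF rf]) (use SS eqs in \<open>auto elim: eventually_mono\<close>)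
  have cross: "e i j = 0 \<and> e j i = 0" if ij: "i \<in> S1" "j \<in> S2" for i j
  proof -
    have "l i t0 \<noteq> l j t0" using ij by (auto simp: S1_def S2_def)
    moreover have "i \<in> S" "j \<in> S" using ij SS by auto
    ultimately show ?thesis
      using vanishing_order_nonzero[OF root_family_contact[OF rf, of i j]]
        vanishing_order_nonzero[OF root_family_contact[OF rf, of j i]] by simp
  qed
  have cm: "coprime_monic_near t0 (card S1) (card S2) A B"
    unfolding coprime_monic_near_def using eqs by eventually_elim blast
  from that[OF SS ne1 ne2 rf1 rf2 cross cm] show ?thesis by blast
qed

text \<open>Each factor inherits the class of the coefficients, and its roots lose at most the maximum of the
  two losses.\<close>

lemma evaluates_factor:
  assumes f: "factors_near t0 P [P1, P2]" and e1: "evaluates t0 P1 G1 g1" and e2: "evaluates t0 P2 G2 g2"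
  shows "evaluates t0 P (max G1 G2) (max G1 G2 - max (G1 - g1) (G2 - g2))"
  unfolding evaluates_def
proof (intro allI impI)
  fix S l e assume S: "S \<noteq> {}" and rf: "root_family t0 S l e P"
  obtain m1 m2 where A: "hyperbolic_curve_near t0 m1 P1" "m1 \<ge> 1" and B: "hyperbolic_curve_near t0 m2 P2" "m2 \<ge> 1"
    and eq: "\<forall>\<^sub>F t in nhds t0. P t = P1 t * P2 t"
    using f unfolding factors_near_def by auto
  have no: "\<nexists>x. poly (P1 t0) x = 0 \<and> poly (P2 t0) x = 0"
  proof -
    have "\<forall>j<Suc (Suc 0). \<forall>i<j. \<nexists>x. poly (([P1, P2] ! i) t0) x = 0 \<and> poly (([P1, P2] ! j) t0) x = 0"
      using f unfolding factors_near_def by simp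
    from this[THEN spec, of 1] show ?thesis by simp
  qed
  obtain S1 S2 where S12: "S = S1 \<union> S2" "S1 \<inter> S2 = {}" "S1 \<noteq> {}" "S2 \<noteq> {}"
    and rf1: "root_family t0 S1 l e P1" and rf2: "root_family t0 S2 l e P2"
    and cross: "\<And>i j. i \<in> S1 \<Longrightarrow> j \<in> S2 \<Longrightarrow> e i j = 0 \<and> e j i = 0"
    and cm: "coprime_monic_near t0 (card S1) (card S2) P1 P2"
    using root_family_splits[OF rf A B eq no] by metis
  note n = split_numbers[OF root_family_finite[OF rf] S12 cross]
  have 1: "g1 \<le> G1" "G1 = max_order e S1" "G1 - g1 = max_loss e S1"
    and r1: "\<And>k s i. G1 \<le> k \<Longrightarrow> (\<forall>i. wCk t0 k s (\<lambda>t. coeff (P1 t) i)) \<Longrightarrow> i \<in> S1 \<Longrightarrow>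
        wCk t0 (k - (G1 - g1)) (s + (G1 - g1)) (l i)"
    using e1 S12(3) rf1 unfolding evaluates_def by blast+
  have 2: "g2 \<le> G2" "G2 = max_order e S2" "G2 - g2 = max_loss e S2"
    and r2: "\<And>k s i. G2 \<le> k \<Longrightarrow> (\<forall>i. wCk t0 k s (\<lambda>t. coeff (P2 t) i)) \<Longrightarrow> i \<in> S2 \<Longrightarrow>
        wCk t0 (k - (G2 - g2)) (s + (G2 - g2)) (l i)"
    using e2 S12(4) rf2 unfolding evaluates_def by blast+
  define G where "G = max G1 G2"
  define D where "D = max (G1 - g1) (G2 - g2)"
  have "D \<le> G" unfolding D_def G_def by auto
  then have D: "D \<le> G" "G - (G - D) = D" by simp_all
  have reg: "wCk t0 (k - D) (s + D) (l i)"
    if k: "G \<le> k" and c: "\<forall>i. wCk t0 k s (\<lambda>t. coeff (P t) i)" and i: "i \<in> S" for k s i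
  proof -
    have c': "wCk t0 k s (\<lambda>t. coeff (P t) i)" for i using c by blast
    have eq': "\<forall>\<^sub>F t in nhds t0. P t = P2 t * P1 t" using eq by eventually_elim simp
    note cA = hyperbolic_curve_nearD(2)[OF A(1)] and cB = hyperbolic_curve_nearD(2)[OF B(1)]
    have cf: "wCk t0 k s (\<lambda>t. coeff (P1 t) i)" "wCk t0 k s (\<lambda>t. coeff (P2 t) i)" for i
      by (rule factor_wCk[OF cm eq cA cB c'],
          rule factor_wCk[OF coprime_monic_near_commute[OF cm] eq' cB cA c'])
    have tr: "wCk t0 (k - D) (s + D) f" if "wCk t0 (k - d) (s + d) f" "d \<le> D" for d f
    proof -
      have "k - d = (k - D) + (D - d)" "s + D = (s + d) + (D - d)" using that(2) D(1) k by auto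
      then show ?thesis using that(1) wCk_trade_add by metis
    qed
    show ?thesis
    proof (cases "i \<in> S1")
      case True
      have "wCk t0 (k - (G1 - g1)) (s + (G1 - g1)) (l i)"
        by (rule r1) (use k cf True in \<open>auto simp: G_def\<close>)
      then show ?thesis by (rule tr) (simp add: D_def)
    next
      case False
      have "wCk t0 (k - (G2 - g2)) (s + (G2 - g2)) (l i)"
        by (rule r2) (use k cf False i S12(1) in \<open>auto simp: G_def\<close>)
      then show ?thesis by (rule tr) (simp add: D_def)
    qed
  qed
  have "G = max_order e S" "D = max_loss e S"
    unfolding G_def D_def using n 1 2 by simp_all
  then show "max G1 G2 - max (G1 - g1) (G2 - g2) \<le> max G1 G2 \<and> max G1 G2 = max_order e S \<and>
     max G1 G2 - (max G1 G2 - max (G1 - g1) (G2 - g2)) = max_loss e S \<and>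
     (\<forall>k s. max G1 G2 \<le> k \<longrightarrow> (\<forall>i. wCk t0 k s (\<lambda>t. coeff (P t) i)) \<longrightarrow>
        (\<forall>i\<in>S. wCk t0 (k - (max G1 G2 - (max G1 G2 - max (G1 - g1) (G2 - g2))))
           (s + (max G1 G2 - (max G1 G2 - max (G1 - g1) (G2 - g2)))) (l i)))"
    unfolding G_def[symmetric] D_def[symmetric] D(2) using reg by simp
qed

lemma coeff_monic_poly:
  "coeff (monic_poly n a) j = (if j = n then 1 else if j < n then (- 1) ^ (n - j) * a (n - j) else 0)"
proof -
  have "coeff (\<Sum>k=1..n. monom ((- 1) ^ k * a k) (n - k)) j
      = (\<Sum>k=1..n. if n - k = j then (- 1) ^ k * a k else 0)"
    by (simp add: coeff_sum)
  also have "\<dots> = (\<Sum>k=1..n. if k = n - j \<and> j < n then (- 1) ^ k * a k else 0)"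
    by (rule sum.cong) auto
  also have "\<dots> = (if j < n then (- 1) ^ (n - j) * a (n - j) else 0)"
    by (cases "j < n") (auto simp: sum.delta)
  finally show ?thesis by (simp add: monic_poly_def)
qed

lemma (in germ_algebra) coeff_root_poly:
  assumes "finite S" "\<And>i. i \<in> S \<Longrightarrow> C (w i)"
  shows "C (\<lambda>t. coeff (root_poly S (\<lambda>i. w i t)) k)"
  using assms
proof (induction S arbitrary: k rule: finite_induct)
  case empty
  then show ?case using const by simp
next
  case (insert i S)
  have "C (\<lambda>t. coeff (root_poly S (\<lambda>i. w i t)) k)" for k using insert by blast
  note IH = this
  have 1: "C (\<lambda>t. w i t * coeff (root_poly S (\<lambda>i. w i t)) k)" by (intro mult IH insert.prems) simp
  show ?case
  proof (cases k)
    case 0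
    then show ?thesis unfolding coeff_root_poly_insert[OF insert.hyps]
      using diff[OF const[of 0] 1] by simp
  next
    case (Suc j)
    then show ?thesis unfolding coeff_root_poly_insert[OF insert.hyps]
      using diff[OF IH[of j] 1] by simp
  qed
qed

lemma isCont_eq_near:
  fixes f g :: "real \<Rightarrow> real"
  assumes "isCont f t0" "isCont g t0" "\<forall>\<^sub>F t in at t0. f t = g t"
  shows "\<forall>\<^sub>F t in nhds t0. f t = g t"
  using assms(3) isCont_eq_at[OF assms] by (rule eventually_nhdsI_at)

lemma acoeff_center_first:
  assumes "root_family t0 S l e P" "S \<noteq> {}"
  shows "\<forall>\<^sub>F t in nhds t0. acoeff (center (P t)) 1 = 0"
  using root_family_center[OF assms]
proof eventually_elim
  case (elim t)
  note fin = root_family_finite[OF assms(1)]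
  obtain k where k: "Suc k = card S" using fin assms(2) by (metis card_gt_0_iff gr0_implies_Suc)
  have "(\<Sum>i\<in>S. l i t - mean_root S l t) = 0"
    using assms(2) fin by (simp add: mean_root_def sum_subtractf)
  then have 1: "coeff (root_poly S (\<lambda>i. l i t - mean_root S l t)) k = 0"
    using root_poly_first_coeff[OF fin k, of "\<lambda>i. l i t - mean_root S l t"] by linarith
  have c: "center (P t) = root_poly S (\<lambda>i. l i t - mean_root S l t)" using elim by blast
  have "degree (center (P t)) = Suc k" unfolding c k by (rule degree_root_poly[OF fin])
  then show ?case using 1 unfolding acoeff_def c[symmetric] by simp
qed

text \<open>The exponent of the rescaling is the least contact order, because both are half the order of the
  second coefficient. The rescaled roots are continuous and thus are the roots of the rescaled
  polynomial also at \<open>t0\<close>, where division by \<open>(t - t0)^r\<close> is meaningless. Since they are not all equal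
  there, every root has a partner with contact order exactly \<open>r\<close>.\<close>

lemma rescaled_root_family:
  assumes rf: "root_family t0 S l e P" and two: "2 \<le> card S"
    and vo: "vanishing_order t0 (\<lambda>t. acoeff (center (P t)) 2) (enat (2 * r))"
    and bc: "\<And>k. k \<in> {1..card S} \<Longrightarrow> isCont (b k) t0"
    and beq: "\<And>k. k \<in> {1..card S} \<Longrightarrow>
        \<forall>\<^sub>F t in nhds t0. acoeff (center (P t)) k = (t - t0) ^ (k * r) * b k t"
  shows "\<exists>w. root_family t0 S w (\<lambda>i j. e i j - enat r) (\<lambda>t. monic_poly (card S) (\<lambda>k. b k t)) \<and>
     (\<forall>i\<in>S. \<forall>\<^sub>F t in nhds t0. l i t - mean_root S l t = (t - t0) ^ r * w i t) \<and>
     (\<forall>i\<in>S. \<forall>j\<in>S. enat r \<le> e i j) \<and> (\<forall>i\<in>S. \<exists>j\<in>S. e i j = enat r)"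
proof -
  note fin = root_family_finite[OF rf]
  have ne: "S \<noteq> {}" using two by auto
  have "\<exists>i\<in>S. \<exists>j\<in>S. e i j \<noteq> \<infinity>"
  proof (rule ccontr)
    assume "\<not> ?thesis"
    then have inf: "\<And>i j. i \<in> S \<Longrightarrow> j \<in> S \<Longrightarrow> e i j = \<infinity>" by blast
    have "\<forall>\<^sub>F t in nhds t0. \<forall>i\<in>S. l i t = mean_root S l t"
      using fin all_contacts_infinite[OF rf ne inf] by (intro eventually_ball_finite) auto
    then have "\<forall>\<^sub>F t in nhds t0. acoeff (center (P t)) 2 = 0"
      using root_family_eq[OF rf]
    proof eventually_elim
      case (elim t)
      have "acoeff (center (P t)) 2 = - (\<Sum>i\<in>S. (l i t - mean_root S l t)\<^sup>2) / 2"
        unfolding elim(2) mean_root_def by (rule acoeff2_center_root_poly[OF fin two])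
      also have "(\<Sum>i\<in>S. (l i t - mean_root S l t)\<^sup>2) = 0"
        by (rule sum.neutral) (use elim(1) in auto)
      finally show ?case by simp
    qed
    then have "vanishing_order t0 (\<lambda>t. acoeff (center (P t)) 2) \<infinity>"
      by (simp add: vanishing_order_def germ_zero_def)
    from vanishing_order_unique[OF vo this] show False by simp
  qed
  then obtain i1 j1 where ij1: "i1 \<in> S" "j1 \<in> S" "e i1 j1 \<noteq> \<infinity>" by blast
  obtain m i0 j0 where m: "i0 \<in> S" "j0 \<in> S" "e i0 j0 = enat m"
    "\<And>i j. i \<in> S \<Longrightarrow> j \<in> S \<Longrightarrow> enat m \<le> e i j"
    using least_contact[where e = e, OF fin ij1(1) ij1(2) ij1(3)] by metis
  obtain w where w: "\<And>i. i \<in> S \<Longrightarrow> Ck_at t0 0 (w i)"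
    "\<And>i. i \<in> S \<Longrightarrow> \<forall>\<^sub>F t in nhds t0. l i t - mean_root S l t = (t - t0) ^ m * w i t"
    "w i0 t0 \<noteq> w j0 t0" "vanishing_order t0 (\<lambda>t. acoeff (center (P t)) 2) (enat (2 * m))"
    using second_coefficient_order[OF rf two m] by blast
  have mr: "m = r" using vanishing_order_unique[OF vo w(4)] by simp
  have wc: "isCont (w i) t0" if "i \<in> S" for i
    using Ck_at_imp_isCont[OF w(1)[OF that]] eventually_nhds_x_imp_x by blast
  have contact: "vanishing_order t0 (\<lambda>t. w i t - w j t) (e i j - enat r)" if ij: "i \<in> S" "j \<in> S" for i j
  proof (rule vanishing_order_div_power[OF root_family_contact[OF rf ij]])
    show "enat r \<le> e i j" using m(4)[OF ij] mr by simp
    show "isCont (\<lambda>t. w i t - w j t) t0" using wc ij by auto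
    show "\<forall>\<^sub>F t in nhds t0. l i t - l j t = (t - t0) ^ r * (w i t - w j t)"
      using w(2)[OF ij(1)] w(2)[OF ij(2)]
    proof eventually_elim
      case (elim t)
      have "l i t - l j t = (l i t - mean_root S l t) - (l j t - mean_root S l t)" by simp
      also have "\<dots> = (t - t0) ^ r * (w i t - w j t)" unfolding elim mr by (simp add: algebra_simps)
      finally show ?case .
    qed
  qed
  have coeffs: "\<forall>\<^sub>F t in nhds t0. (- 1) ^ k * b k t = coeff (root_poly S (\<lambda>i. w i t)) (card S - k)"
    if k: "k \<in> {1..card S}" for k
  proof (rule isCont_eq_near)
    show "isCont (\<lambda>t. (- 1) ^ k * b k t) t0" using bc[OF k] by (auto intro!: continuous_intros)
    show "isCont (\<lambda>t. coeff (root_poly S (\<lambda>i. w i t)) (card S - k)) t0"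
      by (rule germ_algebra.coeff_root_poly[OF germ_algebra_isCont fin]) (rule wc)
    have wev: "\<forall>\<^sub>F t in nhds t0. \<forall>i\<in>S. l i t - mean_root S l t = (t - t0) ^ m * w i t"
      using fin w(2) by (intro eventually_ball_finite) auto
    show "\<forall>\<^sub>F t in at t0. (- 1) ^ k * b k t = coeff (root_poly S (\<lambda>i. w i t)) (card S - k)"
      using eventually_at_nhds[OF wev] eventually_at_nhds[OF beq[OF k]]
        eventually_at_nhds[OF root_family_center[OF rf ne]] eventually_ne_at
    proof eventually_elim
      case (elim t)
      have c: "center (P t) = root_poly S (\<lambda>i. (t - t0) ^ r * w i t)"
        using elim(3) elim(1) mr by (auto intro!: prod.cong)
      have "degree (center (P t)) = card S" unfolding c by (rule degree_root_poly[OF fin])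
      then have "acoeff (center (P t)) k = (- 1) ^ k * coeff (center (P t)) (card S - k)"
        by (simp only: acoeff_def)
      also have "coeff (center (P t)) (card S - k)
          = ((t - t0) ^ r) ^ (card S - (card S - k)) * coeff (root_poly S (\<lambda>i. w i t)) (card S - k)"
        unfolding c by (rule coeff_root_poly_scale[OF fin]) simp
      also have "card S - (card S - k) = k" using k by simp
      finally have "(t - t0) ^ (k * r) * b k t
          = (- 1) ^ k * ((t - t0) ^ (k * r) * coeff (root_poly S (\<lambda>i. w i t)) (card S - k))"
        unfolding elim(2) by (simp add: power_mult[symmetric] mult.commute)
      then have "b k t = (- 1) ^ k * coeff (root_poly S (\<lambda>i. w i t)) (card S - k)"
        using elim(4) by (simp add: mult.left_commute)
      then show ?case by (simp add: mult.assoc[symmetric] power_mult_distrib[symmetric])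
    qed
  qed
  have Q: "\<forall>\<^sub>F t in nhds t0. monic_poly (card S) (\<lambda>k. b k t) = root_poly S (\<lambda>i. w i t)"
  proof -
    have "\<forall>\<^sub>F t in nhds t0. \<forall>k\<in>{1..card S}. (- 1) ^ k * b k t = coeff (root_poly S (\<lambda>i. w i t)) (card S - k)"
      using coeffs by (intro eventually_ball_finite) auto
    then show ?thesis
    proof eventually_elim
      case (elim t)
      show ?case
      proof (rule poly_eqI)
        fix j
        show "coeff (monic_poly (card S) (\<lambda>k. b k t)) j = coeff (root_poly S (\<lambda>i. w i t)) j"
        proof (cases "j < card S")
          case True
          then show ?thesis using elim[THEN bspec, of "card S - j"] by (simp add: coeff_monic_poly)
        next
          case False
          show ?thesis
          proof (cases "j = card S")
            case True
            then show ?thesis using coeff_root_poly_card[OF fin] by (simp add: coeff_monic_poly)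
          next
            case False2: False
            have "coeff (root_poly S (\<lambda>i. w i t)) j = 0"
              by (rule coeff_eq_0) (use False False2 degree_root_poly[OF fin, of "\<lambda>i. w i t"] in linarith)
            then show ?thesis using False False2 by (simp add: coeff_monic_poly)
          qed
        qed
      qed
    qed
  qed
  have rfQ: "root_family t0 S w (\<lambda>i j. e i j - enat r) (\<lambda>t. monic_poly (card S) (\<lambda>k. b k t))"
    unfolding root_family_def using fin w(1) contact Q by blast
  have least: "\<exists>j\<in>S. e i j = enat r" if i: "i \<in> S" for i
  proof -
    obtain j where j: "j \<in> S" "w i t0 \<noteq> w j t0" using w(3) m(1,2) by metis
    then have "e i j - enat r = 0" using vanishing_order_nonzero[OF contact[OF i j(1)]] by simp
    then have "e i j = enat r"
      using m(4)[OF i j(1)] mr by (cases "e i j") (auto simp: zero_enat_def)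
    then show ?thesis using j by blast
  qed
  show ?thesis
  proof (intro exI[of _ w] conjI ballI rfQ least)
    show "\<forall>\<^sub>F t in nhds t0. l i t - mean_root S l t = (t - t0) ^ r * w i t" if "i \<in> S" for i
      using w(2)[OF that] unfolding mr .
    show "enat r \<le> e i j" if "i \<in> S" "j \<in> S" for i j
      using m(4)[OF that] unfolding mr .
  qed
qed

text \<open>The coefficient \<open>b\<^sub>j\<close> arises by \<open>j r\<close> divisions by \<open>t - t0\<close>, and \<open>(n - j) r\<close> further units are traded in
  to reach the common class \<open>(k - n r, s + n r)\<close>. The factor \<open>(t - t0)^r\<close> of the roots returns \<open>r\<close> units.\<close>

lemma evaluates_rescale:
  assumes hc: "hyperbolic_curve_near t0 n P" and n: "n > 1"
    and rs: "rescaled_near t0 n r P Q" and eQ: "evaluates t0 Q G g"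
  shows "evaluates t0 P (G + n * r) (g + r)"
  unfolding evaluates_def
proof (intro allI impI)
  fix S l e assume S: "S \<noteq> {}" and rf: "root_family t0 S l e P"
  note fin = root_family_finite[OF rf]
  have card: "card S = n" by (rule root_family_card[OF rf hc])
  obtain b where b: "\<forall>k\<in>{2..n}. \<exists>\<epsilon>>0. continuous_on (ball t0 \<epsilon>) (b k) \<and>
       (\<forall>t\<in>ball t0 \<epsilon>. acoeff (center (P t)) k = (t - t0) ^ (k * r) * b k t)"
    "b 2 t0 \<noteq> 0" and Q: "Q = (\<lambda>t. monic_poly n (\<lambda>k. if k = 1 then 0 else b k t))"
    using rs unfolding rescaled_near_def by blast
  have b2: "isCont (b k) t0 \<and> (\<forall>\<^sub>F t in nhds t0. acoeff (center (P t)) k = (t - t0) ^ (k * r) * b k t)"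
    if k: "k \<in> {2..n}" for k
  proof -
    obtain \<epsilon> where \<epsilon>: "\<epsilon> > 0" "continuous_on (ball t0 \<epsilon>) (b k)"
       "\<And>t. t \<in> ball t0 \<epsilon> \<Longrightarrow> acoeff (center (P t)) k = (t - t0) ^ (k * r) * b k t"
      using b(1) k by blast
    have "\<forall>\<^sub>F t in nhds t0. t \<in> ball t0 \<epsilon>" using \<epsilon>(1) by (intro eventually_nhds_in_open) auto
    then have "\<forall>\<^sub>F t in nhds t0. acoeff (center (P t)) k = (t - t0) ^ (k * r) * b k t"
      by eventually_elim (rule \<epsilon>(3))
    moreover have "isCont (b k) t0"
      using \<epsilon>(1,2) continuous_on_eq_continuous_at[OF open_ball] centre_in_ball by blast
    ultimately show ?thesis by blast
  qed
  define b' where "b' = (\<lambda>k. if k = 1 then (\<lambda>_. 0) else b k)"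
  have Q': "Q = (\<lambda>t. monic_poly (card S) (\<lambda>k. b' k t))"
    unfolding Q card b'_def by (intro ext arg_cong[of _ _ "monic_poly n"]) auto
  have b': "isCont (b' k) t0" "\<forall>\<^sub>F t in nhds t0. acoeff (center (P t)) k = (t - t0) ^ (k * r) * b' k t"
    if k: "k \<in> {1..card S}" for k
  proof -
    have "isCont (b' k) t0 \<and> (\<forall>\<^sub>F t in nhds t0. acoeff (center (P t)) k = (t - t0) ^ (k * r) * b' k t)"
    proof (cases "k = 1")
      case True
      have "\<forall>\<^sub>F t in nhds t0. acoeff (center (P t)) 1 = (t - t0) ^ (1 * r) * 0"
        using acoeff_center_first[OF rf S] by eventually_elim simp
      then show ?thesis unfolding b'_def True by simp
    next
      case False
      then have "k \<in> {2..n}" using k card by auto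
      from b2[OF this] show ?thesis using False by (simp add: b'_def)
    qed
    then show "isCont (b' k) t0" "\<forall>\<^sub>F t in nhds t0. acoeff (center (P t)) k = (t - t0) ^ (k * r) * b' k t"
      by blast+
  qed
  have two: "2 \<in> {2..n}" using n by simp
  have vo: "vanishing_order t0 (\<lambda>t. acoeff (center (P t)) 2) (enat (2 * r))"
    unfolding vanishing_order_def using b2[OF two] b(2) by auto
  have card2: "2 \<le> card S" using n card by simp
  have "\<exists>w. root_family t0 S w (\<lambda>i j. e i j - enat r) Q \<and>
     (\<forall>i\<in>S. \<forall>\<^sub>F t in nhds t0. l i t - mean_root S l t = (t - t0) ^ r * w i t) \<and>
     (\<forall>i\<in>S. \<forall>j\<in>S. enat r \<le> e i j) \<and> (\<forall>i\<in>S. \<exists>j\<in>S. e i j = enat r)"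
    unfolding Q'
  proof (rule rescaled_root_family[OF rf card2 vo])
    show "isCont (b' k) t0" if "k \<in> {1..card S}" for k using that by (rule b'(1))
    show "\<forall>\<^sub>F t in nhds t0. acoeff (center (P t)) k = (t - t0) ^ (k * r) * b' k t"
      if "k \<in> {1..card S}" for k using that by (rule b'(2))
  qed
  then obtain w where rfQ: "root_family t0 S w (\<lambda>i j. e i j - enat r) Q"
    and w: "\<forall>i\<in>S. \<forall>\<^sub>F t in nhds t0. l i t - mean_root S l t = (t - t0) ^ r * w i t"
    and le: "\<forall>i\<in>S. \<forall>j\<in>S. enat r \<le> e i j" and ex: "\<forall>i\<in>S. \<exists>j\<in>S. e i j = enat r"
    by (elim exE conjE)
  define D where "D = G - g"
  have q: "g \<le> G" "G = max_order (\<lambda>i j. e i j - enat r) S" "D = max_loss (\<lambda>i j. e i j - enat r) S"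
    and reg: "\<And>k s i. G \<le> k \<Longrightarrow> (\<forall>i. wCk t0 k s (\<lambda>t. coeff (Q t) i)) \<Longrightarrow> i \<in> S \<Longrightarrow>
        wCk t0 (k - D) (s + D) (w i)"
    using eQ[unfolded evaluates_def, THEN spec, of S, THEN spec, of w, THEN spec, THEN mp, OF S, THEN mp, OF rfQ]
    unfolding D_def by blast+
  have le': "\<And>i j. i \<in> S \<Longrightarrow> j \<in> S \<Longrightarrow> enat r \<le> e i j"
    and ex': "\<And>i. i \<in> S \<Longrightarrow> \<exists>j\<in>S. e i j = enat r" using le ex by blast+
  have c: "max_loss e S = D + (n - 1) * r" "max_order e S = G + n * r"
    using rescale_numbers[where e = e, OF fin S] le' ex' unfolding q(2,3) card by blast+
  have nr: "n * r = (n - 1) * r + r" using n by (cases n) auto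
  define D' where "D' = D + (n - 1) * r"
  have DG: "D \<le> G" by (simp add: D_def)
  have D': "G + n * r - (g + r) = D'" using q(1) nr by (simp add: D'_def D_def)
  have main: "wCk t0 (k - D') (s + D') (l i)"
    if k: "G + n * r \<le> k" and c: "\<forall>i. wCk t0 k s (\<lambda>t. coeff (P t) i)" and i: "i \<in> S" for k s i
  proof -
    define k' where "k' = k - n * r"
    have k': "k = k' + n * r" "G \<le> k'" using k by (auto simp: k'_def)
    have c': "\<And>i. wCk t0 k s (\<lambda>t. coeff (P t) i)" using c by blast
    have bw: "wCk t0 k' (s + n * r) (b' j)" if j: "j \<in> {1..card S}" for j
    proof -
      have "n * r = (n - j) * r + j * r" using j card by (simp add: add_mult_distrib[symmetric])
      note jr = this
      have "wCk t0 ((k' + (n - j) * r) + j * r) s (\<lambda>t. acoeff (center (P t)) j)"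
      proof -
        have "\<forall>\<^sub>F t in nhds t0. acoeff (center (P t)) j = (- 1) ^ j * coeff (center (P t)) (n - j)"
          using root_family_center[OF rf S]
        proof eventually_elim
          case (elim t)
          then have "degree (center (P t)) = n" using degree_root_poly[OF fin] card by metis
          then show ?case by (simp only: acoeff_def)
        qed
        from wCk_cong[OF this, of k s]
        have "wCk t0 k s (\<lambda>t. acoeff (center (P t)) j)"
          using wCk_mult[OF wCk_const center_wCk[OF rf S c']] by blast
        moreover have "(k' + (n - j) * r) + j * r = k" using k'(1) jr by simp
        ultimately show ?thesis by simp
      qed
      from wCk_div_power[OF this b'(2)[OF j] b'(1)[OF j]]
      have "wCk t0 (k' + (n - j) * r) (s + j * r) (b' j)" .
      from wCk_trade_add[OF this] have "wCk t0 k' (s + j * r + (n - j) * r) (b' j)" .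
      moreover have "s + j * r + (n - j) * r = s + n * r" using jr by simp
      ultimately show ?thesis by simp
    qed
    have "wCk t0 k' (s + n * r) (\<lambda>t. coeff (Q t) j)" for j
    proof (cases "j < n")
      case True
      then have "n - j \<in> {1..card S}" using card by auto
      from wCk_mult[OF wCk_const bw[OF this]] show ?thesis
        using True unfolding Q' coeff_monic_poly card by simp
    next
      case False
      then show ?thesis unfolding Q' coeff_monic_poly card
        by (cases "j = n") (simp_all add: wCk_const)
    qed
    then have "\<forall>j. wCk t0 k' (s + n * r) (\<lambda>t. coeff (Q t) j)" by blast
    from reg[OF k'(2) this i] have "wCk t0 (k' - D) (s + n * r + D) (w i)" .
    moreover have "s + n * r + D = (s + D + (n - 1) * r) + r" using nr by linarith
    ultimately have wi: "wCk t0 (k' - D) ((s + D + (n - 1) * r) + r) (w i)" by simp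
    have kk: "k' - D + r = k - D'" "s + D + (n - 1) * r = s + D'" "k - D' + D' = k"
      using k'(1,2) DG nr by (auto simp: D'_def)
    from wCk_mult_power[OF wi] have "wCk t0 (k - D') (s + D') (\<lambda>t. (t - t0) ^ r * w i t)"
      unfolding kk .
    moreover have "wCk t0 (k - D') (s + D') (mean_root S l)"
      by (rule wCk_trade_add) (unfold kk(3), rule mean_root_wCk[OF rf S c'])
    ultimately have sum: "wCk t0 (k - D') (s + D') (\<lambda>t. mean_root S l t + (t - t0) ^ r * w i t)"
      by (intro wCk_add)
    have "\<forall>\<^sub>F t in nhds t0. l i t = mean_root S l t + (t - t0) ^ r * w i t"
      using bspec[OF w i] by eventually_elim linarith
    from wCk_cong[OF this] sum show ?thesis by blast
  qed
  have a: "g + r \<le> G + n * r" using q(1) nr by linarith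
  show "g + r \<le> G + n * r \<and> G + n * r = max_order e S \<and> G + n * r - (g + r) = max_loss e S \<and>
     (\<forall>k s. G + n * r \<le> k \<longrightarrow> (\<forall>i. wCk t0 k s (\<lambda>t. coeff (P t) i)) \<longrightarrow>
        (\<forall>i\<in>S. wCk t0 (k - (G + n * r - (g + r))) (s + (G + n * r - (g + r))) (l i)))"
    unfolding D' c D'_def[symmetric]
  proof (intro conjI allI impI ballI a refl)
    fix k s i assume "G + n * r \<le> k" "\<forall>i. wCk t0 k s (\<lambda>t. coeff (P t) i)" "i \<in> S"
    then show "wCk t0 (k - D') (s + D') (l i)" by (rule main)
  qed
qed

lemma evaluatesD:
  assumes "evaluates t0 P G g" "S \<noteq> {}" "root_family t0 S l e P"
  shows "g \<le> G" "G = max_order e S" "G - g = max_loss e S"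
    "\<lbrakk>G \<le> k; \<forall>i. wCk t0 k s (\<lambda>t. coeff (P t) i); i \<in> S\<rbrakk> \<Longrightarrow> wCk t0 (k - (G - g)) (s + (G - g)) (l i)"
proof -
  note E = assms(1)[unfolded evaluates_def, THEN spec, of S, THEN spec, of l, THEN spec, of e,
      THEN mp, OF assms(2), THEN mp, OF assms(3)]
  show "g \<le> G" by (rule E[THEN conjunct1])
  show "G = max_order e S" by (rule E[THEN conjunct2, THEN conjunct1])
  show "G - g = max_loss e S" by (rule E[THEN conjunct2, THEN conjunct2, THEN conjunct1])
  show "\<lbrakk>G \<le> k; \<forall>i. wCk t0 k s (\<lambda>t. coeff (P t) i); i \<in> S\<rbrakk> \<Longrightarrow> wCk t0 (k - (G - g)) (s + (G - g)) (l i)"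
    using E[THEN conjunct2, THEN conjunct2, THEN conjunct2, THEN spec, of k, THEN spec, of s] by blast
qed

lemma split_orders_evaluates: "split_orders t0 P G g \<Longrightarrow> evaluates t0 P G g"
proof (induction rule: split_orders.induct)
  case (split_orders_factor n P P1 P2 G1 g1 G2 g2)
  from split_orders_factor.hyps(3) split_orders_factor.IH show ?case by (rule evaluates_factor)
next
  case (split_orders_rescale n P r Q G g)
  from split_orders_rescale.hyps(1,2,4) split_orders_rescale.IH show ?case by (rule evaluates_rescale)
next
  case (split_orders_flat n P)
  from split_orders_flat(1,2,4) show ?case by (rule evaluates_flat)
next
  case (split_orders_linear P)
  from split_orders_linear show ?case by (rule evaluates_linear)
qed

text \<open>Uniqueness of the values of the recursion turns the definite descriptions into the contact numbers.\<close>

lemma split_orders_values: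
  assumes "split_orders t0 P G g" "root_family t0 S l e P" "S \<noteq> {}"
  shows "Gamma_at t0 P = max_order e S" "Gamma_at t0 P - gamma_at t0 P = max_loss e S"
    "max_loss e S \<le> max_order e S"
proof -
  have *: "G' = max_order e S \<and> g' \<le> G' \<and> G' - g' = max_loss e S" if "split_orders t0 P G' g'" for G' g'
    using evaluatesD(1-3)[OF split_orders_evaluates[OF that] assms(3,2)] by (intro conjI)
  have G: "G = max_order e S" and g: "g \<le> G" "G - g = max_loss e S" using *[OF assms(1)] by auto
  have "Gamma_at t0 P = G"
    unfolding Gamma_at_def
  proof (rule the_equality)
    fix G' assume "\<exists>g. split_orders t0 P G' g"
    then obtain g' where "split_orders t0 P G' g'" by blast
    from *[OF this] show "G' = G" using G by simp
  qed (use assms(1) in blast)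
  moreover have "gamma_at t0 P = g"
    unfolding gamma_at_def
  proof (rule the_equality)
    fix g' assume "\<exists>G. split_orders t0 P G g'"
    then obtain G' where "split_orders t0 P G' g'" by blast
    from *[OF this] show "g' = g" using G g by linarith
  qed (use assms(1) in blast)
  ultimately show "Gamma_at t0 P = max_order e S" "Gamma_at t0 P - gamma_at t0 P = max_loss e S"
    "max_loss e S \<le> max_order e S" using G g by auto
qed

text \<open>The coefficients are unweighted here, and the weight of the roots is forgotten.\<close>

lemma root_family_regular:
  assumes "split_orders t0 P G g" "root_family t0 S l e P" "S \<noteq> {}"
    and "Gamma_at t0 P \<le> k" "\<And>i. Ck_at t0 k (\<lambda>t. coeff (P t) i)" "i \<in> S"
  shows "Ck_at t0 (k - (Gamma_at t0 P - gamma_at t0 P)) (l i)"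
proof -
  note v = split_orders_values[OF assms(1-3)]
  note E = evaluatesD[OF split_orders_evaluates[OF assms(1)] assms(3,2)]
  have c: "\<forall>i. wCk t0 k 0 (\<lambda>t. coeff (P t) i)" using assms(5) by simp
  have "G \<le> k" using assms(4) v(1) E(2) by linarith
  from E(4)[OF this c assms(6)] have "Ck_at t0 (k - (G - g)) (l i)" by (rule wCk_imp_Ck_at)
  then show ?thesis unfolding v(2) E(3) .
qed

section \<open>Root families from splitting trees\<close>

text \<open>Lists are convenient for concatenating the roots of several factors; the contact condition then
  concerns the set of functions only.\<close>

definition root_germs :: "real \<Rightarrow> (real \<Rightarrow> real) list \<Rightarrow> (real \<Rightarrow> real poly) \<Rightarrow> bool" where
  "root_germs t0 L P \<longleftrightarrow> (\<forall>f\<in>set L. Ck_at t0 0 f) \<and>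
     (\<forall>f\<in>set L. \<forall>g\<in>set L. \<exists>e. vanishing_order t0 (\<lambda>t. f t - g t) e) \<and>
     (\<forall>\<^sub>F t in nhds t0. P t = (\<Prod>f\<leftarrow>L. [:- f t, 1:]))"

lemma prod_list_eq_root_poly:
  "(\<Prod>f\<leftarrow>L. [:- f t, 1:]) = root_poly {..<length L} (\<lambda>i. (L ! i) (t :: real))"
  by (simp add: prod.list_conv_set_nth atLeast0LessThan)

lemma root_germs_imp_root_family:
  assumes "root_germs t0 L P"
  shows "\<exists>e. root_family t0 {..<length L} (\<lambda>i. L ! i) e P"
proof -
  have "\<exists>e. vanishing_order t0 (\<lambda>t. (L ! i) t - (L ! j) t) e" if "i < length L" "j < length L" for i j
    using assms that unfolding root_germs_def by simp
  then obtain e where e: "\<And>i j. i < length L \<Longrightarrow> j < length L \<Longrightarrow> vanishing_order t0 (\<lambda>t. (L ! i) t - (L ! j) t) (e i j)"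
    by metis
  have "\<forall>\<^sub>F t in nhds t0. P t = root_poly {..<length L} (\<lambda>i. (L ! i) t)"
    using assms unfolding root_germs_def prod_list_eq_root_poly by blast
  moreover have "\<forall>i<length L. Ck_at t0 0 (L ! i)" using assms unfolding root_germs_def by auto
  ultimately have "root_family t0 {..<length L} (\<lambda>i. L ! i) e P"
    unfolding root_family_def using e by blast
  then show ?thesis by blast
qed

lemma root_germs_linear:
  assumes "hyperbolic_curve_near t0 1 P" shows "\<exists>L. root_germs t0 L P"
proof (intro exI)
  show "root_germs t0 [\<lambda>t. - coeff (P t) 0] P"
    unfolding root_germs_def
  proof (intro conjI ballI)
    fix f assume "f \<in> set [\<lambda>t. - coeff (P t) 0]"
    then have f: "f = (\<lambda>t. - coeff (P t) 0)" by simp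
    have "\<forall>\<^sub>F t in nhds t0. isCont (\<lambda>t. coeff (P t) 0) t"
      using hyperbolic_curve_nearD(2)[OF assms] by simp
    then show "Ck_at t0 0 f" unfolding f Ck_at.simps by eventually_elim (intro continuous_intros)
    fix g assume "g \<in> set [\<lambda>t. - coeff (P t) 0]"
    then show "\<exists>e. vanishing_order t0 (\<lambda>t. f t - g t) e"
      unfolding f using vanishing_order_zero by auto
  next
    show "\<forall>\<^sub>F t in nhds t0. P t = (\<Prod>f\<leftarrow>[\<lambda>t. - coeff (P t) 0]. [:- f t, 1:])"
      using hyperbolic_curve_nearD(1)[OF assms]
    proof eventually_elim
      case (elim t)
      then have "coeff (P t) 1 = 1" by auto
      then have "P t = [:coeff (P t) 0, 1:]"
        using elim by (intro poly_eqI) (auto simp: coeff_pCons coeff_eq_0 split: nat.split)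
      then show ?case by simp
    qed
  qed
qed

lemma prod_list_concat_map:
  "(\<Prod>x\<leftarrow>concat (map h xs). f x) = (\<Prod>y\<leftarrow>xs. \<Prod>x\<leftarrow>h y. (f x :: 'a::comm_monoid_mult))"
  by (induction xs) simp_all

lemma root_germs_root:
  assumes "root_germs t0 L P" "f \<in> set L" shows "poly (P t0) (f t0) = 0" "isCont f t0"
proof -
  have "P t0 = (\<Prod>f\<leftarrow>L. [:- f t0, 1:])"
    using assms(1) eventually_nhds_x_imp_x unfolding root_germs_def by blast
  moreover have "poly (\<Prod>f\<leftarrow>L. [:- f t0, 1:]) (f t0) = 0" using assms(2) by (induction L) auto
  ultimately show "poly (P t0) (f t0) = 0" by simp
  have "Ck_at t0 0 f" using assms unfolding root_germs_def by blast
  from Ck_at_imp_isCont[OF this] show "isCont f t0" by (rule eventually_nhds_x_imp_x)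
qed

text \<open>Roots of different factors differ at \<open>t0\<close> and hence have contact order \<open>0\<close>.\<close>

lemma root_germs_factor:
  assumes f: "factors_near t0 P Ps" and ex: "\<And>Q. Q \<in> set Ps \<Longrightarrow> \<exists>L. root_germs t0 L Q"
  shows "\<exists>L. root_germs t0 L P"
proof -
  obtain h where h: "\<And>Q. Q \<in> set Ps \<Longrightarrow> root_germs t0 (h Q) Q" using ex by metis
  have no: "\<nexists>x. poly (Q t0) x = 0 \<and> poly (R t0) x = 0" if QR: "Q \<in> set Ps" "R \<in> set Ps" "Q \<noteq> R" for Q R
  proof -
    obtain i j where ij: "i < length Ps" "j < length Ps" "Ps ! i = Q" "Ps ! j = R"
      using QR by (metis in_set_conv_nth)
    have *: "\<forall>j<length Ps. \<forall>i<j. \<nexists>x. poly ((Ps ! i) t0) x = 0 \<and> poly ((Ps ! j) t0) x = 0"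
      using f unfolding factors_near_def by blast
    have "i \<noteq> j" using ij QR(3) by blast
    then consider "i < j" | "j < i" by linarith
    then show ?thesis
    proof cases
      case 1
      then show ?thesis using *[THEN spec, of j, THEN mp, OF ij(2), THEN spec, of i] ij by blast
    next
      case 2
      then show ?thesis using *[THEN spec, of i, THEN mp, OF ij(1), THEN spec, of j] ij by blast
    qed
  qed
  have "root_germs t0 (concat (map h Ps)) P"
    unfolding root_germs_def
  proof (intro conjI ballI)
    fix f assume "f \<in> set (concat (map h Ps))"
    then obtain Q where Q: "Q \<in> set Ps" "f \<in> set (h Q)" by auto
    then show "Ck_at t0 0 f" using h[OF Q(1)] unfolding root_germs_def by blast
    fix g assume "g \<in> set (concat (map h Ps))"
    then obtain R where R: "R \<in> set Ps" "g \<in> set (h R)" by auto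
    show "\<exists>e. vanishing_order t0 (\<lambda>t. f t - g t) e"
    proof (cases "Q = R")
      case True
      then show ?thesis using h[OF Q(1)] Q(2) R(2) unfolding root_germs_def by blast
    next
      case False
      have "f t0 \<noteq> g t0"
        using no[OF Q(1) R(1) False] root_germs_root(1)[OF h[OF Q(1)] Q(2)]
          root_germs_root(1)[OF h[OF R(1)] R(2)] by metis
      moreover have "isCont (\<lambda>t. f t - g t) t0"
        using root_germs_root(2)[OF h[OF Q(1)] Q(2)] root_germs_root(2)[OF h[OF R(1)] R(2)]
        by (intro continuous_intros)
      ultimately have "vanishing_order t0 (\<lambda>t. f t - g t) 0" by (intro vanishing_order_nonzeroI) auto
      then show ?thesis by blast
    qed
  next
    have "\<forall>\<^sub>F t in nhds t0. \<forall>Q\<in>set Ps. Q t = (\<Prod>f\<leftarrow>h Q. [:- f t, 1:])"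
      using h unfolding root_germs_def by (intro eventually_ball_finite) auto
    moreover have "\<forall>\<^sub>F t in nhds t0. P t = (\<Prod>Q\<leftarrow>Ps. Q t)" using f unfolding factors_near_def by blast
    ultimately show "\<forall>\<^sub>F t in nhds t0. P t = (\<Prod>f\<leftarrow>concat (map h Ps). [:- f t, 1:])"
    proof eventually_elim
      case (elim t)
      have "map (\<lambda>Q. Q t) Ps = map (\<lambda>Q. \<Prod>f\<leftarrow>h Q. [:- f t, 1:]) Ps"
        by (rule map_cong) (use elim(1) in auto)
      then show ?case unfolding elim(2) prod_list_concat_map by (rule arg_cong)
    qed
  qed
  then show ?thesis by blast
qed

definition center_curve :: "nat \<Rightarrow> (real \<Rightarrow> real poly) \<Rightarrow> real \<Rightarrow> real" where
  "center_curve n P t = - coeff (P t) (n - 1) / real n"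

text \<open>At a single parameter the roots may be enumerated arbitrarily; the enumeration need not depend
  continuously on the parameter.\<close>

lemma center_hyperbolic:
  assumes "hyperbolic_curve_near t0 n P" "n \<ge> 1"
  shows "\<forall>\<^sub>F t in nhds t0. \<exists>x. P t = root_poly {..<n} x \<and>
      center (P t) = root_poly {..<n} (\<lambda>i. x i - center_curve n P t) \<and>
      (\<Sum>i<n. x i - center_curve n P t) = 0 \<and>
      (n \<ge> 2 \<longrightarrow> acoeff (center (P t)) 2 = - (\<Sum>i<n. (x i - center_curve n P t)\<^sup>2) / 2)"
  using hyperbolic_curve_nearD(1)[OF assms(1)]
proof eventually_elim
  case (elim t)
  then obtain xs where xs: "length xs = n" "P t = (\<Prod>x\<leftarrow>xs. [:- x, 1:])"
    using hyperbolic_splits[of "P t"] by auto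
  define x where "x = (\<lambda>i. xs ! i)"
  have Pt: "P t = root_poly {..<n} x"
    unfolding xs(2) x_def xs(1)[symmetric] by (simp add: prod.list_conv_set_nth atLeast0LessThan)
  have "0 \<in> {..<n}" using assms(2) by simp
  then have ne: "{..<n} \<noteq> {}" by blast
  have c: "center_curve n P t = (\<Sum>i<n. x i) / real n"
    using root_poly_first_coeff[of "{..<n}" "n - 1" x] assms(2)
    unfolding center_curve_def Pt by simp
  have "center (P t) = root_poly {..<n} (\<lambda>i. x i - center_curve n P t)"
    using center_root_poly(2)[OF finite_lessThan ne, of x] unfolding c Pt card_lessThan .
  moreover have "(\<Sum>i<n. x i - center_curve n P t) = 0"
    using assms(2) by (simp add: sum_subtractf c)
  moreover have "acoeff (center (P t)) 2 = - (\<Sum>i<n. (x i - center_curve n P t)\<^sup>2) / 2" if "n \<ge> 2"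
    using acoeff2_center_root_poly[OF finite_lessThan, of n x] that unfolding c Pt card_lessThan by blast
  ultimately show ?case using Pt by blast
qed

lemma center_curve_cont:
  assumes "hyperbolic_curve_near t0 n P" "n \<ge> 1"
  shows "Ck_at t0 0 (center_curve n P)"
proof -
  have "\<forall>\<^sub>F t in nhds t0. isCont (\<lambda>t. coeff (P t) (n - 1)) t"
    using hyperbolic_curve_nearD(2)[OF assms(1)] by simp
  then show ?thesis unfolding Ck_at.simps center_curve_def
    by eventually_elim (use assms(2) in \<open>auto intro!: continuous_intros\<close>)
qed

text \<open>The sum of the squares of the centered roots vanishes.\<close>

lemma root_germs_coincide:
  assumes h: "hyperbolic_curve_near t0 n P" "n > 1"
    and z: "germ_zero t0 (\<lambda>t. acoeff (center (P t)) 2)"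
  shows "\<exists>L. root_germs t0 L P"
proof (intro exI)
  let ?c = "center_curve n P"
  have n: "n \<ge> 1" "n \<ge> 2" using h(2) by auto
  show "root_germs t0 (replicate n ?c) P"
    unfolding root_germs_def
  proof (intro conjI ballI)
    fix f assume "f \<in> set (replicate n ?c)"
    then have f: "f = ?c" by auto
    show "Ck_at t0 0 f" unfolding f by (rule center_curve_cont[OF h(1) n(1)])
    fix g assume "g \<in> set (replicate n ?c)"
    then have "g = ?c" by auto
    then show "\<exists>e. vanishing_order t0 (\<lambda>t. f t - g t) e"
      unfolding f using vanishing_order_zero by auto
  next
    show "\<forall>\<^sub>F t in nhds t0. P t = (\<Prod>f\<leftarrow>replicate n ?c. [:- f t, 1:])"
      using center_hyperbolic[OF h(1) n(1)] z[unfolded germ_zero_def]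
    proof eventually_elim
      case (elim t)
      then obtain x where x: "P t = root_poly {..<n} x" "(\<Sum>i<n. (x i - ?c t)\<^sup>2) = 0" using n(2) by auto
      then have "\<forall>i<n. (x i - ?c t)\<^sup>2 = 0" by (subst (asm) sum_nonneg_eq_0_iff) auto
      then have "root_poly {..<n} x = root_poly {..<n} (\<lambda>_. ?c t)" by (intro prod.cong) auto
      then show ?case using x(1) by (simp add: map_replicate_const)
    qed
  qed
qed

text \<open>The roots are those of the rescaled curve multiplied by \<open>(t - t0)^r\<close> and shifted by the mean; their
  contact orders increase by \<open>r\<close>.\<close>

lemma root_germs_rescale:
  assumes h: "hyperbolic_curve_near t0 n P" "n > 1"
    and rs: "rescaled_near t0 n r P Q" and L: "root_germs t0 L Q"
  shows "\<exists>L. root_germs t0 L P"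
proof (intro exI)
  let ?c = "center_curve n P"
  let ?f = "\<lambda>w t. ?c t + (t - t0) ^ r * w t"
  have n: "n \<ge> 1" using h(2) by auto
  obtain b where b: "\<forall>k\<in>{2..n}. \<exists>\<epsilon>>0. continuous_on (ball t0 \<epsilon>) (b k) \<and>
       (\<forall>t\<in>ball t0 \<epsilon>. acoeff (center (P t)) k = (t - t0) ^ (k * r) * b k t)"
    and Q: "Q = (\<lambda>t. monic_poly n (\<lambda>k. if k = 1 then 0 else b k t))"
    using rs unfolding rescaled_near_def by blast
  have beq: "\<forall>\<^sub>F t in nhds t0. \<forall>k\<in>{2..n}. acoeff (center (P t)) k = (t - t0) ^ (k * r) * b k t"
  proof (rule eventually_ball_finite; (rule ballI)?)
    fix k assume "k \<in> {2..n}"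
    then obtain \<epsilon> where \<epsilon>: "\<epsilon> > 0"
       "\<And>t. t \<in> ball t0 \<epsilon> \<Longrightarrow> acoeff (center (P t)) k = (t - t0) ^ (k * r) * b k t"
      using b by blast
    have "\<forall>\<^sub>F t in nhds t0. t \<in> ball t0 \<epsilon>" using \<epsilon>(1) by (intro eventually_nhds_in_open) auto
    then show "\<forall>\<^sub>F t in nhds t0. acoeff (center (P t)) k = (t - t0) ^ (k * r) * b k t"
      by eventually_elim (rule \<epsilon>(2))
  qed simp
  have degQ: "degree (Q t) = n" for t
  proof (rule antisym)
    show "degree (Q t) \<le> n" by (rule degree_le) (simp add: Q coeff_monic_poly)
    show "n \<le> degree (Q t)" by (rule le_degree) (simp add: Q coeff_monic_poly)
  qed
  have Qev: "\<forall>\<^sub>F t in nhds t0. Q t = root_poly {..<length L} (\<lambda>i. (L ! i) t)"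
    using L unfolding root_germs_def prod_list_eq_root_poly by blast
  have lenL: "length L = n"
    using eventually_nhds_x_imp_x[OF Qev] degQ[of t0] degree_root_poly[of "{..<length L}" "\<lambda>i. (L ! i) t0"]
    by simp
  show "root_germs t0 (map ?f L) P"
    unfolding root_germs_def
  proof (intro conjI ballI)
    fix f assume "f \<in> set (map ?f L)"
    then obtain w where w: "w \<in> set L" "f = ?f w" by auto
    have "\<forall>\<^sub>F t in nhds t0. isCont w t" "\<forall>\<^sub>F t in nhds t0. isCont ?c t"
      using L w(1) center_curve_cont[OF h(1) n] unfolding root_germs_def by auto
    then show "Ck_at t0 0 f" unfolding w(2) Ck_at.simps
      by eventually_elim (auto intro!: continuous_intros)
    fix g assume "g \<in> set (map ?f L)"
    then obtain v where v: "v \<in> set L" "g = ?f v" by auto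
    obtain e where "vanishing_order t0 (\<lambda>t. w t - v t) e"
      using L w(1) v(1) unfolding root_germs_def by blast
    from vanishing_order_mult_power[OF this, of r]
    have "vanishing_order t0 (\<lambda>t. f t - g t) (e + enat r)"
      unfolding w(2) v(2) by (simp add: algebra_simps)
    then show "\<exists>e. vanishing_order t0 (\<lambda>t. f t - g t) e" by blast
  next
    show "\<forall>\<^sub>F t in nhds t0. P t = (\<Prod>f\<leftarrow>map ?f L. [:- f t, 1:])"
      using center_hyperbolic[OF h(1) n] beq Qev
    proof eventually_elim
      case (elim t)
      let ?w = "\<lambda>i. (L ! i) t"
      obtain x where x: "P t = root_poly {..<n} x"
        "center (P t) = root_poly {..<n} (\<lambda>i. x i - ?c t)" "(\<Sum>i<n. x i - ?c t) = 0"
        using elim(1) by blast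
      have Qt: "Q t = root_poly {..<n} ?w" using elim(3) lenL by simp
      have degc: "degree (center (P t)) = n" unfolding x(2) by (simp only: degree_root_poly[OF finite_lessThan] card_lessThan)
      have eq: "center (P t) = root_poly {..<n} (\<lambda>i. (t - t0) ^ r * ?w i)"
      proof (rule poly_eqI)
        fix j
        consider "j = n" | "j > n" | "Suc j = n" | "j + 2 \<le> n" by linarith
        then show "coeff (center (P t)) j = coeff (root_poly {..<n} (\<lambda>i. (t - t0) ^ r * ?w i)) j"
        proof cases
          case 1
          then show ?thesis unfolding x(2)
            using coeff_root_poly_card[where S = "{..<n}"] by (simp only: card_lessThan finite_lessThan)
        next
          case 2
          then show ?thesis
            using degc degree_root_poly[OF finite_lessThan[of n], where x = "\<lambda>i. (t - t0) ^ r * ?w i"]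
            by (simp add: coeff_eq_0)
        next
          case 3
          have sc: "coeff (root_poly {..<n} (\<lambda>i. (t - t0) ^ r * ?w i)) j
              = ((t - t0) ^ r) ^ (n - j) * coeff (Q t) j"
            unfolding Qt using coeff_root_poly_scale[of "{..<n}" j] 3 unfolding card_lessThan by auto
          have "coeff (center (P t)) j = 0"
            unfolding x(2) using root_poly_first_coeff[of "{..<n}" j "\<lambda>i. x i - ?c t"] 3 x(3) by simp
          moreover have "n - j = 1" "j < n" using 3 by auto
          then have "coeff (Q t) j = 0" unfolding Q coeff_monic_poly by simp
          ultimately show ?thesis using sc by simp
        next
          case 4
          have sc: "coeff (root_poly {..<n} (\<lambda>i. (t - t0) ^ r * ?w i)) j
              = ((t - t0) ^ r) ^ (n - j) * coeff (Q t) j"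
            unfolding Qt using coeff_root_poly_scale[of "{..<n}" j] 4 unfolding card_lessThan by auto
          have k: "n - j \<in> {2..n}" "n - j \<noteq> 1" "j < n" "j \<noteq> n" "n - (n - j) = j" using 4 by auto
          have "acoeff (center (P t)) (n - j) = (- 1) ^ (n - j) * coeff (center (P t)) j"
            unfolding acoeff_def degc k(5) ..
          also have "acoeff (center (P t)) (n - j) = (t - t0) ^ ((n - j) * r) * b (n - j) t"
            using elim(2) k(1) by blast
          finally have 1: "(- 1) ^ (n - j) * coeff (center (P t)) j = (t - t0) ^ ((n - j) * r) * b (n - j) t" ..
          have "coeff (center (P t)) j = ((- 1) ^ (n - j) * (- 1) ^ (n - j)) * coeff (center (P t)) j"
            by (simp add: power_mult_distrib[symmetric])
          also have "\<dots> = (- 1) ^ (n - j) * ((t - t0) ^ ((n - j) * r) * b (n - j) t)"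
            unfolding mult.assoc 1 ..
          also have "\<dots> = ((t - t0) ^ r) ^ (n - j) * ((- 1) ^ (n - j) * b (n - j) t)"
            by (simp add: power_mult[symmetric] mult.commute mult.left_commute)
          also have "(- 1) ^ (n - j) * b (n - j) t = coeff (Q t) j"
            unfolding Q coeff_monic_poly using k by simp
          finally show ?thesis unfolding sc .
        qed
      qed
      have shift: "pcompose (root_poly {..<n} y) [:- a, 1:] = root_poly {..<n} (\<lambda>i. a + y i)" for y a
        unfolding pcompose_prod by (simp add: pcompose_pCons algebra_simps)
      have "P t = root_poly {..<n} (\<lambda>i. ?c t + (x i - ?c t))" unfolding x(1) by simp
      also have "\<dots> = pcompose (center (P t)) [:- ?c t, 1:]" unfolding x(2) shift ..
      also have "\<dots> = root_poly {..<n} (\<lambda>i. ?c t + (t - t0) ^ r * ?w i)" unfolding eq shift ..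
      also have "\<dots> = (\<Prod>f\<leftarrow>map ?f L. [:- f t, 1:])"
        unfolding prod_list_eq_root_poly length_map lenL by (intro prod.cong) (auto simp: lenL)
      finally show ?case .
    qed
  qed
qed

lemma splitting_tree_root_germs: "splitting_tree t0 P T \<Longrightarrow> \<exists>L. root_germs t0 L P"
proof (induction rule: splitting_tree.induct)
  case (splitting_tree_linear P)
  then show ?case by (rule root_germs_linear)
next
  case (splitting_tree_factor n P Ps Ts)
  show ?case
  proof (rule root_germs_factor)
    show "factors_near t0 P Ps" by fact
    fix Q assume "Q \<in> set Ps"
    then show "\<exists>L. root_germs t0 L Q"
      using splitting_tree_factor(7) by (auto simp: list_all2_conv_all_nth in_set_conv_nth)
  qed
next
  case (splitting_tree_rescale n P r Q T)
  then obtain L where "root_germs t0 L Q" by blast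
  with splitting_tree_rescale show ?case by (intro root_germs_rescale)
next
  case (splitting_tree_coincide n P)
  then show ?case by (intro root_germs_coincide)
qed

section \<open>Gluing local parameterizations\<close>

definition parameterizes :: "nat \<Rightarrow> nat \<Rightarrow> (real \<Rightarrow> real poly) \<Rightarrow> (nat \<Rightarrow> real \<Rightarrow> real) \<Rightarrow> real set \<Rightarrow> bool" where
  "parameterizes k n P l U \<longleftrightarrow> (\<forall>t\<in>U. P t = root_poly {1..n} (\<lambda>i. l i t) \<and> (\<forall>i\<in>{1..n}. Ck_at t k (l i)))"

lemma parameterizes_mono: "parameterizes k n P l U \<Longrightarrow> V \<subseteq> U \<Longrightarrow> parameterizes k n P l V"
  unfolding parameterizes_def by blast

lemma root_poly_eq_permutes:
  assumes "finite S" "root_poly S x = root_poly S y"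
  shows "\<exists>\<sigma>. \<sigma> permutes S \<and> (\<forall>i\<in>S. x i = y (\<sigma> i))"
proof -
  have "proots (root_poly S z) = image_mset z (mset_set S)" for z
    by (subst proots_prod) (use assms(1) in \<open>auto simp: sum_unfold_sum_mset\<close>)
  then have "image_mset x (mset_set S) = image_mset y (mset_set S)" using assms(2) by metis
  then show ?thesis using image_mset_eq_implies_permutes[OF assms(1)] by metis
qed

text \<open>The number of distinct roots cannot drop near \<open>t0\<close>, since continuous functions through different
  roots stay apart. If it cannot rise either, then nearby roots are exhausted by these functions, and
  two root functions that meet at \<open>t0\<close> follow the same one.\<close>

lemma coincide_near_max_card:
  fixes t0 :: real and F :: "(real \<Rightarrow> real) set"
  assumes cont: "\<And>f. f \<in> F \<Longrightarrow> isCont f t0"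
    and roots: "\<forall>\<^sub>F t in nhds t0. finite (R t) \<and> card (R t) \<le> card (R t0)"
    and all: "\<forall>\<^sub>F t in nhds t0. \<forall>f\<in>F. f t \<in> R t" and sur: "R t0 \<subseteq> (\<lambda>f. f t0) ` F"
    and fg: "f \<in> F" "g \<in> F" "f t0 = (g t0 :: real)"
  shows "\<forall>\<^sub>F t in nhds t0. f t = g t"
proof -
  have finR: "finite (R t0)" using eventually_nhds_x_imp_x[OF roots] by blast
  \<comment> \<open>For each root \<open>v\<close> at \<open>t0\<close>, \<open>h v\<close> is one root function through \<open>v\<close>.\<close>
  have "\<forall>v\<in>R t0. \<exists>f. f \<in> F \<and> f t0 = v" using sur by (auto simp: subset_iff image_iff)
  from bchoice[OF this] obtain h where h: "\<And>v. v \<in> R t0 \<Longrightarrow> h v \<in> F" "\<And>v. v \<in> R t0 \<Longrightarrow> h v t0 = v" by blast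
  have sep: "\<forall>\<^sub>F t in nhds t0. u t \<noteq> v t" if "u \<in> F" "v \<in> F" "u t0 \<noteq> v t0" for u v
  proof -
    have "\<forall>\<^sub>F t in nhds t0. u t - v t \<noteq> 0"
      by (rule isCont_nonzero_near) (use that(3) cont[OF that(1)] cont[OF that(2)] in auto)
    then show ?thesis by eventually_elim simp
  qed
  have 1: "\<forall>\<^sub>F t in nhds t0. \<forall>v\<in>R t0. \<forall>w\<in>R t0 - {v}. h v t \<noteq> h w t"
  proof (rule eventually_ball_finite[OF finR], rule ballI, rule eventually_ball_finite, simp add: finR, rule ballI)
    fix v w assume v: "v \<in> R t0" and w: "w \<in> R t0 - {v}"
    show "\<forall>\<^sub>F t in nhds t0. h v t \<noteq> h w t"
      by (rule sep) (use h v w in auto)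
  qed
  have 2: "\<forall>\<^sub>F t in nhds t0. \<forall>w\<in>R t0 - {u t0}. u t \<noteq> h w t" if u: "u \<in> F" for u
  proof (rule eventually_ball_finite, simp add: finR, rule ballI)
    fix w assume w: "w \<in> R t0 - {u t0}"
    show "\<forall>\<^sub>F t in nhds t0. u t \<noteq> h w t"
      by (rule sep[OF u]) (use h w in auto)
  qed
  show ?thesis using roots all 1 2[OF fg(1)] 2[OF fg(2)]
  proof eventually_elim
    case (elim t)
    have inj: "inj_on (\<lambda>v. h v t) (R t0)" using elim(3) by (intro inj_onI) blast
    have sub: "(\<lambda>v. h v t) ` R t0 \<subseteq> R t" using elim(2) h(1) by blast
    have "card ((\<lambda>v. h v t) ` R t0) = card (R t0)" using inj by (rule card_image)
    then have eq: "(\<lambda>v. h v t) ` R t0 = R t"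
      using elim(1) sub card_mono[OF _ sub] by (intro card_subset_eq) auto
    have "f t = h (f t0) t"
    proof -
      have "f t \<in> (\<lambda>v. h v t) ` R t0" using eq elim(2) fg(1) by simp
      then show ?thesis using elim(4) by auto
    qed
    moreover have "g t = h (g t0) t"
    proof -
      have "g t \<in> (\<lambda>v. h v t) ` R t0" using eq elim(2) fg(2) by simp
      then show ?thesis using elim(5) by auto
    qed
    ultimately show ?case using fg(3) by simp
  qed
qed

text \<open>In the overlap there is a point at which the number of distinct roots is maximal. A permutation that
  matches the values there matches the germs, and one may switch from one family to the other.\<close>

lemma parameterizes_glue:
  assumes l: "parameterizes k n P l {a<..<b}" and m: "parameterizes k n P m {c<..<d}"
    and ord: "a \<le> c" "c < b" "b \<le> d"
  shows "\<exists>l. parameterizes k n P l {a<..<d}"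
proof -
  let ?S = "{1..n}"
  define R where "R = (\<lambda>t. {x. poly (P t) x = 0})"
  have Rl: "R t = (\<lambda>i. l i t) ` ?S" if "t \<in> {a<..<b}" for t
  proof -
    have "P t = root_poly ?S (\<lambda>i. l i t)" using l that unfolding parameterizes_def by blast
    then show ?thesis unfolding R_def using poly_root_poly[of ?S] by auto
  qed
  have fin: "finite (R t)" "card (R t) \<le> n" if "t \<in> {a<..<b}" for t
    using Rl[OF that] card_image_le[of ?S "\<lambda>i. l i t"] by auto
  let ?I = "{c<..<b}"
  have "\<exists>t. t \<in> ?I \<and> (\<forall>u. u \<in> ?I \<longrightarrow> card (R u) \<le> card (R t))"
  proof (rule ex_has_greatest_nat)
    show "(c + b) / 2 \<in> ?I" using ord by auto
    show "\<forall>u. u \<in> ?I \<longrightarrow> card (R u) < Suc n"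
      using fin(2) ord by (auto simp: less_Suc_eq_le)
  qed
  then obtain t1 where t1: "t1 \<in> ?I" "\<And>u. u \<in> ?I \<Longrightarrow> card (R u) \<le> card (R t1)" by blast
  have I_sub: "?I \<subseteq> {a<..<b}" "?I \<subseteq> {c<..<d}" using ord by auto
  have Pl: "P t = root_poly ?S (\<lambda>i. l i t)" "\<And>i. i \<in> ?S \<Longrightarrow> Ck_at t k (l i)" if "t \<in> {a<..<b}" for t
    using l that unfolding parameterizes_def by blast+
  have Pm: "P t = root_poly ?S (\<lambda>i. m i t)" "\<And>i. i \<in> ?S \<Longrightarrow> Ck_at t k (m i)" if "t \<in> {c<..<d}" for t
    using m that unfolding parameterizes_def by blast+
  have t1l: "t1 \<in> {a<..<b}" and t1m: "t1 \<in> {c<..<d}" using t1(1) I_sub by auto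
  obtain \<sigma> where \<sigma>: "\<sigma> permutes ?S" "\<And>i. i \<in> ?S \<Longrightarrow> l i t1 = m (\<sigma> i) t1"
    using root_poly_eq_permutes[of ?S "\<lambda>i. l i t1" "\<lambda>i. m i t1"] Pl(1)[OF t1l] Pm(1)[OF t1m] by auto
  have \<sigma>S: "\<sigma> i \<in> ?S" if "i \<in> ?S" for i using \<sigma>(1) that by (simp only: permutes_in_image)
  let ?F = "l ` ?S \<union> m ` ?S"
  have evI: "\<forall>\<^sub>F t in nhds t1. t \<in> ?I" using t1(1) by (intro eventually_nhds_in_open) auto
  have contF: "isCont f t1" if "f \<in> ?F" for f
    using that Ck_at_imp_isCont[OF Pl(2)[OF t1l], THEN eventually_nhds_x_imp_x]
      Ck_at_imp_isCont[OF Pm(2)[OF t1m], THEN eventually_nhds_x_imp_x] by blast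
  have near: "\<forall>\<^sub>F t in nhds t1. l i t = m (\<sigma> i) t" if i: "i \<in> ?S" for i
  proof (rule coincide_near_max_card[where R = R and F = ?F])
    show "\<forall>\<^sub>F t in nhds t1. finite (R t) \<and> card (R t) \<le> card (R t1)"
      using evI by eventually_elim (use fin(1) t1(2) I_sub in blast)
    show "\<forall>\<^sub>F t in nhds t1. \<forall>f\<in>?F. f t \<in> R t"
      using evI
    proof eventually_elim
      case (elim t)
      then have tl: "t \<in> {a<..<b}" and tm: "t \<in> {c<..<d}" using I_sub by auto
      have "m j t \<in> R t" if "j \<in> ?S" for j
        unfolding R_def Pm(1)[OF tm] using that poly_root_poly[of ?S] by auto
      then show ?case using Rl[OF tl] by auto
    qed
    show "R t1 \<subseteq> (\<lambda>f. f t1) ` ?F" using Rl[OF t1l] by auto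
  qed (use i \<sigma>S \<sigma>(2) contF in auto)
  define q where "q = (\<lambda>i t. if t < t1 then l i t else m (\<sigma> i) t)"
  have "parameterizes k n P q {a<..<d}"
    unfolding parameterizes_def
  proof (intro ballI conjI)
    fix t assume t: "t \<in> {a<..<d}"
    show "P t = root_poly ?S (\<lambda>i. q i t)"
    proof (cases "t < t1")
      case True
      then have "t \<in> {a<..<b}" using t t1 by auto
      from Pl(1)[OF this] show ?thesis using True by (simp add: q_def)
    next
      case False
      then have "t \<in> {c<..<d}" using t t1 by auto
      from Pm(1)[OF this] have "P t = root_poly ?S (\<lambda>i. m i t)" .
      also have "\<dots> = (\<Prod>i\<in>?S. [:- m (\<sigma> i) t, 1:])"
        using prod.permute[OF \<sigma>(1), of "\<lambda>i. [:- m i t, 1:]"] by (simp add: o_def)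
      finally show ?thesis using False by (simp add: q_def)
    qed
    fix i assume i: "i \<in> ?S"
    consider "t < t1" | "t = t1" | "t > t1" by linarith
    then show "Ck_at t k (q i)"
    proof cases
      case 1
      then have "\<forall>\<^sub>F u in nhds t. u \<in> {..<t1}" by (intro eventually_nhds_in_open) auto
      then have "\<forall>\<^sub>F u in nhds t. q i u = l i u" by eventually_elim (simp add: q_def)
      from Ck_at_cong[OF this] show ?thesis using Pl(2)[of t i] i t t1 1 by auto
    next
      case 2
      have "\<forall>\<^sub>F u in nhds t1. q i u = l i u" using near[OF i] by eventually_elim (simp add: q_def)
      from Ck_at_cong[OF this] show ?thesis using Pl(2)[OF t1l i] 2 by blast
    next
      case 3
      have "\<forall>\<^sub>F u in nhds t. u \<in> {t1<..}" using 3 by (intro eventually_nhds_in_open) auto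
      then have "\<forall>\<^sub>F u in nhds t. q i u = m (\<sigma> i) u" by eventually_elim (simp add: q_def)
      from Ck_at_cong[OF this] show ?thesis using Pm(2)[of t "\<sigma> i"] \<sigma>S[OF i] t t1 3 by auto
    qed
  qed
  then show ?thesis by blast
qed

text \<open>Bolzano's form of compactness: the property holds for short intervals and is additive by gluing.\<close>

lemma global_parameterization:
  assumes "A \<le> B" and I: "open I" "is_interval I" "{A..B} \<subseteq> I"
    and loc: "\<And>t. t \<in> {A..B} \<Longrightarrow> \<exists>\<epsilon>>0. \<exists>l. parameterizes k n P l {t-\<epsilon><..<t+\<epsilon>}"
  shows "\<exists>a b l. a < A \<and> B < b \<and> {a<..<b} \<subseteq> I \<and> parameterizes k n P l {a<..<b}"
proof -
  define good where "good x y \<longleftrightarrow> ({x..y} \<subseteq> {A..B} \<longrightarrow> x \<le> y \<longrightarrow>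
     (\<exists>a b l. a < x \<and> y < b \<and> {a<..<b} \<subseteq> I \<and> parameterizes k n P l {a<..<b}))" for x y
  have "good A B"
    using assms(1)
  proof (induction rule: Bolzano)
    case (trans x y z)
    show ?case unfolding good_def
    proof (intro impI)
      assume xz: "{x..z} \<subseteq> {A..B}"
      have "\<exists>a b l. a < x \<and> y < b \<and> {a<..<b} \<subseteq> I \<and> parameterizes k n P l {a<..<b}"
        using trans xz unfolding good_def by auto
      then obtain a b l where 1: "a < x" "y < b" "{a<..<b} \<subseteq> I" "parameterizes k n P l {a<..<b}" by blast
      have "\<exists>a b l. a < y \<and> z < b \<and> {a<..<b} \<subseteq> I \<and> parameterizes k n P l {a<..<b}"
        using trans xz unfolding good_def by auto
      then obtain c d m where 2: "c < y" "z < d" "{c<..<d} \<subseteq> I" "parameterizes k n P m {c<..<d}" by blast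
      let ?c = "max a c" and ?d = "max b d"
      show "\<exists>a b l. a < x \<and> z < b \<and> {a<..<b} \<subseteq> I \<and> parameterizes k n P l {a<..<b}"
      proof (cases "b \<le> d")
        case True
        have "parameterizes k n P m {?c<..<d}" using 2(4) by (rule parameterizes_mono) auto
        from parameterizes_glue[OF 1(4) this] obtain q where "parameterizes k n P q {a<..<d}"
          using 1 2 True trans by auto
        moreover have "{a<..<d} \<subseteq> I"
        proof
          fix u assume "u \<in> {a<..<d}"
          then have "u \<in> {a<..<b} \<or> u \<in> {c<..<d}" using 1 2 by auto
          then show "u \<in> I" using 1 2 by blast
        qed
        ultimately show ?thesis using 1 2 by blast
      next
        case False
        then show ?thesis using 1 2 trans by (intro exI[of _ a] exI[of _ b] exI[of _ l]) auto
      qed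
    qed
  next
    case (local x)
    then obtain \<epsilon> l where \<epsilon>: "\<epsilon> > 0" "parameterizes k n P l {x-\<epsilon><..<x+\<epsilon>}" using loc[of x] by auto
    have "x \<in> I" using local I(3) by auto
    then obtain \<delta> where \<delta>: "\<delta> > 0" "ball x \<delta> \<subseteq> I" using I(1) openE by blast
    define \<eta> where "\<eta> = min \<epsilon> \<delta>"
    have \<eta>: "\<eta> > 0" "{x-\<eta><..<x+\<eta>} \<subseteq> I" "parameterizes k n P l {x-\<eta><..<x+\<eta>}"
    proof -
      show "\<eta> > 0" using \<epsilon> \<delta> by (simp add: \<eta>_def)
      have "{x-\<eta><..<x+\<eta>} \<subseteq> ball x \<delta>" by (auto simp: \<eta>_def dist_real_def)
      then show "{x-\<eta><..<x+\<eta>} \<subseteq> I" using \<delta>(2) by blast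
      show "parameterizes k n P l {x-\<eta><..<x+\<eta>}" using \<epsilon>(2) by (rule parameterizes_mono) (auto simp: \<eta>_def)
    qed
    show ?case
    proof (intro exI[of _ "\<eta>"] conjI allI impI \<eta>(1))
      fix a b assume ab: "a \<le> x \<and> x \<le> b \<and> b - a < \<eta>"
      show "good a b" unfolding good_def
        using ab \<eta> by (intro impI exI[of _ "x - \<eta>"] exI[of _ "x + \<eta>"] exI[of _ l]) auto
    qed
  qed
  then show ?thesis using assms(1) unfolding good_def by auto
qed

lemma root_family_near:
  assumes "splitting_tree t0 P T"
  shows "\<exists>S l e. root_family t0 S l e P"
  using root_germs_imp_root_family splitting_tree_root_germs[OF assms] by blast

lemma vanishing_order_near:
  assumes "vanishing_order t0 f e" "\<forall>\<^sub>F t in nhds t0. isCont f t"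
  shows "\<forall>\<^sub>F t in at t0. vanishing_order t f (if e = \<infinity> then \<infinity> else 0)"
proof (cases e)
  case (enat m)
  then obtain u where u: "isCont u t0" "u t0 \<noteq> 0" "\<forall>\<^sub>F t in nhds t0. f t = (t - t0) ^ m * u t"
    using assms(1) unfolding vanishing_order_def by auto
  show ?thesis
    using eventually_at_nhds[OF u(3)] eventually_at_nhds[OF isCont_nonzero_near[OF u(1,2)]]
      eventually_at_nhds[OF assms(2)] eventually_ne_at
    by eventually_elim (use enat in \<open>auto intro: vanishing_order_nonzeroI\<close>)
next
  case infinity
  then have "\<forall>\<^sub>F t in nhds t0. f t = 0" using assms(1) unfolding vanishing_order_def germ_zero_def by simp
  then have "\<forall>\<^sub>F t in nhds t0. \<forall>\<^sub>F u in nhds t. f u = 0" by (simp add: eventually_eventually)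
  from eventually_at_nhds[OF this] show ?thesis
    by eventually_elim (simp add: infinity vanishing_order_def germ_zero_def)
qed

lemma generic_numbers:
  assumes "finite S" "S \<noteq> {}" "\<And>i j. i \<in> S \<Longrightarrow> j \<in> S \<Longrightarrow> e i j = \<infinity> \<or> e i j = 0"
  shows "max_order e S = 0"
proof -
  have 1: "last_contact e S i = 0" if "i \<in> S" for i
  proof -
    have "finite_part (e i j) = 0" if "j \<in> S" for j
      using assms(3)[OF \<open>i \<in> S\<close> that] by (auto simp: finite_part_def zero_enat_def)
    then have "(\<lambda>j. finite_part (e i j)) ` S = {0}" using assms(2) by auto
    then show ?thesis by (simp add: last_contact_def)
  qed
  have 2: "root_loss e S i = 0" if "i \<in> S" for i
    unfolding root_loss_def
  proof (rule sum.neutral, rule ballI)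
    fix j assume "j \<in> S - {i}"
    then show "(case e i j of enat m \<Rightarrow> m | \<infinity> \<Rightarrow> last_contact e S i) = 0"
      using assms(3)[OF that, of j] 1[OF that] by (auto simp: zero_enat_def)
  qed
  have "(\<lambda>i. root_loss e S i + last_contact e S i) ` S = {0}" using 1 2 assms(2) by auto
  then show ?thesis by (simp add: max_order_def)
qed

text \<open>Away from \<open>t0\<close> a difference of roots \<open>(t - t0)^e u\<close> does not vanish, so that the only contact orders
  are \<open>0\<close> and \<open>\<infinity>\<close>.\<close>

lemma Gamma_at_near:
  assumes rf: "root_family t0 S l e P" and S: "S \<noteq> {}"
  shows "\<forall>\<^sub>F t in at t0. \<forall>G g. split_orders t P G g \<longrightarrow> Gamma_at t P = 0"
proof -
  note fin = root_family_finite[OF rf]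
  have cont: "\<forall>\<^sub>F t in nhds t0. \<forall>i\<in>S. Ck_at t 0 (l i)"
  proof (rule eventually_ball_finite[OF fin], rule ballI)
    fix i assume "i \<in> S"
    from root_family_cont[OF rf this] show "\<forall>\<^sub>F t in nhds t0. Ck_at t 0 (l i)"
      by (simp add: eventually_eventually)
  qed
  have ord: "\<forall>\<^sub>F t in at t0. \<forall>i\<in>S. \<forall>j\<in>S. vanishing_order t (\<lambda>t. l i t - l j t) (if e i j = \<infinity> then \<infinity> else 0)"
  proof (intro eventually_ball_finite fin ballI vanishing_order_near)
    fix i j assume ij: "i \<in> S" "j \<in> S"
    show "vanishing_order t0 (\<lambda>t. l i t - l j t) (e i j)" by (rule root_family_contact[OF rf ij])
    have "\<forall>\<^sub>F t in nhds t0. isCont (l i) t" "\<forall>\<^sub>F t in nhds t0. isCont (l j) t"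
      using root_family_cont[OF rf] ij by auto
    then show "\<forall>\<^sub>F t in nhds t0. isCont (\<lambda>t. l i t - l j t) t"
      by eventually_elim (intro continuous_intros)
  qed
  have eq: "\<forall>\<^sub>F t in nhds t0. \<forall>\<^sub>F u in nhds t. P u = root_poly S (\<lambda>i. l i u)"
    using root_family_eq[OF rf] by (simp add: eventually_eventually)
  from eventually_at_nhds[OF cont] ord eventually_at_nhds[OF eq] show ?thesis
  proof eventually_elim
    case (elim t)
    have rft: "root_family t S l (\<lambda>i j. if e i j = \<infinity> then \<infinity> else 0) P"
      unfolding root_family_def using fin elim by blast
    show ?case
    proof (intro allI impI)
      fix G g assume "split_orders t P G g"
      from split_orders_values(1)[OF this rft S] show "Gamma_at t P = 0"
        using generic_numbers[OF fin S, of "\<lambda>i j. if e i j = \<infinity> then \<infinity> else 0"] by simp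
    qed
  qed
qed

section \<open>Global parameterization\<close>

text \<open>Every point of \<open>J\<close> has a neighbourhood in \<open>J\<close> on which \<open>\<Gamma>\<close> is bounded by its value at this point.\<close>

lemma finite_Gamma_on:
  assumes "compact J" "J \<noteq> {}"
    and rec: "\<And>t. t \<in> J \<Longrightarrow> \<exists>G g. split_orders t P G g"
    and rf: "\<And>t. t \<in> J \<Longrightarrow> \<exists>S l e. S \<noteq> {} \<and> root_family t S l e P"
  shows "\<exists>N. Gamma_on J P = enat N"
proof -
  have "\<exists>\<epsilon>>0. \<forall>u\<in>ball t \<epsilon> \<inter> J. Gamma_at u P \<le> Gamma_at t P" if t: "t \<in> J" for t
  proof -
    obtain S l e where S: "S \<noteq> {}" "root_family t S l e P" using rf[OF t] by blast
    have "\<forall>\<^sub>F u in nhds t. u \<in> J \<longrightarrow> Gamma_at u P \<le> Gamma_at t P"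
    proof (rule eventually_nhdsI_at)
      show "\<forall>\<^sub>F u in at t. u \<in> J \<longrightarrow> Gamma_at u P \<le> Gamma_at t P"
        using Gamma_at_near[OF S(2,1)] by eventually_elim (use rec in fastforce)
    qed simp
    then show ?thesis unfolding eventually_nhds_metric by (auto simp: dist_commute)
  qed
  then obtain \<epsilon> where \<epsilon>: "\<And>t. t \<in> J \<Longrightarrow> \<epsilon> t > 0"
    "\<And>t u. t \<in> J \<Longrightarrow> u \<in> ball t (\<epsilon> t) \<inter> J \<Longrightarrow> Gamma_at u P \<le> Gamma_at t P" by metis
  have "J \<subseteq> (\<Union>t\<in>J. ball t (\<epsilon> t))" using \<epsilon>(1) by force
  then obtain C where C: "C \<subseteq> J" "finite C" "J \<subseteq> (\<Union>t\<in>C. ball t (\<epsilon> t))"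
    using compactE_image[OF assms(1), of J "\<lambda>t. ball t (\<epsilon> t)"] by auto
  have "Gamma_at u P \<le> Max ((\<lambda>t. Gamma_at t P) ` C)" if u: "u \<in> J" for u
  proof -
    obtain t where t: "t \<in> C" "u \<in> ball t (\<epsilon> t)" using C(3) u by auto
    then have "Gamma_at u P \<le> Gamma_at t P" using \<epsilon>(2)[of t u] C(1) u by auto
    also have "\<dots> \<le> Max ((\<lambda>t. Gamma_at t P) ` C)" using t(1) C(2) by (intro Max_ge) auto
    finally show ?thesis .
  qed
  then have "Gamma_on J P \<le> enat (Max ((\<lambda>t. Gamma_at t P) ` C))"
    unfolding Gamma_on_def by (intro SUP_least) simp
  then show ?thesis by (cases "Gamma_on J P") auto
qed

lemma local_parameterization:
  assumes rf: "root_family t S l e P" and card: "card S = n"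
    and reg: "\<And>i. i \<in> S \<Longrightarrow> Ck_at t k (l i)"
  shows "\<exists>\<epsilon>>0. \<exists>l. parameterizes k n P l {t-\<epsilon><..<t+\<epsilon>}"
proof -
  note fin = root_family_finite[OF rf]
  obtain h where h: "bij_betw h {1..n} S" using ex_bij_betw_nat_finite_1[OF fin] card by auto
  have hS: "h i \<in> S" if "i \<in> {1..n}" for i using h that by (rule bij_betwE[THEN bspec])
  have "\<forall>\<^sub>F u in nhds t. \<forall>i\<in>S. Ck_at u k (l i)"
    by (intro eventually_ball_finite fin ballI Ck_at_near reg)
  then have "\<forall>\<^sub>F u in nhds t. P u = root_poly {1..n} (\<lambda>i. l (h i) u) \<and> (\<forall>i\<in>{1..n}. Ck_at u k (l (h i)))"
    using root_family_eq[OF rf]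
  proof eventually_elim
    case (elim u)
    have "root_poly S (\<lambda>i. l i u) = root_poly {1..n} (\<lambda>i. l (h i) u)"
      by (rule prod.reindex_bij_betw[OF h, symmetric])
    then show ?case using elim hS by simp
  qed
  then obtain \<epsilon> where \<epsilon>: "\<epsilon> > 0" "\<And>u. dist u t < \<epsilon> \<Longrightarrow> P u = root_poly {1..n} (\<lambda>i. l (h i) u) \<and> (\<forall>i\<in>{1..n}. Ck_at u k (l (h i)))"
    unfolding eventually_nhds_metric by blast
  have "parameterizes k n P (\<lambda>i. l (h i)) {t-\<epsilon><..<t+\<epsilon>}"
    unfolding parameterizes_def
  proof (rule ballI)
    fix u assume "u \<in> {t-\<epsilon><..<t+\<epsilon>}"
    then have "dist u t < \<epsilon>" by (auto simp: dist_real_def)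
    then show "P u = root_poly {1..n} (\<lambda>i. l (h i) u) \<and> (\<forall>i\<in>{1..n}. Ck_at u k (l (h i)))" by (rule \<epsilon>(2))
  qed
  then show ?thesis using \<epsilon>(1) by blast
qed

theorem theorem5p9:
  fixes I J :: "real set" and n p :: nat
    and a :: "nat \<Rightarrow> real \<Rightarrow> real" and P :: "real \<Rightarrow> real poly"
  assumes I: "open I" "is_interval I"
    and J: "compact J" "is_interval J" "J \<noteq> {}" "J \<subseteq> I"
    and n: "n \<ge> 1"
    and P: "\<And>t. P t = monic_poly n (\<lambda>j. a j t)"
    and hyp: "\<And>t. t \<in> I \<Longrightarrow> hyperbolic (P t)"
    and E: "E_infinity I P = {}"
    and tree: "\<And>t. t \<in> J \<Longrightarrow> \<exists>T. splitting_tree t P T \<and> thin T"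
    and p: "p > 0"
    and recursion: "\<And>t. t \<in> J \<Longrightarrow> \<exists>G g. split_orders t P G g"
    and regular: "\<And>j. j \<in> {1..n} \<Longrightarrow> Ck_on (enat p + Gamma_on J P) (a j) I"
  shows "\<exists>I' l. open I' \<and> is_interval I' \<and> J \<subseteq> I' \<and> I' \<subseteq> I \<and>
           (\<forall>j\<in>{1..n}. Ck_on (enat p + gamma_on J P) (l j) I') \<and>
           (\<forall>t\<in>I'. P t = (\<Prod>j=1..n. [:- l j t, 1:]))"
proof -
  have coeffP: "coeff (P t) i = (if i = n then 1 else if i < n then (- 1) ^ (n - i) * a (n - i) t else 0)" for t i
    unfolding P by (rule coeff_monic_poly)
  have degP: "degree (P t) = n" for t
  proof (rule antisym)
    show "degree (P t) \<le> n" by (rule degree_le) (simp add: coeffP)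
    show "n \<le> degree (P t)" by (rule le_degree) (simp add: coeffP)
  qed
  have rf: "\<exists>S l e. S \<noteq> {} \<and> card S = n \<and> root_family t S l e P" if t: "t \<in> J" for t
  proof -
    obtain S l e where rf: "root_family t S l e P" using tree[OF t] root_family_near by metis
    have "P t = root_poly S (\<lambda>i. l i t)" using root_family_eq[OF rf] by (rule eventually_nhds_x_imp_x)
    then have "card S = n" using degP[of t] degree_root_poly[OF root_family_finite[OF rf]] by simp
    moreover from this have "S \<noteq> {}" using n by auto
    ultimately show ?thesis using rf by blast
  qed
  obtain N where N: "Gamma_on J P = enat N"
    using finite_Gamma_on[OF J(1,3) recursion] rf by metis
  have GN: "Gamma_at t P \<le> N" if "t \<in> J" for t
  proof -
    have "enat (Gamma_at t P) \<le> Gamma_on J P" unfolding Gamma_on_def using that by (rule SUP_upper)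
    then show ?thesis using N by simp
  qed
  define D where "D = (SUP t\<in>J. enat (Gamma_at t P - gamma_at t P))"
  have "D \<le> enat N" unfolding D_def
    by (rule SUP_least) (use GN in \<open>auto intro: order.trans[OF diff_le_self]\<close>)
  then obtain d where d: "D = enat d" "d \<le> N" by (cases D) auto
  have dD: "Gamma_at t P - gamma_at t P \<le> d" if "t \<in> J" for t
  proof -
    have "enat (Gamma_at t P - gamma_at t P) \<le> D" unfolding D_def using that by (rule SUP_upper)
    then show ?thesis using d(1) by simp
  qed
  \<comment> \<open>With \<open>N\<close> for \<open>\<Gamma>\<close> on \<open>J\<close>, the number \<open>N - d\<close> is \<open>\<gamma>\<close> on \<open>J\<close>; the roots near \<open>t\<close> lose at most \<open>d\<close> of the
    \<open>p + N\<close> derivatives of the coefficients.\<close>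
  define k where "k = p + (N - d)"
  have gk: "enat p + gamma_on J P = enat k"
    unfolding gamma_on_def D_def[symmetric] N d(1) by (simp add: k_def)
  have reg: "Ck_at t (p + N) (\<lambda>u. coeff (P u) i)" if t: "t \<in> I" for t i
  proof (cases "i < n")
    case True
    then have "n - i \<in> {1..n}" by auto
    then have "Ck_on (enat (p + N)) (a (n - i)) I" using regular N by simp
    then have "Ck_at t (p + N) (a (n - i))" using I(1) t by (rule Ck_on_imp_Ck_at)
    then have "Ck_at t (p + N) (\<lambda>u. (- 1) ^ (n - i) * a (n - i) u)" by (intro Ck_at_mult Ck_at_const)
    then show ?thesis using True by (simp add: coeffP)
  next
    case False
    then show ?thesis by (cases "i = n") (simp_all add: coeffP Ck_at_const)
  qed
  have loc: "\<exists>\<epsilon>>0. \<exists>l. parameterizes k n P l {t-\<epsilon><..<t+\<epsilon>}" if t: "t \<in> J" for t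
  proof -
    obtain S l e where S: "S \<noteq> {}" "card S = n" "root_family t S l e P" using rf[OF t] by blast
    obtain G g where Gg: "split_orders t P G g" using recursion[OF t] by blast
    have tI: "t \<in> I" using t J(4) by blast
    have "Gamma_at t P \<le> p + N" using GN[OF t] by simp
    from root_family_regular[OF Gg S(3,1) this reg[OF tI]]
    have "Ck_at t (p + N - (Gamma_at t P - gamma_at t P)) (l i)" if "i \<in> S" for i using that .
    moreover have "k \<le> p + N - (Gamma_at t P - gamma_at t P)" using dD[OF t] d(2) by (simp add: k_def)
    ultimately have "Ck_at t k (l i)" if "i \<in> S" for i using that Ck_at_mono by blast
    then show ?thesis by (rule local_parameterization[OF S(3,2)])
  qed
  obtain A B where AB: "J = {A..B}"
    using is_interval_compact[of J] J(1,2) by (metis cbox_interval)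
  have "A \<le> B" using AB J(3) by simp
  then obtain x y l where l: "x < A" "B < y" "{x<..<y} \<subseteq> I" "parameterizes k n P l {x<..<y}"
    using global_parameterization[OF _ I, of A B k n P] loc J(4) unfolding AB by metis
  show ?thesis
    unfolding gk
  proof (intro exI[of _ "{x<..<y}"] exI[of _ l] conjI ballI)
    show "J \<subseteq> {x<..<y}" using AB l(1,2) by auto
    show "{x<..<y} \<subseteq> I" by fact
    show "is_interval {x<..<y}" by (rule is_interval_oo)
    fix j assume "j \<in> {1..n}"
    then show "Ck_on (enat k) (l j) {x<..<y}"
      using l(4) by (intro Ck_at_imp_Ck_on) (auto simp: parameterizes_def)
  next
    fix t assume "t \<in> {x<..<y}"
    then show "P t = (\<Prod>j = 1..n. [:- l j t, 1:])"
      using l(4) unfolding parameterizes_def by blast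
  qed simp
qed

end
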